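(* Let $G$ be a finitely generated group. (1) If $G$ is constricted, then every asymptotic cone of $G$ is either simply connected or its fundamental group contains an uncountably generated free subgroup. (2) If $G$ is not wide, then $G$ has an asymptotic cone which is either simply connected or whose fundamental group contains an uncountably generated free subgroup.
   Context: Asymptotic cones. Let $(X,\mathrm{dist})$ be a metric space, $\omega$ an ultrafilter on $\mathbb N$, $e=(e_n)$ a sequence of points of $X$ (observation sequence), and $d=(d_n)$ a sequence of positive reals that is $\omega$-divergent, i.e. $\omega(\{n : d_n>M\})=1$ for every $M$ (scaling sequence; its existence forces $\omega$ to be non-principal). The asymptotic cone $\mathrm{Con}^\omega(X,e,d)$ is the set of sequences $(x_n)\in\prod X$ with $\lim^\omega \mathrm{dist}(x_n,e_n)/d_n<\infty$, modulo the relation $\lim^\omega \mathrm{dist}(x_n,y_n)/d_n=0$, with metric $\lim^\omega \mathrm{dist}(x_n,y_n)/d_n$. An asymptotic cone of a finitely generated group $G$ is an asymptotic cone of its Cayley graph with respect to a finite generating set (equivalently of $G$ with the word metric). A point $x$ of a connected space $Y$ is a global cut-point if $Y\setminus\{x\}$ has at least two connected components. $G$ is constricted if all of its asymptotic cones have global cut-points; $G$ is wide if none of its asymptotic cones has a global cut-point. *)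

theory Defs
  imports "HOL-Analysis.Analysis" "HOL-Algebra.Generated_Groups"
begin

section \<open>Ultrafilters and ultralimits\<close>

text \<open>A set \<open>A\<close> has \<open>\<omega>\<close>-measure one iff \<open>eventually (\<lambda>n. n \<in> A) \<omega>\<close>.\<close>

definition ultrafilter :: "'a filter \<Rightarrow> bool" where
  "ultrafilter \<omega> \<longleftrightarrow>
     \<omega> \<noteq> bot \<and> (\<forall>P. eventually P \<omega> \<or> eventually (\<lambda>n. \<not> P n) \<omega>)"

text \<open>Ultralimits are taken in the compact space of extended reals, where they always exist.\<close>

definition ultralim :: "'a filter \<Rightarrow> ('a \<Rightarrow> real) \<Rightarrow> ereal" where
  "ultralim \<omega> f = Lim \<omega> (\<lambda>n. ereal (f n))"


section \<open>Asymptotic cones of metric spaces\<close>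

definition scaling_sequence :: "nat filter \<Rightarrow> (nat \<Rightarrow> real) \<Rightarrow> bool" where
  "scaling_sequence \<omega> d \<longleftrightarrow>
     (\<forall>n. d n > 0) \<and> (\<forall>M. eventually (\<lambda>n. d n > M) \<omega>)"

definition observation_sequence :: "'a metric \<Rightarrow> (nat \<Rightarrow> 'a) \<Rightarrow> bool" where
  "observation_sequence X e \<longleftrightarrow> (\<forall>n. e n \<in> mspace X)"

definition cone_dist ::
  "'a metric \<Rightarrow> nat filter \<Rightarrow> (nat \<Rightarrow> real) \<Rightarrow> (nat \<Rightarrow> 'a) \<Rightarrow> (nat \<Rightarrow> 'a) \<Rightarrow> ereal" where
  "cone_dist X \<omega> d x y = ultralim \<omega> (\<lambda>n. mdist X (x n) (y n) / d n)"

definition cone_sequences ::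
  "'a metric \<Rightarrow> nat filter \<Rightarrow> (nat \<Rightarrow> 'a) \<Rightarrow> (nat \<Rightarrow> real) \<Rightarrow> (nat \<Rightarrow> 'a) set" where
  "cone_sequences X \<omega> e d = {x. (\<forall>n. x n \<in> mspace X) \<and> cone_dist X \<omega> d x e < \<infinity>}"

definition cone_rel ::
  "'a metric \<Rightarrow> nat filter \<Rightarrow> (nat \<Rightarrow> 'a) \<Rightarrow> (nat \<Rightarrow> real) \<Rightarrow> ((nat \<Rightarrow> 'a) \<times> (nat \<Rightarrow> 'a)) set" where
  "cone_rel X \<omega> e d =
     {(x, y). x \<in> cone_sequences X \<omega> e d \<and> y \<in> cone_sequences X \<omega> e d \<and> cone_dist X \<omega> d x y = 0}"

definition asymptotic_cone ::
  "'a metric \<Rightarrow> nat filter \<Rightarrow> (nat \<Rightarrow> 'a) \<Rightarrow> (nat \<Rightarrow> real) \<Rightarrow> (nat \<Rightarrow> 'a) set metric" where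
  "asymptotic_cone X \<omega> e d =
     metric (cone_sequences X \<omega> e d // cone_rel X \<omega> e d,
             \<lambda>A B. real_of_ereal (cone_dist X \<omega> d (SOME x. x \<in> A) (SOME y. y \<in> B)))"

text \<open>
  The constructor \<^const>\<open>metric\<close> is only meaningful on pairs satisfying \<^const>\<open>Metric_space\<close>.
  The next lemmas show that this is the case and that the distance does not depend on the
  representatives.
\<close>

lemma tendsto_ultralim:
  assumes "ultrafilter \<omega>"
  shows "((\<lambda>n. ereal (f n)) \<longlongrightarrow> ultralim \<omega> f) \<omega>"
proof -
  let ?F = "filtermap (\<lambda>n. ereal (f n)) \<omega>"
  have nb: "?F \<noteq> bot"
    using assms by (simp add: ultrafilter_def filtermap_bot_iff)
  obtain l where l: "inf (nhds l) ?F \<noteq> bot"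
    using compact_UNIV[where 'a = ereal] nb unfolding compact_filter by auto
  have "((\<lambda>n. ereal (f n)) \<longlongrightarrow> l) \<omega>"
  proof (rule topological_tendstoI)
    fix S assume S: "open S" "l \<in> S"
    show "eventually (\<lambda>n. ereal (f n) \<in> S) \<omega>"
    proof (rule ccontr)
      assume "\<not> ?thesis"
      hence "eventually (\<lambda>n. ereal (f n) \<notin> S) \<omega>"
        using assms unfolding ultrafilter_def by blast
      hence "eventually (\<lambda>z. z \<notin> S) ?F" by (simp add: eventually_filtermap)
      moreover have "eventually (\<lambda>z. z \<in> S) (nhds l)"
        using S by (rule eventually_nhds_in_open)
      ultimately have "eventually (\<lambda>z. False) (inf (nhds l) ?F)"
        unfolding eventually_inf by blast
      thus False using l by (simp add: eventually_False)
    qed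
  qed
  moreover have "\<omega> \<noteq> bot" using assms by (simp add: ultrafilter_def)
  ultimately show ?thesis
    unfolding ultralim_def using tendsto_Lim[of \<omega>] by metis
qed

context
  fixes X :: "'a metric" and \<omega> :: "nat filter" and e :: "nat \<Rightarrow> 'a" and d :: "nat \<Rightarrow> real"
  assumes uf: "ultrafilter \<omega>" and sc: "scaling_sequence \<omega> d" and ob: "observation_sequence X e"
begin

lemma dpos: "d n > 0"
  using sc by (simp add: scaling_sequence_def)

lemma \<omega>_nontrivial: "\<omega> \<noteq> bot"
  using uf by (simp add: ultrafilter_def)

lemma tendsto_cone_dist:
  "((\<lambda>n. ereal (mdist X (x n) (y n) / d n)) \<longlongrightarrow> cone_dist X \<omega> d x y) \<omega>"
  unfolding cone_dist_def by (rule tendsto_ultralim[OF uf])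

lemma cone_dist_nonneg: "0 \<le> cone_dist X \<omega> d x y"
  by (rule tendsto_lowerbound[OF tendsto_cone_dist _ \<omega>_nontrivial])
    (simp add: dpos less_imp_le)

lemma cone_dist_commute: "cone_dist X \<omega> d x y = cone_dist X \<omega> d y x"
  by (simp add: cone_dist_def mdist_commute)

lemma cone_dist_triangle:
  assumes "\<And>n. x n \<in> mspace X" "\<And>n. y n \<in> mspace X" "\<And>n. z n \<in> mspace X"
  shows "cone_dist X \<omega> d x z \<le> cone_dist X \<omega> d x y + cone_dist X \<omega> d y z"
proof -
  have sum: "((\<lambda>n. ereal (mdist X (x n) (y n) / d n) + ereal (mdist X (y n) (z n) / d n))
          \<longlongrightarrow> cone_dist X \<omega> d x y + cone_dist X \<omega> d y z) \<omega>"
    using cone_dist_nonneg[of x y] cone_dist_nonneg[of y z]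
    by (intro tendsto_add_ereal_general tendsto_cone_dist) auto
  show ?thesis
  proof (rule tendsto_le[OF \<omega>_nontrivial sum tendsto_cone_dist])
    have "mdist X (x n) (z n) / d n \<le> mdist X (x n) (y n) / d n + mdist X (y n) (z n) / d n" for n
      using mdist_triangle[of "x n" X "y n" "z n"] assms dpos[of n]
      by (simp add: add_divide_distrib[symmetric] divide_right_mono)
    thus "eventually (\<lambda>n. ereal (mdist X (x n) (z n) / d n)
            \<le> ereal (mdist X (x n) (y n) / d n) + ereal (mdist X (y n) (z n) / d n)) \<omega>"
      by simp
  qed
qed

lemma cone_dist_refl:
  assumes "\<And>n. x n \<in> mspace X"
  shows "cone_dist X \<omega> d x x = 0"
proof -
  have "(\<lambda>n. ereal (mdist X (x n) (x n) / d n)) = (\<lambda>n. 0)"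
    using assms by (simp add: zero_ereal_def fun_eq_iff)
  hence "((\<lambda>n. ereal (mdist X (x n) (x n) / d n)) \<longlongrightarrow> 0) \<omega>"
    by simp
  thus ?thesis
    using tendsto_cone_dist[of x x] \<omega>_nontrivial by (metis tendsto_unique)
qed

lemma cone_sequencesD:
  assumes "x \<in> cone_sequences X \<omega> e d"
  shows "x n \<in> mspace X" "cone_dist X \<omega> d x e < \<infinity>"
  using assms by (auto simp: cone_sequences_def)

lemma cone_dist_finite:
  assumes "x \<in> cone_sequences X \<omega> e d" "y \<in> cone_sequences X \<omega> e d"
  shows "cone_dist X \<omega> d x y < \<infinity>"
proof -
  have "cone_dist X \<omega> d x y \<le> cone_dist X \<omega> d x e + cone_dist X \<omega> d e y"
    using assms ob by (intro cone_dist_triangle) (auto simp: cone_sequencesD observation_sequence_def)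
  also have "\<dots> < \<infinity>"
    using assms[THEN cone_sequencesD(2)] by (simp add: cone_dist_commute[of e])
  finally show ?thesis .
qed

lemma equiv_cone_rel: "equiv (cone_sequences X \<omega> e d) (cone_rel X \<omega> e d)"
proof (rule equivI)
  show "trans (cone_rel X \<omega> e d)"
  proof (rule transI)
    fix x y z assume "(x, y) \<in> cone_rel X \<omega> e d" "(y, z) \<in> cone_rel X \<omega> e d"
    then show "(x, z) \<in> cone_rel X \<omega> e d"
      using cone_dist_triangle[of x y z] cone_dist_nonneg[of x z]
      by (auto simp: cone_rel_def cone_sequencesD)
  qed
  show "sym (cone_rel X \<omega> e d)"
    by (auto simp: sym_def cone_rel_def cone_dist_commute)
  show "refl_on (cone_sequences X \<omega> e d) (cone_rel X \<omega> e d)"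
    by (auto simp: refl_on_def cone_rel_def cone_dist_refl cone_sequencesD)
  show "cone_rel X \<omega> e d \<subseteq> cone_sequences X \<omega> e d \<times> cone_sequences X \<omega> e d"
    by (auto simp: cone_rel_def)
qed

lemma some_in_class:
  assumes "A \<in> cone_sequences X \<omega> e d // cone_rel X \<omega> e d"
  shows "(SOME x. x \<in> A) \<in> A"
  using in_quotient_imp_non_empty[OF equiv_cone_rel assms] by (simp add: some_in_eq)

lemma cone_dist_cong:
  assumes "(x, x') \<in> cone_rel X \<omega> e d" "(y, y') \<in> cone_rel X \<omega> e d"
  shows "cone_dist X \<omega> d x y = cone_dist X \<omega> d x' y'"
proof -
  have le: "cone_dist X \<omega> d x y \<le> cone_dist X \<omega> d x' y'"
    if "(x, x') \<in> cone_rel X \<omega> e d" "(y, y') \<in> cone_rel X \<omega> e d" for x x' y y'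
    using that cone_dist_triangle[of x x' y] cone_dist_triangle[of x' y' y]
    by (auto simp: cone_rel_def cone_sequencesD cone_dist_commute[of y' y])
  have s: "(x', x) \<in> cone_rel X \<omega> e d" "(y', y) \<in> cone_rel X \<omega> e d"
    using assms by (auto simp: cone_rel_def cone_dist_commute)
  show ?thesis
    by (rule antisym[OF le[OF assms] le[OF s]])
qed

lemma Metric_space_asymptotic_cone:
  "Metric_space (cone_sequences X \<omega> e d // cone_rel X \<omega> e d)
     (\<lambda>A B. real_of_ereal (cone_dist X \<omega> d (SOME x. x \<in> A) (SOME y. y \<in> B)))"
  (is "Metric_space ?Q ?D")
proof
  fix A B C
  show "0 \<le> ?D A B" by (simp add: cone_dist_nonneg real_of_ereal_pos)
  show "?D A B = ?D B A" by (simp add: cone_dist_commute)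
  have mem: "(SOME x. x \<in> A) \<in> cone_sequences X \<omega> e d" if "A \<in> ?Q" for A
    using some_in_class[OF that] in_quotient_imp_subset[OF equiv_cone_rel that] by blast
  have fin: "\<bar>cone_dist X \<omega> d (SOME x. x \<in> A) (SOME y. y \<in> B)\<bar> \<noteq> \<infinity>"
    if "A \<in> ?Q" "B \<in> ?Q" for A B
    using cone_dist_finite[OF mem mem, OF that] cone_dist_nonneg by auto
  show "?D A B = 0 \<longleftrightarrow> A = B" if AB: "A \<in> ?Q" "B \<in> ?Q"
  proof -
    have "?D A B = 0 \<longleftrightarrow> cone_dist X \<omega> d (SOME x. x \<in> A) (SOME y. y \<in> B) = 0"
      using fin[OF AB] by (auto simp: real_of_ereal_eq_0)
    also have "\<dots> \<longleftrightarrow> ((SOME x. x \<in> A), (SOME y. y \<in> B)) \<in> cone_rel X \<omega> e d"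
      using mem AB by (auto simp: cone_rel_def)
    also have "\<dots> \<longleftrightarrow> A = B"
      using quotient_eq_iff[OF equiv_cone_rel AB some_in_class some_in_class, OF AB] by simp
    finally show ?thesis .
  qed
  show "?D A C \<le> ?D A B + ?D B C" if "A \<in> ?Q" "B \<in> ?Q" "C \<in> ?Q"
  proof -
    have t: "cone_dist X \<omega> d (SOME x. x \<in> A) (SOME y. y \<in> C)
        \<le> cone_dist X \<omega> d (SOME x. x \<in> A) (SOME y. y \<in> B)
          + cone_dist X \<omega> d (SOME x. x \<in> B) (SOME y. y \<in> C)"
      using mem that by (intro cone_dist_triangle) (auto simp: cone_sequencesD)
    have r: "real_of_ereal u \<le> real_of_ereal v + real_of_ereal w"
      if "\<bar>u\<bar> \<noteq> \<infinity>" "\<bar>v\<bar> \<noteq> \<infinity>" "\<bar>w\<bar> \<noteq> \<infinity>" "u \<le> v + w" for u v w :: ereal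
      using that by (cases u; cases v; cases w) auto
    show ?thesis
      by (rule r[OF fin fin fin t]) (use that in auto)
  qed
qed

lemma mspace_asymptotic_cone:
  "mspace (asymptotic_cone X \<omega> e d) = cone_sequences X \<omega> e d // cone_rel X \<omega> e d"
  unfolding asymptotic_cone_def
  by (rule Metric_space.mspace_metric[OF Metric_space_asymptotic_cone])

lemma mdist_asymptotic_cone:
  assumes "x \<in> cone_sequences X \<omega> e d" "y \<in> cone_sequences X \<omega> e d"
  shows "ereal (mdist (asymptotic_cone X \<omega> e d) (cone_rel X \<omega> e d `` {x}) (cone_rel X \<omega> e d `` {y}))
         = cone_dist X \<omega> d x y"
proof -
  let ?c = "\<lambda>x. cone_rel X \<omega> e d `` {x}"
  have rep: "(z, SOME u. u \<in> ?c z) \<in> cone_rel X \<omega> e d" if "z \<in> cone_sequences X \<omega> e d" for z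
    using some_in_class[OF quotientI[OF that]] by simp
  have "mdist (asymptotic_cone X \<omega> e d) (?c x) (?c y) = real_of_ereal (cone_dist X \<omega> d x y)"
    unfolding asymptotic_cone_def Metric_space.mdist_metric[OF Metric_space_asymptotic_cone]
    using cone_dist_cong[OF rep rep, OF assms] by simp
  moreover have "\<bar>cone_dist X \<omega> d x y\<bar> \<noteq> \<infinity>"
    using cone_dist_finite[OF assms] cone_dist_nonneg by auto
  ultimately show ?thesis by (simp add: ereal_real)
qed

end


section \<open>Finitely generated groups and their asymptotic cones\<close>

definition finite_generating_set :: "('a, 'b) monoid_scheme \<Rightarrow> 'a set \<Rightarrow> bool" where
  "finite_generating_set G S \<longleftrightarrow> finite S \<and> S \<subseteq> carrier G \<and> generate G S = carrier G"

definition finitely_generated :: "('a, 'b) monoid_scheme \<Rightarrow> bool" where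
  "finitely_generated G \<longleftrightarrow> (\<exists>S. finite_generating_set G S)"

definition word_value :: "('a, 'b) monoid_scheme \<Rightarrow> 'a list \<Rightarrow> 'a" where
  "word_value G ws = foldr (\<otimes>\<^bsub>G\<^esub>) ws \<one>\<^bsub>G\<^esub>"

definition words_over :: "('a, 'b) monoid_scheme \<Rightarrow> 'a set \<Rightarrow> 'a list set" where
  "words_over G S = lists (S \<union> m_inv G ` S)"

definition word_length :: "('a, 'b) monoid_scheme \<Rightarrow> 'a set \<Rightarrow> 'a \<Rightarrow> nat" where
  "word_length G S g = (LEAST n. \<exists>ws \<in> words_over G S. length ws = n \<and> word_value G ws = g)"

text \<open>
  The distance of the vertices \<open>g\<close> and \<open>h\<close> in the Cayley graph. The value outside the carrier is
  irrelevant, but \<^const>\<open>Metric_space\<close> wants it to be symmetric and nonnegative there.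
\<close>

definition word_metric :: "('a, 'b) monoid_scheme \<Rightarrow> 'a set \<Rightarrow> 'a metric" where
  "word_metric G S =
     metric (carrier G,
       \<lambda>g h. if g \<in> carrier G \<and> h \<in> carrier G
              then real (word_length G S (m_inv G g \<otimes>\<^bsub>G\<^esub> h)) else 0)"

definition asymptotic_cones :: "('a, 'b) monoid_scheme \<Rightarrow> (nat \<Rightarrow> 'a) set metric set" where
  "asymptotic_cones G =
     {asymptotic_cone (word_metric G S) \<omega> e d | S \<omega> e d.
        finite_generating_set G S \<and> ultrafilter \<omega> \<and>
        observation_sequence (word_metric G S) e \<and> scaling_sequence \<omega> d}"

context group
begin

lemma words_over_carrier:
  assumes "S \<subseteq> carrier G" "ws \<in> words_over G S"
  shows "set ws \<subseteq> carrier G"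
  using assms by (auto simp: words_over_def in_lists_conv_set)

lemma word_value_closed: "set ws \<subseteq> carrier G \<Longrightarrow> word_value G ws \<in> carrier G"
  by (induction ws) (auto simp: word_value_def)

lemma word_value_append:
  "set us \<subseteq> carrier G \<Longrightarrow> set vs \<subseteq> carrier G \<Longrightarrow>
     word_value G (us @ vs) = word_value G us \<otimes> word_value G vs"
proof (induction us)
  case Nil
  then show ?case using word_value_closed[of vs] by (simp add: word_value_def)
next
  case (Cons u us)
  have "word_value G us \<in> carrier G" "word_value G vs \<in> carrier G"
    using Cons.prems by (auto intro: word_value_closed)
  then show ?case using Cons by (simp add: word_value_def m_assoc)
qed

lemma word_value_inv:
  "set ws \<subseteq> carrier G \<Longrightarrow> word_value G (rev (map (m_inv G) ws)) = inv (word_value G ws)"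
proof (induction ws)
  case Nil
  then show ?case by (simp add: word_value_def)
next
  case (Cons w ws)
  have c: "word_value G ws \<in> carrier G" using Cons.prems by (auto intro: word_value_closed)
  have "word_value G (rev (map (m_inv G) (w # ws)))
      = word_value G (rev (map (m_inv G) ws)) \<otimes> word_value G [inv w]"
    using Cons.prems by (simp, subst word_value_append) auto
  also have "\<dots> = inv (word_value G (w # ws))"
    using Cons c by (simp add: word_value_def inv_mult_group)
  finally show ?case .
qed

lemma ex_word:
  assumes "S \<subseteq> carrier G" "g \<in> generate G S"
  shows "\<exists>ws \<in> words_over G S. word_value G ws = g"
  using assms(2)
proof (induction rule: generate.induct)
  case one
  show ?case by (rule bexI[of _ "[]"]) (auto simp: words_over_def word_value_def)
next
  case (incl h)
  show ?case
    using incl assms(1) by (intro bexI[of _ "[h]"]) (auto simp: words_over_def word_value_def)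
next
  case (inv h)
  show ?case
    using inv assms(1) by (intro bexI[of _ "[inv h]"]) (auto simp: words_over_def word_value_def)
next
  case (eng h1 h2)
  then obtain us vs where "us \<in> words_over G S" "word_value G us = h1"
    "vs \<in> words_over G S" "word_value G vs = h2" by blast
  then show ?case
    using words_over_carrier[OF assms(1)] word_value_append[of us vs]
    by (intro bexI[of _ "us @ vs"]) (auto simp: words_over_def)
qed

lemma word_length_le:
  "ws \<in> words_over G S \<Longrightarrow> word_length G S (word_value G ws) \<le> length ws"
  unfolding word_length_def by (rule Least_le) auto

lemma word_length_attained:
  assumes "finite_generating_set G S" "g \<in> carrier G"
  obtains ws where "ws \<in> words_over G S" "length ws = word_length G S g" "word_value G ws = g"
proof -
  have "\<exists>n. \<exists>ws \<in> words_over G S. length ws = n \<and> word_value G ws = g"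
    using ex_word[of S g] assms unfolding finite_generating_set_def by blast
  from LeastI_ex[OF this] show ?thesis using that unfolding word_length_def by blast
qed

lemma word_length_inv_le:
  assumes S: "finite_generating_set G S" and g: "g \<in> carrier G"
  shows "word_length G S (inv g) \<le> word_length G S g"
proof -
  have Sc: "S \<subseteq> carrier G" using S by (simp add: finite_generating_set_def)
  obtain ws where ws: "ws \<in> words_over G S" "length ws = word_length G S g" "word_value G ws = g"
    using word_length_attained[OF S g] .
  have "rev (map (m_inv G) ws) \<in> words_over G S"
    using ws(1) Sc by (force simp: words_over_def in_lists_conv_set)
  from word_length_le[OF this] show ?thesis
    using ws word_value_inv[OF words_over_carrier[OF Sc ws(1)]] by simp
qed

lemma word_length_mult_le:
  assumes S: "finite_generating_set G S" and g: "g \<in> carrier G" and h: "h \<in> carrier G"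
  shows "word_length G S (g \<otimes> h) \<le> word_length G S g + word_length G S h"
proof -
  have Sc: "S \<subseteq> carrier G" using S by (simp add: finite_generating_set_def)
  obtain us where us: "us \<in> words_over G S" "length us = word_length G S g" "word_value G us = g"
    using word_length_attained[OF S g] .
  obtain vs where vs: "vs \<in> words_over G S" "length vs = word_length G S h" "word_value G vs = h"
    using word_length_attained[OF S h] .
  have "us @ vs \<in> words_over G S"
    using us(1) vs(1) by (auto simp: words_over_def)
  from word_length_le[OF this] show ?thesis
    using us vs word_value_append[OF words_over_carrier[OF Sc us(1)] words_over_carrier[OF Sc vs(1)]]
    by simp
qed

lemma word_length_eq_0:
  assumes S: "finite_generating_set G S" and g: "g \<in> carrier G"
  shows "word_length G S g = 0 \<longleftrightarrow> g = \<one>"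
proof
  assume "word_length G S g = 0"
  then show "g = \<one>"
    using word_length_attained[OF S g] by (metis length_0_conv foldr.simps(1) id_apply word_value_def)
next
  assume "g = \<one>"
  then show "word_length G S g = 0"
    using word_length_le[of "[]" S] by (simp add: words_over_def word_value_def)
qed

lemma Metric_space_word_metric:
  assumes S: "finite_generating_set G S"
  shows "Metric_space (carrier G)
    (\<lambda>g h. if g \<in> carrier G \<and> h \<in> carrier G then real (word_length G S (inv g \<otimes> h)) else 0)"
proof
  have le: "word_length G S (inv g \<otimes> h) \<le> word_length G S (inv h \<otimes> g)"
    if "g \<in> carrier G" "h \<in> carrier G" for g h
    using word_length_inv_le[OF S, of "inv h \<otimes> g"] that by (simp add: inv_mult_group)
  fix x y
  show "(if x \<in> carrier G \<and> y \<in> carrier G then real (word_length G S (inv x \<otimes> y)) else 0)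
      = (if y \<in> carrier G \<and> x \<in> carrier G then real (word_length G S (inv y \<otimes> x)) else 0)"
    using le[of x y] le[of y x] by auto
next
  fix x y assume xy: "x \<in> carrier G" "y \<in> carrier G"
  then show "(if x \<in> carrier G \<and> y \<in> carrier G then real (word_length G S (inv x \<otimes> y)) else 0) = 0
      \<longleftrightarrow> x = y"
    using word_length_eq_0[OF S, of "inv x \<otimes> y"] by (auto simp: inv_comm inv_solve_left')
next
  fix x y z assume xyz: "x \<in> carrier G" "y \<in> carrier G" "z \<in> carrier G"
  have "inv x \<otimes> z = (inv x \<otimes> y) \<otimes> (inv y \<otimes> z)"
    using xyz by (simp add: m_assoc) (simp add: m_assoc[symmetric])
  then have "word_length G S (inv x \<otimes> z) \<le> word_length G S (inv x \<otimes> y) + word_length G S (inv y \<otimes> z)"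
    using word_length_mult_le[OF S, of "inv x \<otimes> y" "inv y \<otimes> z"] xyz by simp
  then show "(if x \<in> carrier G \<and> z \<in> carrier G then real (word_length G S (inv x \<otimes> z)) else 0)
      \<le> (if x \<in> carrier G \<and> y \<in> carrier G then real (word_length G S (inv x \<otimes> y)) else 0)
        + (if y \<in> carrier G \<and> z \<in> carrier G then real (word_length G S (inv y \<otimes> z)) else 0)"
    using xyz by simp
qed auto

lemma mspace_word_metric:
  "finite_generating_set G S \<Longrightarrow> mspace (word_metric G S) = carrier G"
  unfolding word_metric_def by (rule Metric_space.mspace_metric[OF Metric_space_word_metric])

lemma mdist_word_metric:
  "finite_generating_set G S \<Longrightarrow> g \<in> carrier G \<Longrightarrow> h \<in> carrier G \<Longrightarrow>
     mdist (word_metric G S) g h = real (word_length G S (inv g \<otimes> h))"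
  unfolding word_metric_def by (simp add: Metric_space.mdist_metric[OF Metric_space_word_metric])

end


section \<open>Global cut-points, constricted and wide groups\<close>

definition global_cut_point :: "'a topology \<Rightarrow> 'a \<Rightarrow> bool" where
  "global_cut_point Y x \<longleftrightarrow>
     connected_space Y \<and> x \<in> topspace Y \<and>
     (\<exists>C D. C \<in> connected_components_of (subtopology Y (topspace Y - {x})) \<and>
            D \<in> connected_components_of (subtopology Y (topspace Y - {x})) \<and> C \<noteq> D)"

definition has_global_cut_point :: "'a topology \<Rightarrow> bool" where
  "has_global_cut_point Y \<longleftrightarrow> (\<exists>x. global_cut_point Y x)"

definition constricted :: "('a, 'b) monoid_scheme \<Rightarrow> bool" where
  "constricted G \<longleftrightarrow> (\<forall>C \<in> asymptotic_cones G. has_global_cut_point (mtopology_of C))"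

definition wide :: "('a, 'b) monoid_scheme \<Rightarrow> bool" where
  "wide G \<longleftrightarrow> (\<forall>C \<in> asymptotic_cones G. \<not> has_global_cut_point (mtopology_of C))"


section \<open>The fundamental group\<close>

text \<open>
  The library's path operations require a topological type class, whereas cones are spaces with an
  explicit carrier. Paths are total functions on the reals of which only the values on the unit
  interval matter; identifying homotopic loops also removes the dependence on the other values.
\<close>

definition loops_at :: "'a topology \<Rightarrow> 'a \<Rightarrow> (real \<Rightarrow> 'a) set" where
  "loops_at Y x = {p. pathin Y p \<and> p 0 = x \<and> p 1 = x}"

definition loop_concat :: "(real \<Rightarrow> 'a) \<Rightarrow> (real \<Rightarrow> 'a) \<Rightarrow> real \<Rightarrow> 'a" where
  "loop_concat p q = (\<lambda>t. if t \<le> 1/2 then p (2 * t) else q (2 * t - 1))"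

definition loop_homotopy :: "'a topology \<Rightarrow> 'a \<Rightarrow> ((real \<Rightarrow> 'a) \<times> (real \<Rightarrow> 'a)) set" where
  "loop_homotopy Y x =
     {(p, q). p \<in> loops_at Y x \<and> q \<in> loops_at Y x \<and>
              homotopic_with (\<lambda>r. r 0 = x \<and> r 1 = x) (top_of_set {0..1}) Y p q}"

definition fundamental_group :: "'a topology \<Rightarrow> 'a \<Rightarrow> (real \<Rightarrow> 'a) set monoid" where
  "fundamental_group Y x =
     \<lparr>carrier = loops_at Y x // loop_homotopy Y x,
      monoid.mult = (\<lambda>A B. \<Union>p\<in>A. \<Union>q\<in>B. loop_homotopy Y x `` {loop_concat p q}),
      one = loop_homotopy Y x `` {\<lambda>_. x}\<rparr>"

definition simply_connected_space :: "'a topology \<Rightarrow> bool" where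
  "simply_connected_space Y \<longleftrightarrow>
     path_connected_space Y \<and>
     (\<forall>x \<in> topspace Y. carrier (fundamental_group Y x) = {\<one>\<^bsub>fundamental_group Y x\<^esub>})"


section \<open>Free groups\<close>

text \<open>The letter \<open>(True, s)\<close> stands for \<open>s\<close>, the letter \<open>(False, s)\<close> for its inverse.\<close>

definition letter_value :: "('a, 'b) monoid_scheme \<Rightarrow> bool \<times> 'a \<Rightarrow> 'a" where
  "letter_value G l = (if fst l then snd l else m_inv G (snd l))"

definition reduced_word :: "(bool \<times> 'a) list \<Rightarrow> bool" where
  "reduced_word w \<longleftrightarrow>
     (\<forall>i. Suc i < length w \<longrightarrow> \<not> (snd (w ! i) = snd (w ! Suc i) \<and> fst (w ! i) \<noteq> fst (w ! Suc i)))"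

definition free_basis :: "('a, 'b) monoid_scheme \<Rightarrow> 'a set \<Rightarrow> bool" where
  "free_basis G B \<longleftrightarrow>
     B \<subseteq> carrier G \<and> generate G B = carrier G \<and>
     (\<forall>w. set w \<subseteq> UNIV \<times> B \<and> w \<noteq> [] \<and> reduced_word w \<longrightarrow>
          word_value G (map (letter_value G) w) \<noteq> \<one>\<^bsub>G\<^esub>)"

definition free_group :: "('a, 'b) monoid_scheme \<Rightarrow> bool" where
  "free_group G \<longleftrightarrow> group G \<and> (\<exists>B. free_basis G B)"

definition countably_generated :: "('a, 'b) monoid_scheme \<Rightarrow> bool" where
  "countably_generated G \<longleftrightarrow> (\<exists>T \<subseteq> carrier G. countable T \<and> generate G T = carrier G)"

definition has_uncountably_generated_free_subgroup :: "('a, 'b) monoid_scheme \<Rightarrow> bool" where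
  "has_uncountably_generated_free_subgroup G \<longleftrightarrow>
     (\<exists>H. subgroup H G \<and> free_group (G\<lparr>carrier := H\<rparr>) \<and> \<not> countably_generated (G\<lparr>carrier := H\<rparr>))"

end

theory Submission
  imports Defs "HOL-Probability.Discrete_Topology"
begin

text \<open>
  An asymptotic cone \<open>C\<close> of \<open>G\<close> is a geodesic space on which the group of sequences in \<open>G\<close> acts
  transitively by isometries. If \<open>C\<close> has a cut-point, every point is a cut-point and all components
  (branches) at a point are unbounded, so every branch contains a translate of any given loop.

  If for all \<open>x\<close>, \<open>y\<close> each interior point of each geodesic from \<open>x\<close> to \<open>y\<close> separates \<open>x\<close> from \<open>y\<close>,
  sliding points along geodesics towards a base point contracts every loop. Otherwise some
  subinterval of a geodesic consists of points that do not separate its ends, and choosing at each of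
  them a branch that avoids the geodesic yields uncountably many pairwise disjoint branches. A
  non-contractible loop of \<open>C\<close> can then be moved into each of them.

  That alternating products of these loops are not contractible is van Kampen's theorem for the
  retractions onto the branches. No local contractibility is needed: distinct attaching points
  have positive distance, so a fine subdivision of a homotopy meets at most one branch per cell, and
  the changes of its homotopy class act on the reduced words of a free product.
\<close>

section \<open>Separating points in geodesic spaces\<close>

text \<open>Infinitely many branches accumulate along a geodesic, so no positive distance separates
  all of them. Freeness is however a statement about one word at a time, and a word involves
  finitely many branches; this is what makes a single fineness of subdivision sufficient. The
  retraction onto a branch records the part of a path inside it as an element of the fundamental
  group of the whole space, so the free product in question consists of copies of one group, one
  copy for each branch, and need not be constructed: it is enough that every copy acts on normal
  forms. The quantity compared at the end is the length of a normal form. Separation by a point is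
  expressed with path components of its complement: points in different components cannot be joined
  by a path, and paths can be pieced together from geodesics and transported by isometries. Branches
  are unbounded because one separated pair, moved around by isometries, yields separated pairs of
  the same size at every point.\<close>

definition geodesic_in :: "'v::real_normed_vector set \<Rightarrow> (real \<Rightarrow> 'v) \<Rightarrow> 'v \<Rightarrow> 'v \<Rightarrow> bool" where
  "geodesic_in S c x y \<longleftrightarrow> c 0 = x \<and> c 1 = y \<and> c ` {0..1} \<subseteq> S \<and>
     (\<forall>s\<in>{0..1}. \<forall>t\<in>{0..1}. dist (c s) (c t) = \<bar>s - t\<bar> * dist x y)"

definition self_isometry :: "'v::real_normed_vector set \<Rightarrow> ('v \<Rightarrow> 'v) \<Rightarrow> bool" where
  "self_isometry S f \<longleftrightarrow> f ` S = S \<and> (\<forall>u\<in>S. \<forall>v\<in>S. dist (f u) (f v) = dist u v)"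

lemma geodesic_inD:
  assumes "geodesic_in S c x y"
  shows "c 0 = x" "c 1 = y" "\<And>t. 0 \<le> t \<Longrightarrow> t \<le> 1 \<Longrightarrow> c t \<in> S"
    "\<And>s t. 0 \<le> s \<Longrightarrow> s \<le> 1 \<Longrightarrow> 0 \<le> t \<Longrightarrow> t \<le> 1 \<Longrightarrow> dist (c s) (c t) = \<bar>s - t\<bar> * dist x y"
  using assms by (auto simp: geodesic_in_def)

lemma geodesic_in_dist:
  assumes "geodesic_in S c x y" "0 \<le> t" "t \<le> 1"
  shows "dist x (c t) = t * dist x y" "dist (c t) y = (1 - t) * dist x y"
  using geodesic_inD(4)[OF assms(1), of 0 t] geodesic_inD(4)[OF assms(1), of t 1]
    geodesic_inD(1,2)[OF assms(1)] assms(2,3) by auto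

lemma geodesic_in_path:
  assumes "geodesic_in S c x y"
  shows "path c" "pathstart c = x" "pathfinish c = y" "path_image c \<subseteq> S"
proof -
  have "continuous_on {0..1} c"
  proof (rule continuous_onI)
    fix t e :: real assume t: "t \<in> {0..1}" and e: "0 < e"
    \<comment> \<open>The summand 1 keeps the divisor positive when \<open>x = y\<close>.\<close>
    have "dist (c s) (c t) \<le> e" if "s \<in> {0..1}" "dist s t < e / (dist x y + 1)" for s
    proof -
      have "dist (c s) (c t) = \<bar>s - t\<bar> * dist x y"
        using geodesic_inD(4)[OF assms] t that by auto
      also have "\<dots> \<le> e / (dist x y + 1) * (dist x y + 1)"
        using that e by (intro mult_mono) (auto simp: dist_real_def)
      also have "\<dots> = e" by (simp add: add_nonneg_eq_0_iff)
      finally show ?thesis .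
    qed
    then show "\<exists>d>0. \<forall>s\<in>{0..1}. dist s t < d \<longrightarrow> dist (c s) (c t) \<le> e"
      using e by (intro exI[of _ "e / (dist x y + 1)"]) (auto simp: add_nonneg_pos)
  qed
  then show "path c" by (simp add: path_def)
qed (use assms in \<open>auto simp: geodesic_in_def pathstart_def pathfinish_def path_image_def\<close>)

section \<open>Isometries and separation\<close>

lemma self_isometryD:
  assumes "self_isometry S f"
  shows "\<And>u. u \<in> S \<Longrightarrow> f u \<in> S" "\<And>u v. u \<in> S \<Longrightarrow> v \<in> S \<Longrightarrow> dist (f u) (f v) = dist u v"
    "\<And>u v. u \<in> S \<Longrightarrow> v \<in> S \<Longrightarrow> f u = f v \<longleftrightarrow> u = v"
  using assms unfolding self_isometry_def by (auto, metis dist_eq_0_iff)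

lemma self_isometry_inv:
  assumes "self_isometry S f"
  shows "self_isometry S (inv_into S f)"
proof -
  have b: "bij_betw f S S"
    using assms self_isometryD(3)[OF assms] by (auto simp: bij_betw_def self_isometry_def inj_on_def)
  show ?thesis
    unfolding self_isometry_def
  proof (intro conjI ballI)
    show "inv_into S f ` S = S" using bij_betw_inv_into[OF b] by (simp add: bij_betw_def)
    fix u v assume "u \<in> S" "v \<in> S"
    then show "dist (inv_into S f u) (inv_into S f v) = dist u v"
      using self_isometryD(2)[OF assms, of "inv_into S f u" "inv_into S f v"] b
      by (metis bij_betw_def f_inv_into_f inv_into_into)
  qed
qed

lemma self_isometry_inv_f:
  assumes "self_isometry S f" "x \<in> S"
  shows "inv_into S f (f x) = x"
  using assms self_isometryD(3)[OF assms(1)] by (intro inv_into_f_f) (auto simp: inj_on_def)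

lemma lipschitz_on_set_continuous:
  fixes f :: "'a::metric_space \<Rightarrow> 'b::metric_space"
  assumes "\<And>u v. u \<in> S \<Longrightarrow> v \<in> S \<Longrightarrow> dist (f u) (f v) \<le> dist u v"
  shows "continuous_on S f"
  unfolding continuous_on_iff using assms by (meson le_less_trans)

lemma self_isometry_continuous:
  "self_isometry S f \<Longrightarrow> continuous_on S f"
  by (rule lipschitz_on_set_continuous) (simp add: self_isometryD)

lemma self_isometry_linked:
  assumes f: "self_isometry S f" and z: "z \<in> S" and p: "path_component (S - {z}) x y"
  shows "path_component (S - {f z}) (f x) (f y)"
proof -
  obtain g where g: "path g" "path_image g \<subseteq> S - {z}" "pathstart g = x" "pathfinish g = y"
    using p unfolding path_component_def by blast
  have "path (f \<circ> g)"
    using g by (intro path_continuous_image continuous_on_subset[OF self_isometry_continuous[OF f]]) auto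
  moreover have "path_image (f \<circ> g) \<subseteq> S - {f z}"
    using g(2) self_isometryD[OF f] z unfolding path_image_compose by blast
  ultimately show ?thesis
    using g unfolding path_component_def
    by (intro exI[of _ "f \<circ> g"]) (auto simp: pathstart_compose pathfinish_compose)
qed

lemma self_isometry_linked_iff:
  assumes f: "self_isometry S f" and z: "z \<in> S" and "x \<in> S" "y \<in> S"
  shows "path_component (S - {f z}) (f x) (f y) \<longleftrightarrow> path_component (S - {z}) x y"
proof
  assume "path_component (S - {f z}) (f x) (f y)"
  from self_isometry_linked[OF self_isometry_inv[OF f] _ this]
  show "path_component (S - {z}) x y"
    using assms self_isometryD(1)[OF f] by (simp add: self_isometry_inv_f)
qed (rule self_isometry_linked[OF f z])

locale geodesic_set =
  fixes S :: "'v::real_normed_vector set"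
  assumes geodesic_exists: "\<And>x y. x \<in> S \<Longrightarrow> y \<in> S \<Longrightarrow> \<exists>c. geodesic_in S c x y"
begin

text \<open>By the convention of \<open>path_component\<close> this is false if \<open>x\<close> or
  \<open>y\<close> equals \<open>z\<close>. Negated, for points of \<open>S\<close>, it says that
  \<open>z\<close> separates \<open>x\<close> from \<open>y\<close> or is one of them.\<close>

abbreviation linked :: "'v \<Rightarrow> 'v \<Rightarrow> 'v \<Rightarrow> bool" where
  "linked z x y \<equiv> path_component (S - {z}) x y"

lemma path_linked:
  assumes "path g" "path_image g \<subseteq> S - {z}"
  shows "linked z (pathstart g) (pathfinish g)"
  using assms unfolding path_component_def by blast

lemma linkedD: "linked z x y \<Longrightarrow> x \<in> S \<and> y \<in> S \<and> x \<noteq> z \<and> y \<noteq> z"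
  using path_component_mem by fastforce

lemma geodesic_meets:
  assumes "geodesic_in S c x y" "\<not> linked z x y"
  obtains t where "0 \<le> t" "t \<le> 1" "c t = z"
proof -
  have "\<not> path_image c \<subseteq> S - {z}"
    using path_linked[of c z] geodesic_in_path[OF assms(1)] assms(2) by auto
  then have "z \<in> path_image c" using geodesic_in_path[OF assms(1)] by auto
  then show ?thesis using that by (auto simp: path_image_def)
qed

lemma geodesic_linked:
  assumes g: "geodesic_in S c x y" and st: "0 \<le> s" "s \<le> t" "t \<le> 1" and n: "z \<notin> c ` {s..t}"
  shows "linked z (c s) (c t)"
proof -
  have "path (subpath s t c)"
    using st by (intro path_subpath geodesic_in_path(1)[OF g]) auto
  moreover have "path_image (subpath s t c) \<subseteq> S - {z}"
    using geodesic_inD(3)[OF g] st n by (force simp: path_image_subpath)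
  ultimately show ?thesis using path_linked by fastforce
qed

text \<open>A geodesic from \<open>x\<close> to \<open>y\<close> cannot avoid \<open>z\<close>. In
  this metric form separation turns into a contradiction whenever two points would each lie between
  the other and a third.\<close>

lemma separated_dist:
  assumes "\<not> linked z x y" "x \<in> S" "y \<in> S"
  shows "dist x y = dist x z + dist z y"
proof -
  obtain c where c: "geodesic_in S c x y" using geodesic_exists assms by blast
  then obtain t where "0 \<le> t" "t \<le> 1" "c t = z" using geodesic_meets assms by blast
  then show ?thesis using geodesic_in_dist[OF c, of t] by (simp add: algebra_simps)
qed

lemma linked_if_short:
  assumes "x \<in> S" "y \<in> S" "dist x y < dist x z"
  shows "linked z x y"
  using separated_dist[of z x y] assms by (smt (verit) zero_le_dist)

lemma path_connected: "path_connected S"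
  unfolding path_connected_component path_component_def
  using geodesic_exists geodesic_in_path by metis

text \<open>Collapses everything outside the branch of \<open>a\<close> at \<open>z\<close> to \<open>z\<close>; a retraction because every
  geodesic leaving the branch passes through \<open>z\<close>.\<close>
definition collapse :: "'v \<Rightarrow> 'v \<Rightarrow> 'v \<Rightarrow> 'v" where
  "collapse z a y = (if linked z a y then y else z)"

lemma collapse_in: "z \<in> S \<Longrightarrow> y \<in> S \<Longrightarrow> collapse z a y \<in> S"
  by (simp add: collapse_def)

text \<open>If exactly one of the points lies in the branch, then the distance splits at
  \<open>z\<close>, and collapsing keeps one of the two summands.\<close>

lemma dist_collapse_le:
  assumes "z \<in> S" "u \<in> S" "v \<in> S"
  shows "dist (collapse z a u) (collapse z a v) \<le> dist u v"
proof -
  have sep: "dist u v = dist u z + dist z v"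
    if "linked z a u" "\<not> linked z a v" "u \<in> S" "v \<in> S" for u v
    using that by (intro separated_dist) (auto dest: path_component_trans)
  show ?thesis
    using sep[of u v] sep[of v u] assms
    by (auto simp: collapse_def dist_commute)
qed

lemma continuous_on_collapse: "z \<in> S \<Longrightarrow> continuous_on S (collapse z a)"
  by (rule lipschitz_on_set_continuous) (rule dist_collapse_le)

text \<open>The attaching point is included: this makes the set closed in \<open>S\<close>, and
  disjointness of two branches then also keeps their attaching points apart.\<close>

definition branch :: "'v \<Rightarrow> 'v \<Rightarrow> 'v set" where
  "branch z a = insert z {y. linked z a y}"

lemma collapse_not_branch: "y \<notin> branch z a \<Longrightarrow> collapse z a y = z"
  by (auto simp: branch_def collapse_def)

lemma branch_eq: "z \<in> S \<Longrightarrow> branch z a = {y \<in> S. collapse z a y = y}"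
  by (auto simp: branch_def collapse_def dest: linkedD)

text \<open>A branch is the fixed-point set of a continuous map, namely of its own
  retraction.\<close>

lemma closedin_branch:
  assumes "z \<in> S"
  shows "closedin (top_of_set S) (branch z a)"
proof -
  have "continuous_on S (\<lambda>y. collapse z a y - y)"
    by (intro continuous_intros continuous_on_collapse assms)
  from continuous_closedin_preimage_constant[OF this, of 0]
  show ?thesis unfolding branch_eq[OF assms] by simp
qed

end

section \<open>Homogeneous geodesic spaces with a cut-point\<close>

locale cut_point_set = geodesic_set S for S :: "'v::real_normed_vector set" +
  assumes homogeneous: "\<And>x y. x \<in> S \<Longrightarrow> y \<in> S \<Longrightarrow> \<exists>f. self_isometry S f \<and> f x = y"
    and cut_exists: "\<exists>z a b. z \<in> S \<and> a \<in> S - {z} \<and> b \<in> S - {z} \<and> \<not> path_component (S - {z}) a b"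
begin

text \<open>One separated pair is carried to every point by isometries, so the same \<open>r\<close>
  serves all \<open>z\<close>; this uniformity is what \<open>branch_unbounded\<close>
  needs.\<close>

lemma cut_everywhere:
  obtains r where "r > 0"
    "\<And>z. z \<in> S \<Longrightarrow> \<exists>a b. a \<in> S \<and> b \<in> S \<and> dist z a \<ge> r \<and> dist z b \<ge> r \<and> \<not> linked z a b"
proof -
  obtain z a b where zab: "z \<in> S" "a \<in> S" "b \<in> S" "a \<noteq> z" "b \<noteq> z" "\<not> linked z a b"
    using cut_exists by blast
  show ?thesis
  proof
    show "min (dist z a) (dist z b) > 0" using zab by auto
    fix y assume "y \<in> S"
    then obtain f where f: "self_isometry S f" "f z = y" using homogeneous zab by blast
    show "\<exists>a' b'. a' \<in> S \<and> b' \<in> S \<and> dist y a' \<ge> min (dist z a) (dist z b)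
        \<and> dist y b' \<ge> min (dist z a) (dist z b) \<and> \<not> linked y a' b'"
      using zab f self_isometryD[OF f(1)] self_isometry_linked_iff[OF f(1), of z a b]
      by (intro exI[of _ "f a"] exI[of _ "f b"]) auto
  qed
qed

lemma ex_separated:
  assumes "z \<in> S" "x \<in> S"
  obtains b where "b \<in> S" "b \<noteq> z" "\<not> linked z x b"
proof -
  obtain r where "r > 0" and
    r: "\<And>z. z \<in> S \<Longrightarrow> \<exists>a b. a \<in> S \<and> b \<in> S \<and> dist z a \<ge> r \<and> dist z b \<ge> r \<and> \<not> linked z a b"
    using cut_everywhere by metis
  obtain a b where "a \<in> S" "b \<in> S" "a \<noteq> z" "b \<noteq> z" "\<not> linked z a b"
    using r[OF assms(1)] \<open>r > 0\<close> by force
  then show ?thesis using that by (meson path_component_sym path_component_trans)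
qed

text \<open>Suppose the distances from \<open>z\<close> were bounded on the branch, and let
  \<open>y\<close> nearly attain the supremum. Some \<open>w\<close> at distance at least
  \<open>r\<close> from \<open>y\<close> is separated from \<open>z\<close> by \<open>y\<close>,
  hence lies at least \<open>r\<close> further out. It belongs to the same branch: otherwise
  \<open>z\<close> would lie between \<open>y\<close> and \<open>w\<close> while \<open>y\<close>
  lies between \<open>z\<close> and \<open>w\<close>.\<close>

lemma branch_unbounded:
  assumes "z \<in> S" "a \<in> S" "a \<noteq> z"
  obtains y where "linked z a y" "dist z y > R"
proof -
  obtain r where "r > 0" and
    r: "\<And>z. z \<in> S \<Longrightarrow> \<exists>a b. a \<in> S \<and> b \<in> S \<and> dist z a \<ge> r \<and> dist z b \<ge> r \<and> \<not> linked z a b"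
    using cut_everywhere by metis
  have "\<exists>y. linked z a y \<and> dist z y > R"
  proof (rule ccontr)
    assume neg: "\<nexists>y. linked z a y \<and> dist z y > R"
    let ?D = "dist z ` {y. linked z a y}"
    have bdd: "bdd_above ?D" using neg by (intro bdd_aboveI[of _ R]) auto
    have refl: "linked z a a" using assms by (simp add: path_component_refl)
    then have ne: "?D \<noteq> {}" by auto
    have pos: "0 < Sup ?D"
      
    proof -
      have "dist z a \<in> ?D" using refl by (rule imageI[OF CollectI])
      from cSup_upper[OF this bdd] have "dist z a \<le> Sup ?D" .
      moreover have "0 < dist z a" using assms(3) by simp
      ultimately show ?thesis by (rule less_le_trans[rotated])
    qed
    have "Sup ?D - min r (Sup ?D) < Sup ?D" using \<open>r > 0\<close> pos by auto
    from less_cSupE[OF this ne] obtain y where y: "linked z a y" "Sup ?D - min r (Sup ?D) < dist z y"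
      by auto
    have yS: "y \<in> S" "y \<noteq> z" using linkedD[OF y(1)] by auto
    obtain u v where uv: "u \<in> S" "v \<in> S" "dist y u \<ge> r" "dist y v \<ge> r" "\<not> linked y u v"
      using r[OF yS(1)] by blast
    \<comment> \<open>The points \<open>u\<close> and \<open>v\<close> cannot both be linked to
      \<open>z\<close>, so one of them serves as \<open>w\<close>.\<close>
    obtain w where w: "w \<in> S" "dist y w \<ge> r" "\<not> linked y z w"
      using uv by (meson path_component_sym path_component_trans)
    have d: "dist z w = dist z y + dist y w" using separated_dist[OF w(3)] w assms by auto
    have "linked z y w"
    proof (rule ccontr)
      assume "\<not> linked z y w"
      from separated_dist[OF this] yS w d show False by (simp add: dist_commute)
    qed
    then have "linked z a w" using y by (meson path_component_trans)
    then have "dist z w \<le> Sup ?D" using cSup_upper[OF _ bdd] by auto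
    then show False using d y w by auto
  qed
  then show ?thesis using that by blast
qed

text \<open>An isometry moves the base point of \<open>g\<close> to a point of the branch whose
  distance from \<open>z\<close> exceeds the radius of \<open>g\<close> about its base point. The
  moved loop misses \<open>z\<close> and, being connected, stays in the branch; the inverse isometry
  would carry a null-homotopy back.\<close>

lemma nontrivial_loop_in_branch:
  assumes g: "path g" "path_image g \<subseteq> S" "pathfinish g = pathstart g"
    and nt: "\<not> homotopic_paths S g (linepath (pathstart g) (pathstart g))"
    and z: "z \<in> S" "a \<in> S" "a \<noteq> z"
  obtains h where "path h" "path_image h \<subseteq> {y. linked z a y}" "pathfinish h = pathstart h"
    "\<not> homotopic_paths S h (linepath (pathstart h) (pathstart h))"
proof -
  let ?o = "pathstart g"
  have "bounded (path_image g)" using g(1) by (simp add: bounded_path_image)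
  then obtain R where R: "\<And>w. w \<in> path_image g \<Longrightarrow> dist ?o w \<le> R"
    unfolding bounded_any_center[where a = "?o"] by blast
  obtain y where y: "linked z a y" "dist z y > R" using branch_unbounded[OF z] .
  have oS: "?o \<in> S" using g by auto
  obtain f where f: "self_isometry S f" "f ?o = y"
    using homogeneous[OF oS, of y] linkedD[OF y(1)] by blast
  let ?h = "f \<circ> g"
  have cont: "continuous_on S f" by (rule self_isometry_continuous[OF f(1)])
  have p: "path ?h" using g cont by (intro path_continuous_image) (auto intro: continuous_on_subset)
  have st: "pathstart ?h = y" using f by (simp add: pathstart_compose)
  have fin: "pathfinish ?h = y" using f g by (simp add: pathfinish_compose)
  have im: "path_image ?h \<subseteq> S - {z}"
  proof
    fix w assume "w \<in> path_image ?h"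
    then obtain u where u: "u \<in> path_image g" "w = f u" by (auto simp: path_image_compose)
    then have "dist y w \<le> R" using R[OF u(1)] self_isometryD(2)[OF f(1) oS, of u] f g by auto
    then have "w \<noteq> z" using y by (auto simp: dist_commute)
    then show "w \<in> S - {z}" using u g self_isometryD[OF f(1)] by auto
  qed
  have "linked z y w" if "w \<in> path_image ?h" for w
    using path_connected_path_image[OF p] that im st
    by (metis path_component_of_subset path_connected_component pathstart_in_path_image)
  then have im': "path_image ?h \<subseteq> {w. linked z a w}"
    using y by (auto intro: path_component_trans)
  have "\<not> homotopic_paths S ?h (linepath y y)"
  proof
    assume hp: "homotopic_paths S ?h (linepath y y)"
    let ?k = "inv_into S f"
    have k: "self_isometry S ?k" by (rule self_isometry_inv[OF f(1)])
    have "homotopic_paths S (?k \<circ> ?h) (?k \<circ> linepath y y)"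
      using hp k by (intro homotopic_paths_continuous_image) (auto simp: self_isometry_continuous self_isometryD)
    moreover have "homotopic_paths S g (?k \<circ> ?h)"
      using g self_isometry_inv_f[OF f(1)]
      by (intro homotopic_paths_eq) (auto simp: path_image_def image_subset_iff)
    moreover have "?k \<circ> linepath y y = linepath ?o ?o"
      using self_isometry_inv_f[OF f(1) oS] f by (auto simp: linepath_def algebra_simps fun_eq_iff simp flip: scaleR_add_left)
    ultimately show False using nt by (metis homotopic_paths_trans)
  qed
  then show ?thesis using that[OF p im'] st fin by auto
qed

end

section \<open>Contraction of loops in tree-like spaces\<close>

context geodesic_set
begin

text \<open>The geodesics from the base point are chosen arbitrarily; it is the separation
  hypothesis that makes geodesics to nearby points agree except near their ends, and so makes the
  sliding continuous.\<close>

lemma tree_loops_trivial: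
  assumes tree: "\<And>c x y t. geodesic_in S c x y \<Longrightarrow> x \<in> S \<Longrightarrow> y \<in> S \<Longrightarrow> x \<noteq> y \<Longrightarrow> 0 < t \<Longrightarrow> t < 1
      \<Longrightarrow> \<not> linked (c t) x y"
    and g: "path g" "path_image g \<subseteq> S" "pathfinish g = pathstart g"
  shows "homotopic_paths S g (linepath (pathstart g) (pathstart g))"
proof -
  define p where "p = pathstart g"
  have pS: "p \<in> S" using g unfolding p_def by auto
  obtain C where C: "\<And>y. y \<in> S \<Longrightarrow> geodesic_in S (C y) p y"
    using geodesic_exists[OF pS] by metis
  \<comment> \<open>The point at distance \<open>r\<close> from \<open>p\<close> on the way to
    \<open>y\<close>, or \<open>y\<close> itself if that is nearer. For \<open>y = p\<close>
    division by zero gives the parameter 0 and the value \<open>p\<close>.\<close>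
  define G where "G y r = C y (min r (dist p y) / dist p y)" for y r
  have frac: "0 \<le> min r (dist p y) / dist p y" "min r (dist p y) / dist p y \<le> 1" if "0 \<le> r" for y r
    using that by (auto simp: divide_le_eq_1)
  have GS: "G y r \<in> S" if "y \<in> S" "0 \<le> r" for y r
    unfolding G_def using geodesic_inD(3)[OF C[OF that(1)] frac[OF that(2)]] .
  have Gd: "dist p (G y r) = min r (dist p y)" "dist (G y r) y = dist p y - min r (dist p y)"
    if "y \<in> S" "0 \<le> r" for y r
  proof -
    have "min r (dist p y) / dist p y * dist p y = min r (dist p y)" using that(2) by simp
    then show "dist p (G y r) = min r (dist p y)" "dist (G y r) y = dist p y - min r (dist p y)"
      unfolding G_def using geodesic_in_dist[OF C[OF that(1)] frac[OF that(2), of y]]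
      by (simp_all only: left_diff_distrib mult_1_left)
  qed
  have Grr: "dist (G y r) (G y r') \<le> dist r r'" if "y \<in> S" "0 \<le> r" "0 \<le> r'" for y r r'
  proof -
    have "dist (G y r) (G y r')
        = \<bar>min r (dist p y) / dist p y - min r' (dist p y) / dist p y\<bar> * dist p y"
      unfolding G_def using geodesic_inD(4)[OF C[OF that(1)] frac[OF that(2)] frac[OF that(3)]] .
    also have "\<dots> \<le> dist r r'"
    proof (cases "dist p y = 0")
      case False
      then have "\<bar>min r (dist p y) / dist p y - min r' (dist p y) / dist p y\<bar> * dist p y
          = \<bar>min r (dist p y) - min r' (dist p y)\<bar>"
        by (simp add: abs_mult_pos' flip: diff_divide_distrib)
      then show ?thesis by (auto simp: dist_real_def min_def abs_if)
    qed simp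
    finally show ?thesis .
  qed
  \<comment> \<open>If \<open>G y r\<close> is farther from \<open>y\<close> than \<open>y'\<close>
    is, it separates \<open>p\<close> from \<open>y\<close> and hence from \<open>y'\<close>, so
    both geodesics pass through it at the same radius. Otherwise the truncated points lie within
    \<open>dist y y'\<close> of \<open>y\<close> and within \<open>2 * dist y y'\<close> of
    \<open>y'\<close>; adding \<open>dist y y'\<close> gives the factor 4.\<close>
  have Gyy: "dist (G y r) (G y' r) \<le> 4 * dist y y'" if y: "y \<in> S" "y' \<in> S" and r: "0 \<le> r" for y y' r
  proof -
    have tri: "dist p y \<le> dist p y' + dist y y'" "dist p y' \<le> dist p y + dist y y'"
      by (metis dist_commute dist_triangle, metis dist_triangle)
    show ?thesis
    proof (cases "r < dist p y - dist y y'")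
      case True
      show ?thesis
      proof (cases "r = 0")
        case True
        then have "G y r = p" "G y' r = p"
          using Gd(1)[OF y(1) r] Gd(1)[OF y(2) r] by auto
        then show ?thesis by simp
      next
        case False
        define z where "z = G y r"
        have rr: "0 < r" "r < dist p y" "r < dist p y'"
          using False r True tri zero_le_dist[of y y'] by linarith+
        have dz: "dist p z = r" "dist z y = dist p y - r"
          using Gd[OF y(1) r] rr unfolding z_def by auto
        have dpos: "0 < dist p y" using rr by linarith
        then have "p \<noteq> y" by auto
        moreover have "0 < r / dist p y" using rr dpos by (intro divide_pos_pos)
        moreover have "r / dist p y < 1" using rr dpos by (subst divide_less_eq) simp
        ultimately have "\<not> linked (C y (r / dist p y)) p y" by (intro tree[OF C[OF y(1)]] pS y)
        then have n: "\<not> linked z p y" using rr by (simp add: z_def G_def)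
        have "linked z y y'"
          using dz True y by (intro linked_if_short) (auto simp: dist_commute)
        then have "\<not> linked z p y'" using n by (meson path_component_sym path_component_trans)
        then obtain t where t: "0 \<le> t" "t \<le> 1" "C y' t = z"
          using geodesic_meets[OF C[OF y(2)]] by blast
        then have "r = t * dist p y'" using geodesic_in_dist(1)[OF C[OF y(2)], of t] dz by auto
        then have "G y' r = z" using t rr unfolding G_def by auto
        then show ?thesis unfolding z_def by simp
      qed
    next
      case False
      have "dist (G y r) (G y' r) \<le> dist (G y r) y + (dist y y' + dist y' (G y' r))"
        by (meson dist_triangle order_trans add_left_mono)
      then show ?thesis
        using Gd(2)[OF y(1) r] Gd(2)[OF y(2) r] False tri by (simp add: dist_commute min_def split: if_splits)
    qed
  qed
  have "5-lipschitz_on (S \<times> {0..}) (\<lambda>(y, r). G y r)"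
  proof (rule lipschitz_onI)
    fix a b :: "'v \<times> real" assume "a \<in> S \<times> {0..}" "b \<in> S \<times> {0..}"
    then obtain y r y' r' where ab: "a = (y, r)" "b = (y', r')" "y \<in> S" "y' \<in> S" "0 \<le> r" "0 \<le> r'"
      by auto
    have "dist (G y r) (G y' r') \<le> dist (G y r) (G y' r) + dist (G y' r) (G y' r')"
      by (rule dist_triangle)
    also have "\<dots> \<le> 4 * dist y y' + dist r r'" using Gyy[of y y' r] Grr[of y' r r'] ab by auto
    also have "\<dots> \<le> 5 * dist a b"
      using dist_fst_le[of a b] dist_snd_le[of a b] ab by auto
    finally show "dist (case a of (y, r) \<Rightarrow> G y r) (case b of (y, r) \<Rightarrow> G y r) \<le> 5 * dist a b"
      using ab by simp
  qed simp
  then have cont: "continuous_on (S \<times> {0..}) (\<lambda>(y, r). G y r)"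
    by (rule lipschitz_on_continuous_on)
  have "bounded (path_image g)" using g(1) by (simp add: bounded_path_image)
  then obtain R where R: "\<And>w. w \<in> path_image g \<Longrightarrow> dist p w \<le> R"
    unfolding bounded_any_center[where a = p] by blast
  have R0: "0 \<le> R" using R[of p] unfolding p_def by auto
  have gS: "g s \<in> S" "dist p (g s) \<le> R" if "s \<in> {0..1}" for s
    using g R that by (auto simp: path_image_def)
  \<comment> \<open>The radius shrinks from \<open>R\<close>, where no point of the loop is cut off,
    to 0.\<close>
  let ?h = "\<lambda>(t, s). G (g s) ((1 - t) * R)"
  have c: "continuous_on ({0..1} \<times> {0..1}) (\<lambda>x. (g (snd x), (1 - fst x) * R))"
  proof (intro continuous_on_Pair)
    show "continuous_on ({0..1} \<times> {0..1}) (\<lambda>x::real \<times> real. g (snd x))"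
      by (rule continuous_on_compose2[OF g(1)[unfolded path_def] continuous_on_snd[OF continuous_on_id]]) auto
    show "continuous_on ({0..1} \<times> {0..1}) (\<lambda>x::real \<times> real. (1 - fst x) * R)"
      by (intro continuous_intros)
  qed
  have im: "(\<lambda>x. (g (snd x), (1 - fst x) * R)) ` ({0..1} \<times> {0..1}) \<subseteq> S \<times> {0..}"
    using gS R0 by auto
  from continuous_on_compose2[OF cont c im]
  have ch: "continuous_on ({0..1} \<times> {0..1}) ?h" by (simp add: case_prod_beta)
  have end1: "G y R = y" if "y \<in> S" "dist p y \<le> R" for y
    using Gd(2)[OF that(1) R0] that(2) by simp
  have end0: "G y 0 = p" if "y \<in> S" for y
    using Gd(1)[OF that, of 0] by simp
  have endp: "G p r = p" if "0 \<le> r" for r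
    using Gd(1)[OF pS that] that by simp
  have g01: "g 0 = p" "g 1 = p" using g(3) by (auto simp: p_def pathstart_def pathfinish_def)
  show ?thesis
    unfolding homotopic_paths p_def[symmetric]
  proof (intro exI[of _ ?h] conjI ballI)
    have nn: "0 \<le> (1 - t) * R" if "t \<in> {0..1}" for t using that R0 by simp
    show "continuous_on ({0..1} \<times> {0..1}) ?h" by (rule ch)
    show "?h \<in> {0..1} \<times> {0..1} \<rightarrow> S" using GS[OF gS(1) nn] by auto
    show "?h (0, s) = g s" if "s \<in> {0..1}" for s using end1[OF gS[OF that]] by simp
    show "?h (1, s) = linepath p p s" if "s \<in> {0..1}" for s
      using end0[OF gS(1)[OF that]] by (simp add: linepath_def algebra_simps flip: scaleR_add_left)
    show "pathstart (?h \<circ> Pair t) = p" "pathfinish (?h \<circ> Pair t) = pathfinish g"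
      if "t \<in> {0..1}" for t
      using endp[OF nn[OF that]] g01 by (simp_all add: pathstart_def pathfinish_def)
  qed
qed

end

section \<open>Pairwise disjoint branches along a geodesic\<close>

context cut_point_set
begin

text \<open>A path from \<open>x\<close> to \<open>y\<close> avoiding \<open>c t0\<close> avoids a
  neighbourhood of it, so for \<open>t\<close> near \<open>t0\<close> the other nearby points of the
  geodesic lie on one side of \<open>c t\<close>; \<open>b t\<close> is chosen on another side. A
  common point \<open>w\<close> of two branches would have \<open>c s\<close> between
  \<open>w\<close> and \<open>c t\<close>, and also \<open>c t\<close> between \<open>w\<close> and
  \<open>c s\<close>.\<close>

lemma disjoint_branches:
  assumes c: "geodesic_in S c x y" and xy: "x \<in> S" "y \<in> S" "x \<noteq> y"
    and t0: "0 < t0" "t0 < 1" "linked (c t0) x y"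
  obtains l u b where "(l::real) < u" "\<And>t. t \<in> {l<..<u} \<Longrightarrow> c t \<in> S \<and> b t \<in> S \<and> b t \<noteq> c t"
    "\<And>s t. s \<in> {l<..<u} \<Longrightarrow> t \<in> {l<..<u} \<Longrightarrow> s \<noteq> t \<Longrightarrow> branch (c s) (b s) \<inter> branch (c t) (b t) = {}"
proof -
  obtain p where p: "path p" "path_image p \<subseteq> S - {c t0}" "pathstart p = x" "pathfinish p = y"
    using t0(3) unfolding path_component_def by blast
  have "closed (path_image p)" using p(1) by (simp add: closed_path_image)
  moreover have "c t0 \<notin> path_image p" using p by auto
  ultimately obtain e where e: "e > 0" "ball (c t0) e \<subseteq> - path_image p"
    by (metis open_contains_ball ComplI open_Compl)
  \<comment> \<open>The curve \<open>c\<close> has speed \<open>dist x y\<close>, so the last bound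
    keeps \<open>c t\<close> within \<open>e\<close> of \<open>c t0\<close>; the other two keep
    \<open>t\<close> strictly between 0 and 1.\<close>
  define D where "D = min (min t0 (1 - t0)) (e / dist x y)"
  have Dxy: "D * dist x y \<le> e" and D: "0 < D" "D \<le> t0" "D \<le> 1 - t0"
    using e t0 xy by (auto simp: D_def pos_le_divide_eq[symmetric])
  let ?J = "{t0 - D<..<t0 + D}"
  have J: "0 < t" "t < 1" "c t \<in> S" "c t \<notin> path_image p" if "t \<in> ?J" for t
  proof -
    show t: "0 < t" "t < 1" using that D by auto
    then show "c t \<in> S" using geodesic_inD[OF c] by auto
    have "dist (c t0) (c t) = \<bar>t0 - t\<bar> * dist x y"
      using geodesic_inD(4)[OF c] t t0 by auto
    also have "\<dots> < D * dist x y" using that xy by (intro mult_strict_right_mono) auto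
    finally show "c t \<notin> path_image p" using Dxy e by (auto simp: subset_iff)
  qed
  have inj: "c s \<noteq> c t" if "0 \<le> s" "s \<le> 1" "0 \<le> t" "t \<le> 1" "s \<noteq> t" for s t
    using geodesic_inD(4)[OF c that(1-4)] that xy by auto
  \<comment> \<open>For \<open>s < t\<close> follow \<open>c\<close> between \<open>x\<close> and
    \<open>c s\<close>. For \<open>s > t\<close> follow \<open>c\<close> on to \<open>y\<close> and
    return to \<open>x\<close> along \<open>p\<close>.\<close>
  have lx: "linked (c t) x (c s)" if "s \<in> ?J" "t \<in> ?J" "s \<noteq> t" for s t
  proof (cases "s < t")
    case True
    have "linked (c t) (c 0) (c s)"
      using J[OF that(1)] J[OF that(2)] True inj[of _ t]
      by (intro geodesic_linked[OF c]) force+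
    then show ?thesis using geodesic_inD(1)[OF c] by simp
  next
    case False
    have "c t \<noteq> c r" if "r \<in> {s..1}" for r
      using J[OF \<open>s \<in> ?J\<close>] J[OF \<open>t \<in> ?J\<close>] False \<open>s \<noteq> t\<close> that by (intro inj) auto
    then have "c t \<notin> c ` {s..1}" by blast
    then have "linked (c t) (c s) (c 1)"
      using J[OF that(1)] by (intro geodesic_linked[OF c]) auto
    moreover have "linked (c t) x y" using path_linked[of p "c t"] p J[OF that(2)] by auto
    ultimately show ?thesis
      using geodesic_inD(2)[OF c] by (metis path_component_sym path_component_trans)
  qed
  have "\<exists>b. b \<in> S \<and> b \<noteq> c t \<and> \<not> linked (c t) x b" if "t \<in> ?J" for t
    using ex_separated[OF J(3)[OF that] xy(1)] by metis
  then obtain b where b: "\<And>t. t \<in> ?J \<Longrightarrow> b t \<in> S \<and> b t \<noteq> c t \<and> \<not> linked (c t) x (b t)"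
    by metis
  show ?thesis
  proof
    show "t0 - D < t0 + D" using D by simp
    show "c t \<in> S \<and> b t \<in> S \<and> b t \<noteq> c t" if "t \<in> ?J" for t using b J that by blast
    fix s t assume st: "s \<in> ?J" "t \<in> ?J" "s \<noteq> t"
    have notin: "c s \<notin> branch (c t) (b t)" if "s \<in> ?J" "t \<in> ?J" "s \<noteq> t" for s t
    proof -
      have "\<not> linked (c t) (b t) (c s)"
        using lx[OF that] b[OF that(2)] by (meson path_component_sym path_component_trans)
      then show ?thesis using J[OF that(1)] J[OF that(2)] inj[of s t] that(3) by (auto simp: branch_def)
    qed
    show "branch (c s) (b s) \<inter> branch (c t) (b t) = {}"
    proof (rule ccontr)
      assume "\<not> ?thesis"
      then obtain w where w: "w \<in> branch (c s) (b s)" "w \<in> branch (c t) (b t)" by blast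
      then have "w \<noteq> c s" "w \<noteq> c t" using notin[of s t] notin[of t s] st by auto
      then have lw: "linked (c s) (b s) w" "linked (c t) (b t) w" using w by (auto simp: branch_def)
      have "\<not> linked (c s) w (c t)"
        using lw lx[of t s] b[OF st(1)] st by (metis path_component_sym path_component_trans)
      moreover have "\<not> linked (c t) w (c s)"
        using lw lx[of s t] b[OF st(2)] st by (metis path_component_sym path_component_trans)
      ultimately have "dist w (c t) = dist w (c s) + dist (c s) (c t)"
        "dist w (c s) = dist w (c t) + dist (c t) (c s)"
        using separated_dist J st linkedD[OF lw(1)] by metis+
      then show False using inj[of s t] J[OF st(1)] J[OF st(2)] st(3) by (simp add: dist_commute)
    qed
  qed
qed

end

section \<open>Free subgroups and the fundamental group\<close>

text \<open>Uncountable generation is a matter of cardinality: a countable set has only countably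
  many words, while the generators are already uncountable. Words are written in the indices;
  applied to the word \<open>k m^-1\<close>, the hypothesis also shows that \<open>b\<close> is
  injective on \<open>K\<close>.\<close>

lemma (in group) has_uncountably_generated_free_subgroupI:
  fixes b :: "'k \<Rightarrow> 'a" and K :: "'k set"
  assumes b: "b ` K \<subseteq> carrier G" and K: "uncountable K"
    and nt: "\<And>w. w \<noteq> [] \<Longrightarrow> snd ` set w \<subseteq> K \<Longrightarrow> reduced_word w \<Longrightarrow>
      word_value G (map (\<lambda>l. letter_value G (fst l, b (snd l))) w) \<noteq> \<one>"
  shows "has_uncountably_generated_free_subgroup G"
proof -
  have inj: "inj_on b K"
  proof (rule inj_onI, rule ccontr)
    fix k m assume km: "k \<in> K" "m \<in> K" "b k = b m" "k \<noteq> m"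
    have "word_value G (map (\<lambda>l. letter_value G (fst l, b (snd l))) [(True, k), (False, m)]) = \<one>"
      using km b by (auto simp: word_value_def letter_value_def)
    moreover have "reduced_word [(True, k), (False, m)]" using km by (auto simp: reduced_word_def)
    ultimately show False using nt[of "[(True, k), (False, m)]"] km by auto
  qed
  let ?H = "generate G (b ` K)"
  let ?GH = "G\<lparr>carrier := ?H\<rparr>"
  have H: "subgroup ?H G" by (rule generate_is_subgroup[OF b])
  have grp: "group ?GH" by (rule subgroup_imp_group[OF H])
  have BH: "b ` K \<subseteq> ?H" by (auto intro: generate.incl)
  have wv: "word_value ?GH ws = word_value G ws" for ws by (simp add: word_value_def)
  have "free_basis ?GH (b ` K)"
    unfolding free_basis_def
  proof (intro conjI allI impI)
    show "b ` K \<subseteq> carrier ?GH" using BH by simp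
    show "generate ?GH (b ` K) = carrier ?GH" using generate_consistent[OF BH H] by simp
    fix w assume w: "set w \<subseteq> UNIV \<times> b ` K \<and> w \<noteq> [] \<and> reduced_word w"
    define w' where "w' = map (\<lambda>l. (fst l, inv_into K b (snd l))) w"
    have sK: "snd l \<in> b ` K" if "l \<in> set w" for l using w that by (cases l) (auto simp: subset_iff)
    have "reduced_word w'"
      unfolding reduced_word_def
    proof (intro allI impI)
      fix i assume i: "Suc i < length w'"
      then have "snd (w ! i) \<in> b ` K" "snd (w ! Suc i) \<in> b ` K"
        by (auto intro!: sK simp: w'_def)
      then show "\<not> (snd (w' ! i) = snd (w' ! Suc i) \<and> fst (w' ! i) \<noteq> fst (w' ! Suc i))"
        using w i unfolding reduced_word_def by (auto simp: w'_def inv_into_injective)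
    qed
    moreover have "snd ` set w' \<subseteq> K" using sK by (auto simp: w'_def inv_into_into)
    moreover have "w' \<noteq> []" using w by (simp add: w'_def)
    moreover have "map (\<lambda>l. letter_value G (fst l, b (snd l))) w' = map (letter_value ?GH) w"
    proof -
      have "letter_value G (fst l, b (inv_into K b (snd l))) = letter_value ?GH l" if "l \<in> set w" for l
        using f_inv_into_f[OF sK[OF that]] m_inv_consistent[OF H, of "snd l"] BH sK[OF that]
        by (auto simp: letter_value_def subset_iff)
      then show ?thesis by (simp add: w'_def)
    qed
    ultimately show "word_value ?GH (map (letter_value ?GH) w) \<noteq> \<one>\<^bsub>?GH\<^esub>"
      using nt[of w'] by (simp add: wv)
  qed
  moreover have "\<not> countably_generated ?GH"
  proof
    assume "countably_generated ?GH"
    then obtain T where T: "T \<subseteq> carrier ?GH" "countable T" "generate ?GH T = carrier ?GH"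
      unfolding countably_generated_def by blast
    have "generate ?GH T \<subseteq> word_value ?GH ` words_over ?GH T"
      using group.ex_word[OF grp T(1)] by blast
    moreover have "countable (words_over ?GH T)"
      using T(2) unfolding words_over_def by (intro countable_lists) auto
    ultimately have "countable (generate ?GH T)" by (rule countable_subset[OF _ countable_image])
    then have "countable ?H" using T(3) by simp
    then have "countable (b ` K)" using BH countable_subset by blast
    then show False using K inj countable_image_inj_eq by blast
  qed
  ultimately show ?thesis
    unfolding has_uncountably_generated_free_subgroup_def free_group_def using H grp by blast
qed

section \<open>The fundamental group through paths in a normed space\<close>

locale path_model =
  fixes Y :: "'a topology" and S :: "'v::real_normed_vector set" and f :: "'a \<Rightarrow> 'v" and g and x :: 'a
  assumes hom: "homeomorphic_maps Y (top_of_set S) f g" and x: "x \<in> topspace Y"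
begin

lemma fS: "y \<in> topspace Y \<Longrightarrow> f y \<in> S" and gY: "v \<in> S \<Longrightarrow> g v \<in> topspace Y"
  and gf: "y \<in> topspace Y \<Longrightarrow> g (f y) = y" and fg: "v \<in> S \<Longrightarrow> f (g v) = v"
  and contf: "continuous_map Y (top_of_set S) f" and contg: "continuous_map (top_of_set S) Y g"
  using hom by (auto simp: homeomorphic_maps_def continuous_map_def)

definition based :: "(real \<Rightarrow> 'v) \<Rightarrow> bool" where
  "based q \<longleftrightarrow> path q \<and> path_image q \<subseteq> S \<and> pathstart q = f x \<and> pathfinish q = f x"

abbreviation \<pi> where "\<pi> \<equiv> fundamental_group Y x"

text \<open>Every class of loops in \<open>Y\<close> has this form, so calculations in
  \<open>\<pi>\<close> reduce to \<open>homotopic_paths\<close> in \<open>S\<close>.\<close>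

definition cl :: "(real \<Rightarrow> 'v) \<Rightarrow> (real \<Rightarrow> 'a) set" where
  "cl q = loop_homotopy Y x `` {g \<circ> q}"

lemma pathin_eq: "pathin Y p \<longleftrightarrow> continuous_map (top_of_set {0..1}) Y p"
  by (simp add: pathin_def)

lemma path_in_S: "path q \<and> path_image q \<subseteq> S \<longleftrightarrow> continuous_map (top_of_set {0..1}) (top_of_set S) q"
  by (auto simp: path_def path_image_def)

lemma based_f:
  assumes "p \<in> loops_at Y x"
  shows "based (f \<circ> p)"
proof -
  have "continuous_map (top_of_set {0..1}) (top_of_set S) (f \<circ> p)"
    using assms by (intro continuous_map_compose[OF _ contf]) (simp add: loops_at_def pathin_eq)
  then show ?thesis
    using assms unfolding based_def conj_assoc[symmetric] path_in_S
    by (simp only: loops_at_def pathstart_def pathfinish_def) simp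
qed

lemma loop_g:
  assumes "based q"
  shows "g \<circ> q \<in> loops_at Y x"
proof -
  have "continuous_map (top_of_set {0..1}) Y (g \<circ> q)"
    using assms path_in_S[of q] by (intro continuous_map_compose[OF _ contg]) (simp add: based_def)
  then show ?thesis
    using assms gf[OF x] by (auto simp: loops_at_def pathin_eq based_def pathstart_def pathfinish_def)
qed

lemma loop_homotopy_iff:
  assumes "p \<in> loops_at Y x" "q \<in> loops_at Y x"
  shows "(p, q) \<in> loop_homotopy Y x \<longleftrightarrow> homotopic_paths S (f \<circ> p) (f \<circ> q)"
proof
  assume "(p, q) \<in> loop_homotopy Y x"
  then have "homotopic_with (\<lambda>r. r 0 = x \<and> r 1 = x) (top_of_set {0..1}) Y p q"
    by (simp add: loop_homotopy_def)
  from homotopic_with_compose_continuous_map_left[OF this contf,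
      of "\<lambda>r. pathstart r = pathstart (f \<circ> p) \<and> pathfinish r = pathfinish (f \<circ> p)"]
  show "homotopic_paths S (f \<circ> p) (f \<circ> q)"
    using assms unfolding homotopic_paths_def
    by (auto simp: loops_at_def pathstart_def pathfinish_def)
next
  assume h: "homotopic_paths S (f \<circ> p) (f \<circ> q)"
  have "homotopic_with (\<lambda>r. r 0 = x \<and> r 1 = x) (top_of_set {0..1}) Y (g \<circ> (f \<circ> p)) (g \<circ> (f \<circ> q))"
    using assms gf[OF x]
    by (intro homotopic_with_compose_continuous_map_left[OF h[unfolded homotopic_paths_def] contg])
      (auto simp: loops_at_def pathstart_def pathfinish_def)
  \<comment> \<open>The composition is the identity only on \<open>topspace Y\<close>, which
    contains the values of a loop on the unit interval but perhaps not its other values.\<close>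
  moreover have "(g \<circ> (f \<circ> r)) t = r t" if "r \<in> loops_at Y x" "t \<in> {0..1}" for r t
  proof -
    have "r t \<in> topspace Y"
      using that unfolding loops_at_def pathin_eq continuous_map_def by auto
    then show ?thesis by (simp add: gf)
  qed
  ultimately have "homotopic_with (\<lambda>r. r 0 = x \<and> r 1 = x) (top_of_set {0..1}) Y p q"
    using assms by (elim homotopic_with_eq) auto
  then show "(p, q) \<in> loop_homotopy Y x" using assms by (simp add: loop_homotopy_def)
qed

lemma based_fg:
  assumes "based q"
  shows "homotopic_paths S (f \<circ> (g \<circ> q)) q"
proof (rule homotopic_paths_sym[OF homotopic_paths_eq])
  show "path q" "path_image q \<subseteq> S" using assms by (auto simp: based_def)
  fix t :: real assume "t \<in> {0..1}"
  then have "q t \<in> S" using assms by (auto simp: based_def path_image_def)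
  then show "q t = (f \<circ> (g \<circ> q)) t" by (simp add: fg)
qed

lemma cl_iff:
  assumes "based q"
  shows "p \<in> cl q \<longleftrightarrow> p \<in> loops_at Y x \<and> homotopic_paths S q (f \<circ> p)"
proof -
  have "p \<in> cl q \<longleftrightarrow> p \<in> loops_at Y x \<and> homotopic_paths S (f \<circ> (g \<circ> q)) (f \<circ> p)"
    using loop_homotopy_iff[OF loop_g[OF assms], of p] loop_g[OF assms]
    by (auto simp: cl_def loop_homotopy_def)
  then show ?thesis
    using based_fg[OF assms] by (meson homotopic_paths_sym homotopic_paths_trans)
qed

lemma cl_eq_iff:
  assumes "based q" "based r"
  shows "cl q = cl r \<longleftrightarrow> homotopic_paths S q r"
proof
  assume eq: "cl q = cl r"
  have "g \<circ> q \<in> cl q"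
    using cl_iff[OF assms(1)] loop_g[OF assms(1)] homotopic_paths_sym[OF based_fg[OF assms(1)]] by blast
  then have "homotopic_paths S r (f \<circ> (g \<circ> q))" using eq cl_iff[OF assms(2)] by blast
  then show "homotopic_paths S q r"
    using based_fg[OF assms(1)] by (meson homotopic_paths_sym homotopic_paths_trans)
next
  assume "homotopic_paths S q r"
  then show "cl q = cl r"
    using cl_iff[OF assms(1)] cl_iff[OF assms(2)] by (blast intro: homotopic_paths_sym homotopic_paths_trans)
qed

lemma class_eq_cl:
  assumes "p \<in> loops_at Y x"
  shows "loop_homotopy Y x `` {p} = cl (f \<circ> p)"
proof -
  have "r \<in> loop_homotopy Y x `` {p} \<longleftrightarrow> r \<in> cl (f \<circ> p)" for r
    using loop_homotopy_iff[OF assms, of r] cl_iff[OF based_f[OF assms], of r] assms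
    by (auto simp: loop_homotopy_def)
  then show ?thesis by blast
qed

lemma carrier_\<pi>: "carrier \<pi> = cl ` {q. based q}"
proof
  show "carrier \<pi> \<subseteq> cl ` {q. based q}"
    by (auto simp: fundamental_group_def quotient_def class_eq_cl based_f)
  show "cl ` {q. based q} \<subseteq> carrier \<pi>"
    using loop_g by (auto simp: fundamental_group_def quotient_def cl_def)
qed

lemma based_const: "based (linepath (f x) (f x))"
  using fS[OF x] by (simp add: based_def)

lemma one_\<pi>: "\<one>\<^bsub>\<pi>\<^esub> = cl (linepath (f x) (f x))"
proof -
  have "g \<circ> linepath (f x) (f x) = (\<lambda>_. x)"
    using gf[OF x] by (auto simp: linepath_def algebra_simps simp flip: scaleR_add_left)
  then show ?thesis by (simp add: fundamental_group_def cl_def)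
qed

lemma based_join: "based q \<Longrightarrow> based r \<Longrightarrow> based (q +++ r)"
  by (simp add: based_def path_image_join)

lemma based_reverse: "based q \<Longrightarrow> based (reversepath q)"
  by (simp add: based_def)

lemma loop_concat_join: "f \<circ> loop_concat p q = (f \<circ> p) +++ (f \<circ> q)"
  by (auto simp: loop_concat_def joinpaths_def)

lemma loop_concat_loop:
  assumes "p \<in> loops_at Y x" "q \<in> loops_at Y x"
  shows "loop_concat p q \<in> loops_at Y x"
proof -
  have top: "r t \<in> topspace Y" if "r \<in> loops_at Y x" "t \<in> {0..1}" for r t
    using that unfolding loops_at_def pathin_eq continuous_map_def by auto
  have "loop_concat p q t = (g \<circ> ((f \<circ> p) +++ (f \<circ> q))) t" if "t \<in> {0..1}" for t
    using top[OF assms(1), of "2 * t"] top[OF assms(2), of "2 * t - 1"] that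
    by (auto simp: loop_concat_def joinpaths_def gf)
  moreover have "g \<circ> ((f \<circ> p) +++ (f \<circ> q)) \<in> loops_at Y x"
    by (intro loop_g based_join based_f assms)
  ultimately show ?thesis
    by (auto simp: loops_at_def pathin_eq elim: continuous_map_eq)
qed

text \<open>The product is a union over all pairs of representatives; each pair contributes the same
  class.\<close>

lemma mult_\<pi>:
  assumes "based q" "based r"
  shows "cl q \<otimes>\<^bsub>\<pi>\<^esub> cl r = cl (q +++ r)"
proof -
  have "loop_homotopy Y x `` {loop_concat p p'} = cl (q +++ r)" if "p \<in> cl q" "p' \<in> cl r" for p p'
  proof -
    have pq: "p \<in> loops_at Y x" "homotopic_paths S q (f \<circ> p)"
      and pr: "p' \<in> loops_at Y x" "homotopic_paths S r (f \<circ> p')"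
      using that cl_iff assms by auto
    have "homotopic_paths S ((f \<circ> p) +++ (f \<circ> p')) (q +++ r)"
      using pq pr based_f[OF pq(1)] based_f[OF pr(1)]
      by (intro homotopic_paths_join) (auto simp: homotopic_paths_sym based_def)
    then show ?thesis
      using class_eq_cl[OF loop_concat_loop[OF pq(1) pr(1)]] assms pq pr
      by (simp add: loop_concat_join cl_eq_iff based_join based_f)
  qed
  moreover have "g \<circ> q \<in> cl q" "g \<circ> r \<in> cl r"
    using assms cl_iff loop_g based_fg homotopic_paths_sym by blast+
  ultimately show ?thesis
    by (auto simp: fundamental_group_def)
qed

lemma reverse_cancel:
  assumes "based q"
  shows "cl (q +++ reversepath q) = cl (linepath (f x) (f x))"
    "cl (reversepath q +++ q) = cl (linepath (f x) (f x))"
  using assms homotopic_paths_rinv[of q S] homotopic_paths_linv[of q S]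
  by (simp_all add: cl_eq_iff based_join based_reverse based_const) (simp_all add: based_def)

lemma group_\<pi>: "group \<pi>"
proof (rule groupI)
  show "\<one>\<^bsub>\<pi>\<^esub> \<in> carrier \<pi>" using based_const by (auto simp: one_\<pi> carrier_\<pi>)
  fix a b assume ab: "a \<in> carrier \<pi>" "b \<in> carrier \<pi>"
  then obtain p q where p: "a = cl p" "based p" and q: "b = cl q" "based q" by (auto simp: carrier_\<pi>)
  show "a \<otimes>\<^bsub>\<pi>\<^esub> b \<in> carrier \<pi>" using p q based_join by (auto simp: mult_\<pi> carrier_\<pi>)
  show "\<one>\<^bsub>\<pi>\<^esub> \<otimes>\<^bsub>\<pi>\<^esub> a = a"
    using p homotopic_paths_lid'[of p S "f x"] based_const
    by (simp add: one_\<pi> mult_\<pi> cl_eq_iff based_join) (simp add: based_def)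
  show "\<exists>b\<in>carrier \<pi>. b \<otimes>\<^bsub>\<pi>\<^esub> a = \<one>\<^bsub>\<pi>\<^esub>"
    using p based_reverse[of p] reverse_cancel(2)[of p]
    by (intro bexI[of _ "cl (reversepath p)"]) (auto simp: one_\<pi> mult_\<pi> carrier_\<pi>)
  fix c assume "c \<in> carrier \<pi>"
  then obtain r where r: "c = cl r" "based r" by (auto simp: carrier_\<pi>)
  have "homotopic_paths S ((p +++ q) +++ r) (p +++ (q +++ r))"
    using p q r by (intro homotopic_paths_sym[OF homotopic_paths_assoc]) (auto simp: based_def)
  then show "a \<otimes>\<^bsub>\<pi>\<^esub> b \<otimes>\<^bsub>\<pi>\<^esub> c = a \<otimes>\<^bsub>\<pi>\<^esub> (b \<otimes>\<^bsub>\<pi>\<^esub> c)"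
    using p q r by (simp add: mult_\<pi> based_join cl_eq_iff)
qed

lemma inv_\<pi>:
  assumes "based q"
  shows "inv\<^bsub>\<pi>\<^esub> cl q = cl (reversepath q)"
  using assms based_reverse[OF assms] reverse_cancel(2)[OF assms]
  by (intro group.inv_equality[OF group_\<pi>]) (auto simp: mult_\<pi> one_\<pi> carrier_\<pi>)

lemma cl_in_carrier: "based q \<Longrightarrow> cl q \<in> carrier \<pi>"
  by (auto simp: carrier_\<pi>)

end

section \<open>Alternating products of loops in disjoint branches\<close>

definition leads :: "'i \<Rightarrow> ('i \<times> 'p) list \<Rightarrow> bool" where
  "leads i w \<longleftrightarrow> w \<noteq> [] \<and> fst (hd w) = i"

section \<open>Normal forms in a free product of copies of one group\<close>

context group
begin

primrec normal_word :: "('i \<times> 'a) list \<Rightarrow> bool" where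
  "normal_word [] \<longleftrightarrow> True"
| "normal_word (l # w) \<longleftrightarrow> snd l \<in> carrier G \<and> snd l \<noteq> \<one> \<and> \<not> leads (fst l) w \<and> normal_word w"

definition prepend :: "'i \<Rightarrow> 'a \<Rightarrow> ('i \<times> 'a) list \<Rightarrow> ('i \<times> 'a) list" where
  "prepend i a w = (if a = \<one> then w else (i, a) # w)"

text \<open>Left multiplication of a normal form by an element of the copy \<open>i\<close>, as in
  van der Waerden's proof of the normal form theorem for free products.\<close>

definition act :: "'i \<Rightarrow> 'a \<Rightarrow> ('i \<times> 'a) list \<Rightarrow> ('i \<times> 'a) list" where
  "act i a w = (if leads i w then prepend i (a \<otimes> snd (hd w)) (tl w) else prepend i a w)"

text \<open>Allowing \<open>c\<close> to be the identity removes the case distinction: in this form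
  \<open>act\<close> multiplies \<open>c\<close> and leaves \<open>v\<close> alone, so the laws of
  an action become group laws.\<close>

lemma normal_word_prepend:
  assumes "normal_word w"
  obtains c v where "w = prepend i c v" "c \<in> carrier G" "normal_word v" "\<not> leads i v"
proof (cases "leads i w")
  case True
  then obtain c v where "w = (i, c) # v" by (cases w) (auto simp: leads_def)
  then show ?thesis using that[of c v] assms by (simp add: prepend_def)
next
  case False
  then show ?thesis using that[of \<one> w] assms by (simp add: prepend_def)
qed

lemma act_prepend:
  "c \<in> carrier G \<Longrightarrow> a \<in> carrier G \<Longrightarrow> \<not> leads i v \<Longrightarrow> act i a (prepend i c v) = prepend i (a \<otimes> c) v"
  by (auto simp: act_def prepend_def leads_def)

lemma normal_word_prependI:
  "c \<in> carrier G \<Longrightarrow> normal_word v \<Longrightarrow> \<not> leads i v \<Longrightarrow> normal_word (prepend i c v)"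
  by (simp add: prepend_def)

lemma act_closed: "a \<in> carrier G \<Longrightarrow> normal_word w \<Longrightarrow> normal_word (act i a w)"
  by (erule normal_word_prepend[of w i]) (simp add: act_prepend normal_word_prependI)

lemma act_one: "normal_word w \<Longrightarrow> act i \<one> w = w"
  by (erule normal_word_prepend[of w i]) (simp add: act_prepend)

lemma act_act:
  "a \<in> carrier G \<Longrightarrow> b \<in> carrier G \<Longrightarrow> normal_word w \<Longrightarrow> act i a (act i b w) = act i (a \<otimes> b) w"
  by (erule normal_word_prepend[of w i]) (simp add: act_prepend m_assoc)

end

text \<open>The conjugating path disappears under free homotopy of loops, and a freely
  null-homotopic loop is null-homotopic with its base point fixed.\<close>

lemma homotopic_paths_conjugate_null:
  fixes S :: "'v::real_normed_vector set"
  assumes "path p" "path q" "path_image p \<subseteq> S" "path_image q \<subseteq> S"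
    "pathfinish p = pathstart q" "pathfinish q = pathstart q"
    and null: "homotopic_paths S (p +++ q +++ reversepath p) (linepath x x)"
  shows "homotopic_paths S q (linepath (pathstart q) (pathstart q))"
proof -
  have "homotopic_loops S (p +++ q +++ reversepath p) (linepath x x)"
    using homotopic_paths_imp_pathstart[OF null]
    by (intro homotopic_paths_imp_homotopic_loops[OF null]) auto
  then have "homotopic_loops S q (linepath x x)"
    using homotopic_loops_conjugate[OF assms(1-6)] by (meson homotopic_loops_sym homotopic_loops_trans)
  then show ?thesis by (rule homotopic_loops_imp_homotopic_paths_null)
qed

section \<open>Holonomy of paths in finitely many branches\<close>

definition concat_path :: "'v::real_normed_vector \<Rightarrow> ('i \<times> (real \<Rightarrow> 'v)) list \<Rightarrow> real \<Rightarrow> 'v" where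
  "concat_path x ps = foldr (\<lambda>l q. snd l +++ q) ps (linepath x x)"

text \<open>The branches that occur in one word. Finiteness makes unions of them closed; the base
  point, lying outside all of them, is sent by each retraction to the attaching point.\<close>

locale branch_family = geodesic_set S for S :: "'v::real_normed_vector set" +
  fixes I :: "'i set" and z a :: "'i \<Rightarrow> 'v" and x0 :: 'v
  assumes finite_I: "finite I" and I_ne: "I \<noteq> {}" and zS: "\<And>i. i \<in> I \<Longrightarrow> z i \<in> S"
    and disj: "\<And>i j. i \<in> I \<Longrightarrow> j \<in> I \<Longrightarrow> i \<noteq> j \<Longrightarrow> branch (z i) (a i) \<inter> branch (z j) (a j) = {}"
    and x0: "x0 \<in> S" and x0_out: "\<And>i. i \<in> I \<Longrightarrow> x0 \<notin> branch (z i) (a i)"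
begin

sublocale pm: path_model "top_of_set S" S id id x0
  using x0 by unfold_locales (auto simp: homeomorphic_maps_def)

abbreviation P where "P \<equiv> fundamental_group (top_of_set S) x0"

sublocale P: group P by (rule pm.group_\<pi>)

abbreviation \<rho> where "\<rho> i \<equiv> collapse (z i) (a i)"

abbreviation inner where "inner i \<equiv> {y. linked (z i) (a i) y}"

text \<open>The set may pass through any attaching point; only entering a branch other than
  \<open>i\<close> is excluded.\<close>

definition avoids :: "'i \<Rightarrow> 'v set \<Rightarrow> bool" where
  "avoids i T \<longleftrightarrow> (\<forall>j\<in>I. j \<noteq> i \<longrightarrow> T \<inter> inner j = {})"

text \<open>A fixed system of paths from the base point lets weights be assigned to paths that are
  not closed, such as the segments of a subdivision.\<close>

definition \<tau> :: "'v \<Rightarrow> real \<Rightarrow> 'v" where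
  "\<tau> y = (SOME p. path p \<and> path_image p \<subseteq> S \<and> pathstart p = x0 \<and> pathfinish p = y)"

lemma \<tau>:
  assumes "y \<in> S"
  shows "path (\<tau> y)" "path_image (\<tau> y) \<subseteq> S" "pathstart (\<tau> y) = x0" "pathfinish (\<tau> y) = y"
proof -
  have "\<exists>p. path p \<and> path_image p \<subseteq> S \<and> pathstart p = x0 \<and> pathfinish p = y"
    using path_connected x0 assms unfolding path_connected_def by blast
  from someI_ex[OF this]
  show "path (\<tau> y)" "path_image (\<tau> y) \<subseteq> S" "pathstart (\<tau> y) = x0" "pathfinish (\<tau> y) = y"
    unfolding \<tau>_def by auto
qed

definition loop_of :: "(real \<Rightarrow> 'v) \<Rightarrow> real \<Rightarrow> 'v" where
  "loop_of q = \<tau> (pathstart q) +++ q +++ reversepath (\<tau> (pathfinish q))"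

definition path_in :: "(real \<Rightarrow> 'v) \<Rightarrow> bool" where
  "path_in q \<longleftrightarrow> path q \<and> path_image q \<subseteq> S"

lemma path_inD:
  assumes "path_in q"
  shows "path q" "path_image q \<subseteq> S" "pathstart q \<in> S" "pathfinish q \<in> S"
    "\<And>t. t \<in> {0..1} \<Longrightarrow> q t \<in> S"
  using assms unfolding path_in_def by (auto simp: path_image_def pathstart_def pathfinish_def)

lemma based_loop_of: "path_in q \<Longrightarrow> pm.based (loop_of q)"
  using \<tau> path_inD by (auto simp: pm.based_def loop_of_def subset_path_image_join)

lemma based_path_in: "pm.based q \<Longrightarrow> path_in q"
  by (simp add: pm.based_def path_in_def)

lemma path_in_\<rho>:
  assumes "path_in q" "i \<in> I"
  shows "path_in (\<rho> i \<circ> q)"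
proof -
  have "path (\<rho> i \<circ> q)"
    using path_inD[OF assms(1)] continuous_on_collapse[OF zS[OF assms(2)]]
    by (intro path_continuous_image) (auto intro: continuous_on_subset)
  moreover have "path_image (\<rho> i \<circ> q) \<subseteq> S"
    using path_inD(2)[OF assms(1)] collapse_in[OF zS[OF assms(2)]] by (auto simp: path_image_compose)
  ultimately show ?thesis by (simp add: path_in_def)
qed

text \<open>The inverse makes concatenation of paths act on normal words from the left.\<close>
definition wt :: "'i \<Rightarrow> (real \<Rightarrow> 'v) \<Rightarrow> (real \<Rightarrow> 'v) set" where
  "wt i q = inv\<^bsub>P\<^esub> pm.cl (loop_of (\<rho> i \<circ> q))"

lemma wt_closed: "path_in q \<Longrightarrow> i \<in> I \<Longrightarrow> wt i q \<in> carrier P"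
  unfolding wt_def by (intro P.inv_closed pm.cl_in_carrier based_loop_of path_in_\<rho>)

lemma loop_of_cong:
  assumes "homotopic_paths S q r"
  shows "pm.cl (loop_of q) = pm.cl (loop_of r)"
proof -
  have q: "path_in q" and r: "path_in r"
    using homotopic_paths_imp_path[OF assms] homotopic_paths_imp_subset[OF assms] by (auto simp: path_in_def)
  have e: "pathstart q = pathstart r" "pathfinish q = pathfinish r"
    using homotopic_paths_imp_pathstart[OF assms] homotopic_paths_imp_pathfinish[OF assms] .
  have "homotopic_paths S (loop_of q) (loop_of r)"
    unfolding loop_of_def e
    using \<tau> path_inD[OF q] path_inD[OF r] assms e by (intro homotopic_paths_join) auto
  then show ?thesis using pm.cl_eq_iff based_loop_of q r by simp
qed

text \<open>The return path of the first loop cancels against the outward path of the second,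
  because both are the same \<open>\<tau>\<close>; the rest of the chain moves brackets.\<close>

lemma loop_of_join:
  assumes q: "path_in q" and r: "path_in r" and qr: "pathfinish q = pathstart r"
  shows "pm.cl (loop_of (q +++ r)) = pm.cl (loop_of q) \<otimes>\<^bsub>P\<^esub> pm.cl (loop_of r)"
proof -
  let ?t = "\<tau> (pathstart q)" and ?u = "\<tau> (pathstart r)" and ?v = "\<tau> (pathfinish r)"
  note D = path_inD[OF q] path_inD[OF r] \<tau>
  have m: "homotopic_paths S (reversepath ?u +++ ?u) (linepath (pathstart r) (pathstart r))"
    using homotopic_paths_linv[of ?u S] D by simp
  have "homotopic_paths S ((?t +++ q +++ reversepath ?u) +++ ?u +++ r +++ reversepath ?v)
     (((?t +++ q) +++ reversepath ?u) +++ ?u +++ r +++ reversepath ?v)"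
    using D qr by (intro homotopic_paths_join homotopic_paths_assoc) (auto simp: path_image_join)
  also have "homotopic_paths S \<dots> ((?t +++ q) +++ reversepath ?u +++ ?u +++ r +++ reversepath ?v)"
    using D qr by (intro homotopic_paths_sym[OF homotopic_paths_assoc]) (auto simp: path_image_join)
  also have "homotopic_paths S \<dots> ((?t +++ q) +++ (reversepath ?u +++ ?u) +++ r +++ reversepath ?v)"
    using D qr by (intro homotopic_paths_join homotopic_paths_assoc) (auto simp: path_image_join)
  also have "homotopic_paths S \<dots>
      ((?t +++ q) +++ linepath (pathstart r) (pathstart r) +++ r +++ reversepath ?v)"
    using D qr m by (intro homotopic_paths_join) (auto simp: path_image_join)
  also have "homotopic_paths S \<dots> ((?t +++ q) +++ r +++ reversepath ?v)"
    using D qr by (intro homotopic_paths_join homotopic_paths_lid') (auto simp: path_image_join)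
  also have "homotopic_paths S \<dots> (?t +++ q +++ r +++ reversepath ?v)"
    using D qr by (intro homotopic_paths_sym[OF homotopic_paths_assoc]) (auto simp: path_image_join)
  also have "homotopic_paths S \<dots> (?t +++ (q +++ r) +++ reversepath ?v)"
    using D qr by (intro homotopic_paths_join homotopic_paths_assoc) (auto simp: path_image_join)
  finally have "homotopic_paths S (loop_of q +++ loop_of r) (loop_of (q +++ r))"
    using qr by (simp add: loop_of_def)
  moreover have "path_in (q +++ r)" using D qr by (auto simp: path_in_def path_image_join)
  ultimately show ?thesis
    using pm.mult_\<pi>[OF based_loop_of[OF q] based_loop_of[OF r]] q r
    by (simp add: pm.cl_eq_iff pm.based_join based_loop_of homotopic_paths_sym)
qed

lemma wt_join:
  assumes "path_in q" "path_in r" "pathfinish q = pathstart r" "i \<in> I"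
  shows "wt i (q +++ r) = wt i r \<otimes>\<^bsub>P\<^esub> wt i q"
proof -
  have "\<rho> i \<circ> (q +++ r) = (\<rho> i \<circ> q) +++ (\<rho> i \<circ> r)"
    by (auto simp: joinpaths_def)
  then show ?thesis
    using loop_of_join[OF path_in_\<rho>[OF assms(1,4)] path_in_\<rho>[OF assms(2,4)]] assms(3)
      based_loop_of[OF path_in_\<rho>[OF assms(1,4)]] based_loop_of[OF path_in_\<rho>[OF assms(2,4)]]
    by (simp add: wt_def P.inv_mult_group pm.cl_in_carrier pathstart_compose pathfinish_compose)
qed

lemma wt_homotopic:
  assumes "homotopic_paths S q r" "i \<in> I"
  shows "wt i q = wt i r"
proof -
  have "homotopic_paths S (\<rho> i \<circ> q) (\<rho> i \<circ> r)"
    using collapse_in[OF zS[OF assms(2)]]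
    by (intro homotopic_paths_continuous_image[OF assms(1)] continuous_on_collapse zS assms) auto
  then show ?thesis unfolding wt_def by (simp add: loop_of_cong)
qed

text \<open>Closing up with \<open>\<tau>\<close> conjugates a loop, which does not affect whether
  it is null-homotopic.\<close>

lemma wt_trivial_iff:
  assumes "path_in q" "i \<in> I" "pathfinish (\<rho> i \<circ> q) = pathstart (\<rho> i \<circ> q)"
  shows "wt i q = \<one>\<^bsub>P\<^esub> \<longleftrightarrow>
    homotopic_paths S (\<rho> i \<circ> q) (linepath (pathstart (\<rho> i \<circ> q)) (pathstart (\<rho> i \<circ> q)))"
proof -
  let ?r = "\<rho> i \<circ> q" and ?y = "pathstart (\<rho> i \<circ> q)"
  note r = path_in_\<rho>[OF assms(1,2)]
  note D = path_inD[OF r] \<tau>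
  have "wt i q = \<one>\<^bsub>P\<^esub> \<longleftrightarrow> pm.cl (loop_of ?r) = \<one>\<^bsub>P\<^esub>"
    unfolding wt_def using P.inv_eq_1_iff[OF pm.cl_in_carrier[OF based_loop_of[OF r]]] by simp
  also have "\<dots> \<longleftrightarrow> homotopic_paths S (loop_of ?r) (linepath x0 x0)"
    using pm.cl_eq_iff[OF based_loop_of[OF r] pm.based_const] by (simp add: pm.one_\<pi>)
  also have "\<dots> \<longleftrightarrow> homotopic_paths S ?r (linepath ?y ?y)"
  proof
    assume "homotopic_paths S (loop_of ?r) (linepath x0 x0)"
    then show "homotopic_paths S ?r (linepath ?y ?y)"
      using D assms(3) by (intro homotopic_paths_conjugate_null[of "\<tau> ?y" ?r S x0]) (auto simp: loop_of_def)
  next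
    assume h: "homotopic_paths S ?r (linepath ?y ?y)"
    have "homotopic_paths S (loop_of ?r) (\<tau> ?y +++ linepath ?y ?y +++ reversepath (\<tau> ?y))"
      unfolding loop_of_def assms(3) using D h assms(3) by (intro homotopic_paths_join) auto
    also have "homotopic_paths S \<dots> (\<tau> ?y +++ reversepath (\<tau> ?y))"
      using D by (intro homotopic_paths_join homotopic_paths_lid') auto
    also have "homotopic_paths S \<dots> (linepath x0 x0)"
      using homotopic_paths_rinv[of "\<tau> ?y" S] D by simp
    finally show "homotopic_paths S (loop_of ?r) (linepath x0 x0)" .
  qed
  finally show ?thesis .
qed

text \<open>The retraction makes such a path constant.\<close>

lemma wt_outside:
  assumes "path_in q" "i \<in> I" "path_image q \<inter> inner i = {}"
  shows "wt i q = \<one>\<^bsub>P\<^esub>"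
proof -
  have c: "(\<rho> i \<circ> q) t = z i" if "t \<in> {0..1}" for t
  proof -
    have "q t \<in> path_image q" using that by (auto simp: path_image_def)
    then have "\<not> linked (z i) (a i) (q t)" using assms(3) by blast
    then show ?thesis by (simp add: collapse_def)
  qed
  have "homotopic_paths S (\<rho> i \<circ> q) (linepath (z i) (z i))"
    using path_inD[OF path_in_\<rho>[OF assms(1,2)]] c
    by (intro homotopic_paths_eq) (auto simp: linepath_def algebra_simps simp flip: scaleR_add_left)
  then show ?thesis
    using c wt_trivial_iff[OF assms(1,2)] by (simp add: pathstart_def pathfinish_def)
qed

section \<open>Lifts of paths and homotopies to normal words\<close>

definition step where
  "step q \<omega> \<omega>' \<longleftrightarrow> (\<exists>i\<in>I. avoids i (path_image q) \<and> \<omega>' = P.act i (wt i q) \<omega>)"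

text \<open>A lift assigns to each point of \<open>Q\<close> a state of the fibre over \<open>H\<close>: neighbouring states differ by the
  holonomy of the segment joining the points, in the single branch that the segment can meet.\<close>
definition lift :: "('u::real_normed_vector \<Rightarrow> 'v) \<Rightarrow> 'u set \<Rightarrow> ('u \<Rightarrow> ('i \<times> (real \<Rightarrow> 'v) set) list) \<Rightarrow> bool" where
  "lift H Q s \<longleftrightarrow> (\<forall>u\<in>Q. P.normal_word (s u)) \<and>
     (\<exists>\<epsilon>>0. \<forall>u\<in>Q. \<forall>v\<in>Q. dist u v < \<epsilon> \<longrightarrow> step (H \<circ> linepath u v) (s u) (s v))"

text \<open>If two different indices are admissible, the path enters neither of the two branches and
  both weights are trivial. Hence \<open>step\<close> determines the new state.\<close>

lemma act_wt_eq:
  assumes q: "path_in q" and i: "i \<in> I" "avoids i (path_image q)"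
    and j: "j \<in> I" "avoids j (path_image q)" and w: "P.normal_word \<omega>"
  shows "P.act i (wt i q) \<omega> = P.act j (wt j q) \<omega>"
proof (cases "i = j")
  case False
  then have "wt i q = \<one>\<^bsub>P\<^esub>" "wt j q = \<one>\<^bsub>P\<^esub>"
    using i j by (auto intro!: wt_outside[OF q] simp: avoids_def)
  then show ?thesis using w by (simp add: P.act_one)
qed simp

lemma step_act:
  assumes "path_in q" "i \<in> I" "avoids i (path_image q)" "P.normal_word \<omega>" "step q \<omega> \<omega>'"
  shows "\<omega>' = P.act i (wt i q) \<omega>"
  using assms act_wt_eq unfolding step_def by metis

lemma path_in_line:
  assumes "continuous_on Q H" "H ` Q \<subseteq> S" "convex Q" "u \<in> Q" "v \<in> Q"
  shows "path_in (H \<circ> linepath u v)"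
proof -
  have l: "path_image (linepath u v) \<subseteq> Q" using assms closed_segment_subset by simp
  have "path (H \<circ> linepath u v)"
    by (intro path_continuous_image continuous_on_subset[OF assms(1) l]) simp
  then show ?thesis using l assms(2) by (auto simp: path_in_def path_image_compose)
qed

text \<open>In a convex set two sides of a triangle are homotopic to the third; the factors come in
  reverse order because \<open>wt\<close> inverts.\<close>

lemma wt_triangle:
  assumes H: "continuous_on Q H" "H ` Q \<subseteq> S" "convex Q" and uvw: "u \<in> Q" "v \<in> Q" "w \<in> Q" and i: "i \<in> I"
  shows "wt i (H \<circ> linepath u w) = wt i (H \<circ> linepath v w) \<otimes>\<^bsub>P\<^esub> wt i (H \<circ> linepath u v)"
proof -
  have sub: "path_image (linepath x y) \<subseteq> Q" if "x \<in> Q" "y \<in> Q" for x y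
    using that H(3) closed_segment_subset by simp
  have "homotopic_paths Q (linepath u w) (linepath u v +++ linepath v w)"
    using convex_imp_simply_connected[OF H(3)] sub uvw
    unfolding simply_connected_eq_homotopic_paths by (simp add: path_image_join subset_path_image_join)
  then have "homotopic_paths S (H \<circ> linepath u w) (H \<circ> (linepath u v +++ linepath v w))"
    using H by (intro homotopic_paths_continuous_image) auto
  moreover have "H \<circ> (linepath u v +++ linepath v w) = (H \<circ> linepath u v) +++ (H \<circ> linepath v w)"
    by (auto simp: joinpaths_def)
  ultimately have "wt i (H \<circ> linepath u w) = wt i ((H \<circ> linepath u v) +++ (H \<circ> linepath v w))"
    using wt_homotopic i by metis
  also have "\<dots> = wt i (H \<circ> linepath v w) \<otimes>\<^bsub>P\<^esub> wt i (H \<circ> linepath u v)"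
    using path_in_line[OF H] uvw i by (intro wt_join) (auto simp: pathstart_compose pathfinish_compose)
  finally show ?thesis .
qed

text \<open>A Lebesgue number for the sets that miss the preimages of all branches but one. They
  cover \<open>Q\<close> because the branches are disjoint, and are open because the branches are
  closed and finite in number.\<close>

lemma local_index:
  fixes H :: "'u::real_normed_vector \<Rightarrow> 'v"
  assumes Q: "compact Q" and H: "continuous_on Q H" "H ` Q \<subseteq> S"
  obtains \<epsilon> where "\<epsilon> > 0" "\<And>c. c \<in> Q \<Longrightarrow> \<exists>i\<in>I. avoids i (H ` (ball c \<epsilon> \<inter> Q))"
proof -
  let ?K = "\<lambda>j. {u \<in> Q. H u \<in> branch (z j) (a j)}"
  let ?O = "\<lambda>i. - (\<Union>j\<in>I - {i}. ?K j)"
  have K: "closed (?K j)" if "j \<in> I" for j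
  proof -
    have "closedin (top_of_set Q) (Q \<inter> H -` branch (z j) (a j))"
      using closedin_branch[OF zS[OF that]] H
      by (intro continuous_closedin_preimage_gen[of _ _ S]) auto
    moreover have "Q \<inter> H -` branch (z j) (a j) = ?K j" by auto
    ultimately show ?thesis using Q by (metis closedin_compact compact_imp_closed)
  qed
  have O: "open (?O i)" for i using K finite_I by (intro open_Compl closed_UN) auto
  have cov: "Q \<subseteq> \<Union>(?O ` I)"
  proof
    fix u assume "u \<in> Q"
    show "u \<in> \<Union>(?O ` I)"
    proof (cases "\<exists>i\<in>I. u \<in> ?K i")
      case True
      then obtain i where i: "i \<in> I" "u \<in> ?K i" by blast
      then have "u \<in> ?O i" using disj[OF i(1)] by fastforce
      then show ?thesis using i by blast
    next
      case False
      then show ?thesis using I_ne by blast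
    qed
  qed
  obtain \<epsilon> where e: "0 < \<epsilon>" "\<And>c. c \<in> Q \<Longrightarrow> \<exists>G\<in>?O ` I. ball c \<epsilon> \<subseteq> G"
    using Heine_Borel_lemma[OF Q cov] O by blast
  show ?thesis
  proof
    show "\<epsilon> > 0" by fact
    fix c assume "c \<in> Q"
    then obtain i where i: "i \<in> I" "ball c \<epsilon> \<subseteq> ?O i" using e(2) by blast
    have "avoids i (H ` (ball c \<epsilon> \<inter> Q))"
      unfolding avoids_def using i by (fastforce simp: branch_def)
    then show "\<exists>i\<in>I. avoids i (H ` (ball c \<epsilon> \<inter> Q))" using i by blast
  qed
qed

lemma avoids_mono: "avoids i T \<Longrightarrow> T' \<subseteq> T \<Longrightarrow> avoids i T'"
  unfolding avoids_def by blast

text \<open>The state at \<open>u\<close> is obtained by transport along the segment from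
  \<open>b\<close> to \<open>u\<close> in \<open>n\<close> short steps. The segments to two
  neighbouring points form a ladder of small cells, in each of which transport does not depend on
  the route.\<close>

lemma lift_exists:
  fixes H :: "'u::real_normed_vector \<Rightarrow> 'v"
  assumes Q: "compact Q" "convex Q" and H: "continuous_on Q H" "H ` Q \<subseteq> S"
    and b: "b \<in> Q" and w0: "P.normal_word \<omega>0"
  obtains s where "lift H Q s" "s b = \<omega>0"
proof -
  obtain \<epsilon> where e: "\<epsilon> > 0" "\<And>c. c \<in> Q \<Longrightarrow> \<exists>i\<in>I. avoids i (H ` (ball c \<epsilon> \<inter> Q))"
    using local_index[OF Q(1) H] by metis
  obtain R where R: "\<And>u. u \<in> Q \<Longrightarrow> dist b u \<le> R" "R > 0"
  proof -
    obtain R where "\<And>u. u \<in> Q \<Longrightarrow> dist b u \<le> R"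
      using compact_imp_bounded[OF Q(1)] unfolding bounded_any_center[where a = b] by blast
    then show ?thesis using that[of "max R 1"] by fastforce
  qed
  obtain n :: nat where n: "R / (\<epsilon> / 2) < n" using reals_Archimedean2 by blast
  have n0: "n > 0" using n R(2) e(1) by (cases n) (auto simp: divide_less_0_iff)
  then have Rn: "R / n < \<epsilon> / 2" using n e(1) by (simp add: field_simps)
  \<comment> \<open>Any admissible index gives the same result by \<open>act_wt_eq\<close>; for a
    segment without admissible index the value is arbitrary.\<close>
  define T where "T u v \<omega> =
    (let i = SOME i. i \<in> I \<and> avoids i (path_image (H \<circ> linepath u v)) in P.act i (wt i (H \<circ> linepath u v)) \<omega>)"
    for u v \<omega>
  note line = path_in_line[OF H Q(2)]
  have T: "T u v \<omega> = P.act i (wt i (H \<circ> linepath u v)) \<omega>"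
    if "u \<in> Q" "v \<in> Q" "i \<in> I" "avoids i (path_image (H \<circ> linepath u v))" "P.normal_word \<omega>" for u v i \<omega>
    using someI[of "\<lambda>i. i \<in> I \<and> avoids i (path_image (H \<circ> linepath u v))", OF conjI[OF that(3,4)]]
      act_wt_eq[OF line[OF that(1,2)] _ _ that(3-5)]
    unfolding T_def Let_def by blast
  have img: "path_image (H \<circ> linepath u v) \<subseteq> H ` (ball c \<epsilon> \<inter> Q)"
    if "u \<in> Q" "v \<in> Q" "u \<in> ball c \<epsilon>" "v \<in> ball c \<epsilon>" for u v c
    using that closed_segment_subset[of u "ball c \<epsilon> \<inter> Q" v] Q(2)
    by (auto simp: path_image_compose convex_Int)
  \<comment> \<open>One index serves the whole ball around \<open>c\<close>, so transport inside it
    is governed by \<open>wt_triangle\<close>.\<close>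
  have TT: "T v w (T u v \<omega>) = T u w \<omega> \<and> P.normal_word (T u v \<omega>)"
    if "c \<in> Q" "u \<in> Q" "v \<in> Q" "w \<in> Q" "u \<in> ball c \<epsilon>" "v \<in> ball c \<epsilon>" "w \<in> ball c \<epsilon>" "P.normal_word \<omega>"
    for c u v w \<omega>
  proof -
    note ci = e(2)[OF that(1)]
    obtain i where i: "i \<in> I" "avoids i (H ` (ball c \<epsilon> \<inter> Q))" using ci by blast
    have Ti: "T x y \<omega>' = P.act i (wt i (H \<circ> linepath x y)) \<omega>'"
      if "x \<in> Q" "y \<in> Q" "x \<in> ball c \<epsilon>" "y \<in> ball c \<epsilon>" "P.normal_word \<omega>'" for x y \<omega>'
      using T[OF that(1,2) i(1) avoids_mono[OF i(2) img[OF that(1-4)]] that(5)] .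
    have nw: "P.normal_word (T u v \<omega>)"
      using that i by (subst Ti) (auto intro!: P.act_closed wt_closed line)
    then show ?thesis
      using that i Ti[of v w "T u v \<omega>"] Ti[of u v \<omega>] Ti[of u w \<omega>]
        wt_triangle[OF H Q(2) that(2-4) i(1)] wt_closed[OF line i(1)]
      by (simp add: P.act_act)
  qed
  define p where "p k u = linepath b u (real k / real n)" for k u
  have p0: "p 0 u = b" for u by (simp add: p_def linepath_def)
  have pn: "p n u = u" for u using n0 by (simp add: p_def linepath_def)
  have pQ: "p k u \<in> Q" if "k \<le> n" "u \<in> Q" for k u
  proof -
    have "p k u \<in> closed_segment b u"
      unfolding p_def using that n0 by (intro linepath_in_path) auto
    then show ?thesis using closed_segment_subset[OF b that(2) Q(2)] by blast
  qed
  have duv: "dist (p k u) (p k v) \<le> dist u v" if "k \<le> n" for k u v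
  proof -
    have "p k u - p k v = (real k / real n) *\<^sub>R (u - v)"
      by (simp add: p_def linepath_def algebra_simps)
    then have "dist (p k u) (p k v) = (real k / real n) * dist u v"
      by (simp add: dist_norm)
    also have "\<dots> \<le> 1 * dist u v"
      using that n0 by (intro mult_right_mono) auto
    finally show ?thesis by simp
  qed
  have dk: "dist (p k u) (p (Suc k) u) < \<epsilon> / 2" if "u \<in> Q" for k u
  proof -
    have "p (Suc k) u - p k u = (1 / real n) *\<^sub>R (u - b)"
      by (simp add: p_def linepath_def algebra_simps add_divide_distrib diff_divide_distrib)
    then have "dist (p k u) (p (Suc k) u) = dist b u / n"
      by (metis dist_commute dist_norm norm_scaleR abs_of_nonneg divide_inverse mult.commute
          mult_1 of_nat_0_le_iff zero_le_divide_1_iff)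
    also have "\<dots> \<le> R / n" using R(1)[OF that] by (simp add: divide_right_mono)
    finally show ?thesis using Rn by linarith
  qed
  define st where "st k u = rec_nat \<omega>0 (\<lambda>k \<omega>. T (p k u) (p (Suc k) u) \<omega>) k" for k u
  have st0: "st 0 u = \<omega>0" and stS: "st (Suc k) u = T (p k u) (p (Suc k) u) (st k u)" for k u
    by (simp_all add: st_def)
  have stn: "P.normal_word (st k u)" if "k \<le> n" "u \<in> Q" for k u
    using that
  proof (induction k)
    case (Suc k)
    have "P.normal_word (T (p k u) (p (Suc k) u) (st k u))"
      using Suc TT[of "p k u" "p k u" "p (Suc k) u" "p (Suc k) u" "st k u"] pQ[of k u] pQ[of "Suc k" u] dk[OF Suc.prems(2), of k] e(1)
      by simp
    then show ?case by (simp add: stS)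
  qed (simp add: st0 w0)
  have Tid: "T u u \<omega> = \<omega>" if "u \<in> Q" "P.normal_word \<omega>" for u \<omega>
  proof -
    note ui = e(2)[OF that(1)]
    obtain i where i: "i \<in> I" "avoids i (H ` (ball u \<epsilon> \<inter> Q))" using ui by blast
    \<comment> \<open>An idempotent of a group is the identity.\<close>
    have "wt i (H \<circ> linepath u u) = wt i (H \<circ> linepath u u) \<otimes>\<^bsub>P\<^esub> wt i (H \<circ> linepath u u)"
      using wt_triangle[OF H Q(2) that(1) that(1) that(1) i(1)] .
    then have "wt i (H \<circ> linepath u u) = \<one>\<^bsub>P\<^esub>"
      using wt_closed[OF line[OF that(1) that(1)] i(1)] P.l_cancel_one' by metis
    then show ?thesis
      using T[OF that(1) that(1) i(1) avoids_mono[OF i(2) img[OF that(1) that(1)]] that(2)] e(1) that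
      by (simp add: P.act_one)
  qed
  \<comment> \<open>Both routes from \<open>p k u\<close> to \<open>p (Suc k) v\<close> stay in the
    ball of radius \<open>\<epsilon>\<close> around \<open>p k u\<close>: a rung and a step along
    the ray each contribute less than \<open>\<epsilon> / 2\<close>.\<close>
  have ladder: "st k v = T (p k u) (p k v) (st k u)"
    if "k \<le> n" "u \<in> Q" "v \<in> Q" "dist u v < \<epsilon> / 2" for k u v
    using that
  proof (induction k)
    case 0
    then show ?case by (simp add: st0 p0 Tid b w0)
  next
    case (Suc k)
    let ?c = "p k u"
    have k: "k \<le> n" using Suc.prems by simp
    have c: "?c \<in> Q" "p (Suc k) u \<in> Q" "p k v \<in> Q" "p (Suc k) v \<in> Q"
      using pQ Suc.prems k by auto
    have d: "dist ?c (p k v) < \<epsilon> / 2" "dist ?c (p (Suc k) u) < \<epsilon> / 2"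
      "dist ?c (p (Suc k) v) < \<epsilon>"
    proof -
      show 1: "dist ?c (p k v) < \<epsilon> / 2" using duv[OF k, of u v] Suc.prems by simp
      show "dist ?c (p (Suc k) u) < \<epsilon> / 2" by (rule dk) fact
      show "dist ?c (p (Suc k) v) < \<epsilon>"
        using 1 dk[OF \<open>v \<in> Q\<close>, of k] dist_triangle[of ?c "p (Suc k) v" "p k v"] by simp
    qed
    have bl: "?c \<in> ball ?c \<epsilon>" "p (Suc k) u \<in> ball ?c \<epsilon>" "p k v \<in> ball ?c \<epsilon>" "p (Suc k) v \<in> ball ?c \<epsilon>"
      using d e(1) by auto
    note n = stn[OF k \<open>u \<in> Q\<close>]
    have "st (Suc k) v = T (p k v) (p (Suc k) v) (T ?c (p k v) (st k u))"
      using Suc.IH Suc.prems by (simp add: stS)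
    also have "\<dots> = T ?c (p (Suc k) v) (st k u)" using TT c bl n by blast
    also have "\<dots> = T (p (Suc k) u) (p (Suc k) v) (T ?c (p (Suc k) u) (st k u))"
      using TT c bl n by metis
    finally show ?case by (simp add: stS)
  qed
  have "lift H Q (st n)"
    unfolding lift_def
  proof (intro conjI ballI exI[of _ "\<epsilon> / 2"] impI)
    show "P.normal_word (st n u)" if "u \<in> Q" for u using stn that by simp
    show "\<epsilon> / 2 > 0" using e by simp
    fix u v assume uv: "u \<in> Q" "v \<in> Q" "dist u v < \<epsilon> / 2"
    obtain i where i: "i \<in> I" "avoids i (H ` (ball u \<epsilon> \<inter> Q))" using e(2)[OF uv(1)] by blast
    have av: "avoids i (path_image (H \<circ> linepath u v))"
      using uv e(1) by (intro avoids_mono[OF i(2) img]) auto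
    have "st n v = P.act i (wt i (H \<circ> linepath u v)) (st n u)"
      using ladder[OF order_refl uv] T[OF uv(1,2) i(1) av stn[OF order_refl uv(1)]] by (simp add: pn)
    then show "step (H \<circ> linepath u v) (st n u) (st n v)"
      unfolding step_def using i av by blast
  qed
  moreover have "st n b = \<omega>0"
  proof -
    have "p k b = b" for k by (simp add: p_def linepath_def flip: scaleR_add_left)
    then have "st k b = \<omega>0" for k by (induction k) (simp_all add: st0 stS Tid b w0)
    then show ?thesis .
  qed
  ultimately show ?thesis using that by blast
qed


text \<open>Affine maps send segments to segments, and not increasing distances preserves the mesh
  condition. The instances are the edges of the square and the two halves of the unit
  interval.\<close>

lemma lift_compose:
  assumes s: "lift H Q s" and e: "e ` R \<subseteq> Q"
    "\<And>u v. u \<in> R \<Longrightarrow> v \<in> R \<Longrightarrow> e \<circ> linepath u v = linepath (e u) (e v)"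
    "\<And>u v. u \<in> R \<Longrightarrow> v \<in> R \<Longrightarrow> dist (e u) (e v) \<le> dist u v"
  shows "lift (H \<circ> e) R (s \<circ> e)"
proof -
  obtain \<epsilon> where "\<epsilon> > 0" and \<epsilon>: "\<And>u v. u \<in> Q \<Longrightarrow> v \<in> Q \<Longrightarrow> dist u v < \<epsilon> \<Longrightarrow> step (H \<circ> linepath u v) (s u) (s v)"
    using s unfolding lift_def by blast
  have "step (H \<circ> e \<circ> linepath u v) ((s \<circ> e) u) ((s \<circ> e) v)" if "u \<in> R" "v \<in> R" "dist u v < \<epsilon>" for u v
    using \<epsilon>[of "e u" "e v"] that e(1) e(3)[of u v] e(2)[of u v] by (auto simp: comp_assoc)
  then show ?thesis
    using s e(1) \<open>\<epsilon> > 0\<close> unfolding lift_def by (auto simp: image_subset_iff)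
qed

lemma lift_cong:
  assumes s: "lift H Q s" and H: "continuous_on Q H" "H ` Q \<subseteq> S" "convex Q"
    and eq: "\<And>u. u \<in> Q \<Longrightarrow> H u = H' u"
  shows "lift H' Q s"
proof -
  have "step (H' \<circ> linepath u v) \<omega> \<omega>'" if "step (H \<circ> linepath u v) \<omega> \<omega>'" "u \<in> Q" "v \<in> Q" for u v \<omega> \<omega>'
  proof -
    have l: "linepath u v t \<in> Q" if "t \<in> {0..1}" for t
      using closed_segment_subset[OF \<open>u \<in> Q\<close> \<open>v \<in> Q\<close> H(3)] linepath_in_path[OF that, of u v] by blast
    have pe: "path_image (H' \<circ> linepath u v) = path_image (H \<circ> linepath u v)"
      unfolding path_image_def using l eq by (intro image_cong) auto
    have "homotopic_paths S (H \<circ> linepath u v) (H' \<circ> linepath u v)"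
      using path_inD[OF path_in_line[OF H \<open>u \<in> Q\<close> \<open>v \<in> Q\<close>]] l eq by (intro homotopic_paths_eq) auto
    then show ?thesis using that(1) wt_homotopic unfolding step_def pe by metis
  qed
  then show ?thesis using s unfolding lift_def by blast
qed

text \<open>All steps of a subdivision can use the same index, so their weights multiply up to the
  weight of the whole path.\<close>

lemma lift_single:
  assumes q: "path_in q" and i: "i \<in> I" "avoids i (path_image q)" and s: "lift q {0..1} s"
  shows "s 1 = P.act i (wt i q) (s 0)"
proof -
  obtain \<epsilon> where "\<epsilon> > 0" and \<epsilon>: "\<And>u v. u \<in> {0..1} \<Longrightarrow> v \<in> {0..1} \<Longrightarrow> dist u v < \<epsilon> \<Longrightarrow>
      step (q \<circ> linepath u v) (s u) (s v)"
    using s unfolding lift_def by blast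
  obtain n :: nat where n: "1 / \<epsilon> < n" using reals_Archimedean2 by blast
  have n0: "n > 0" using n \<open>\<epsilon> > 0\<close> by (cases n) (auto simp: divide_less_0_iff)
  then have n1: "1 / n < \<epsilon>" using n \<open>\<epsilon> > 0\<close> by (simp add: field_simps)
  have cq: "continuous_on {0..1} q" "q ` {0..1} \<subseteq> S"
    using path_inD[OF q] by (auto simp: path_def path_image_def)
  have cv: "convex {0..1::real}" by simp
  have k01: "real k / n \<in> {0..1}" if "k \<le> n" for k using that n0 by auto
  have main: "s (k / n) = P.act i (wt i (q \<circ> linepath 0 (k / n))) (s 0)" if "k \<le> n" for k
    using that
  proof (induction k)
    case 0
    have "wt i (q \<circ> linepath 0 0) = wt i (q \<circ> linepath 0 0) \<otimes>\<^bsub>P\<^esub> wt i (q \<circ> linepath 0 0)"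
      using wt_triangle[OF cq cv, of 0 0 0] i by simp
    then have w: "wt i (q \<circ> linepath 0 0) = \<one>\<^bsub>P\<^esub>"
      using wt_closed[OF path_in_line[OF cq cv, of 0 0] i(1)] P.l_cancel_one'
      by (metis atLeastAtMost_iff order_refl zero_le_one)
    have "P.normal_word (s 0)" using s unfolding lift_def by auto
    then show ?case by (simp only: of_nat_0 div_0 w P.act_one)
  next
    case (Suc k)
    let ?u = "real k / n" and ?v = "real (Suc k) / n"
    have uv: "?u \<in> {0..1}" "?v \<in> {0..1}" using k01[of k] k01[of "Suc k"] Suc.prems by auto
    have "dist ?u ?v < \<epsilon>" using n1 by (simp add: dist_real_def flip: diff_divide_distrib)
    then have st: "step (q \<circ> linepath ?u ?v) (s ?u) (s ?v)" using \<epsilon> uv by blast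
    have pl: "path_in (q \<circ> linepath x y)" if "x \<in> {0..1}" "y \<in> {0..1}" for x y
      by (rule path_in_line[OF cq cv that])
    have av: "avoids i (path_image (q \<circ> linepath ?u ?v))"
      using closed_segment_subset[OF uv] cv
      by (intro avoids_mono[OF i(2)]) (auto simp: path_image_compose path_image_def[of q])
    have nu: "P.normal_word (s ?u)" "P.normal_word (s 0)" using s uv unfolding lift_def by auto
    have "s ?v = P.act i (wt i (q \<circ> linepath ?u ?v)) (s ?u)"
      by (rule step_act[OF pl[OF uv] i(1) av nu(1) st])
    also have "\<dots> = P.act i (wt i (q \<circ> linepath ?u ?v)) (P.act i (wt i (q \<circ> linepath 0 ?u)) (s 0))"
      by (simp only: Suc.IH[OF Suc_leD[OF Suc.prems]])
    also have "\<dots> = P.act i (wt i (q \<circ> linepath 0 ?v)) (s 0)"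
      using wt_triangle[OF cq cv, of 0 ?u ?v] uv i nu pl
      by (subst P.act_act) (auto intro!: wt_closed)
    finally show ?case .
  qed
  have "linepath 0 (1::real) = id" by (auto simp: linepath_def)
  then show ?thesis using main[of n] n0 by simp
qed

lemma lift_const:
  fixes q :: "real \<Rightarrow> 'v"
  assumes "\<And>t. t \<in> {0..1} \<Longrightarrow> q t = x0" and s: "lift q {0..1} s"
  shows "s 1 = s 0"
proof -
  obtain i where i: "i \<in> I" using I_ne by blast
  have im: "path_image q \<subseteq> {x0}" using assms(1) by (auto simp: path_image_def)
  have "homotopic_paths S (linepath x0 x0) q"
  proof (rule homotopic_paths_eq[OF path_linepath])
    show "path_image (linepath x0 x0) \<subseteq> S"
      using x0 by (simp only: path_image_linepath) simp
  qed (use assms(1) in \<open>simp add: linepath_refl\<close>)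
  then have q: "path_in q"
    using homotopic_paths_imp_path homotopic_paths_imp_subset unfolding path_in_def by blast
  have out: "path_image q \<inter> inner j = {}" if "j \<in> I" for j
    using im x0_out[OF that] by (auto simp: branch_def)
  then have "s 1 = P.act i (wt i q) (s 0)"
    by (intro lift_single[OF q i _ s]) (auto simp: avoids_def)
  moreover have "wt i q = \<one>\<^bsub>P\<^esub>" using wt_outside[OF q i out[OF i]] .
  ultimately show ?thesis using s by (simp add: P.act_one lift_def)
qed

section \<open>Non-contractibility of alternating products\<close>

definition letter :: "'i \<times> (real \<Rightarrow> 'v) \<Rightarrow> bool" where
  "letter l \<longleftrightarrow> fst l \<in> I \<and> pm.based (snd l) \<and> avoids (fst l) (path_image (snd l)) \<and> wt (fst l) (snd l) \<noteq> \<one>\<^bsub>P\<^esub>"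

lemma based_concat_path: "\<forall>l\<in>set ps. pm.based (snd l) \<Longrightarrow> pm.based (concat_path x0 ps)"
  by (induction ps) (use pm.based_const in \<open>auto simp: concat_path_def intro!: pm.based_join\<close>)

lemma lift_join:
  assumes q: "pm.based q" "pm.based r" and s: "lift (q +++ r) {0..1} s"
  shows "lift q {0..1} (\<lambda>t. s (t / 2))" "lift r {0..1} (\<lambda>t. s ((t + 1) / 2))"
proof -
  let ?e = "\<lambda>c t :: real. (t + c) / 2"
  have half: "lift ((q +++ r) \<circ> ?e c) {0..1} (s \<circ> ?e c)" if "c \<in> {0..1}" for c
  proof (rule lift_compose[OF s])
    show "?e c ` {0..1} \<subseteq> {0..1}" using that by auto
    fix u v :: real
    show "?e c \<circ> linepath u v = linepath (?e c u) (?e c v)"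
      by (simp add: linepath_def fun_eq_iff field_simps)
    show "dist (?e c u) (?e c v) \<le> dist u v"
      by (simp add: dist_real_def flip: diff_divide_distrib)
  qed
  have b: "path (q +++ r)" "path_image (q +++ r) \<subseteq> S"
    using pm.based_join[OF q] by (auto simp: pm.based_def)
  have c: "continuous_on {0..1} ((q +++ r) \<circ> ?e c)" "((q +++ r) \<circ> ?e c) ` {0..1} \<subseteq> S"
    if "c \<in> {0..1}" for c
  proof -
    have e: "?e c ` {0..1} \<subseteq> {0..1}" using that by auto
    show "continuous_on {0..1} ((q +++ r) \<circ> ?e c)"
      by (intro continuous_on_compose continuous_on_subset[OF b(1)[unfolded path_def] e]
          continuous_intros) simp
    show "((q +++ r) \<circ> ?e c) ` {0..1} \<subseteq> S"
      using b(2) e unfolding path_image_def image_comp[symmetric] by blast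
  qed
  have "lift q {0..1} (s \<circ> ?e 0)"
    by (rule lift_cong[OF half c]) (auto simp: joinpaths_def)
  then show "lift q {0..1} (\<lambda>t. s (t / 2))" by (simp add: o_def)
  have "((q +++ r) \<circ> ?e 1) t = r t" if "t \<in> {0..1}" for t
  proof (cases "t = 0")
    \<comment> \<open>At \<open>t = 0\<close> the join still evaluates \<open>q\<close>, at its end,
      which is the start of \<open>r\<close> as both are based.\<close>
    case True
    then show ?thesis using q by (simp add: joinpaths_def pm.based_def pathstart_def pathfinish_def)
  next
    case False
    then show ?thesis using that by (simp add: joinpaths_def add_divide_distrib)
  qed
  then have "lift r {0..1} (s \<circ> ?e 1)"
    by (intro lift_cong[OF half c]) auto
  then show "lift r {0..1} (\<lambda>t. s ((t + 1) / 2))" by (simp add: o_def)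
qed

text \<open>Neighbouring letters belong to different branches, so the state never begins with the
  index of the next letter. Each letter has nontrivial weight and therefore prepends a syllable;
  none is absorbed.\<close>

lemma lift_word:
  assumes "\<forall>l\<in>set ps. letter l" "distinct_adj (map fst ps)" "lift (concat_path x0 ps) {0..1} s"
    "ps \<noteq> [] \<Longrightarrow> \<not> leads (fst (hd ps)) (s 0)"
  shows "length (s 1) = length (s 0) + length ps"
  using assms
proof (induction ps arbitrary: s)
  case Nil
  then have "s 1 = s 0"
    by (intro lift_const[of "concat_path x0 []"]) (auto simp: concat_path_def linepath_def simp flip: scaleR_add_left)
  then show ?case by simp
next
  case (Cons l ps)
  have l: "letter l" using Cons.prems by simp
  have cp: "concat_path x0 (l # ps) = snd l +++ concat_path x0 ps" by (simp add: concat_path_def)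
  have b: "pm.based (snd l)" "pm.based (concat_path x0 ps)"
    using Cons.prems(1) by (auto simp: letter_def intro!: based_concat_path)
  note lj = lift_join[OF b Cons.prems(3)[unfolded cp]]
  have "s (1 / 2) = P.act (fst l) (wt (fst l) (snd l)) (s 0)"
    using lift_single[OF based_path_in[OF b(1)] _ _ lj(1), of "fst l"] l by (simp add: letter_def)
  also have "\<dots> = (fst l, wt (fst l) (snd l)) # s 0"
    using Cons.prems(4) l by (simp add: P.act_def P.prepend_def letter_def)
  finally have mid: "s (1 / 2) = (fst l, wt (fst l) (snd l)) # s 0" .
  have "length (s ((1 + 1) / 2)) = length (s ((0 + 1) / 2)) + length ps"
    using Cons.prems mid
    by (intro Cons.IH[OF _ _ lj(2)]) (auto simp: leads_def distinct_adj_Cons hd_map)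
  then show ?case using mid by simp
qed

text \<open>A null-homotopy would lift to the square. Along the three sides where it is constant the
  state does not change, yet along the fourth the normal word grows by one syllable for each
  letter.\<close>

theorem alternating_word_nontrivial:
  assumes ps: "\<forall>l\<in>set ps. letter l" "distinct_adj (map fst ps)" "ps \<noteq> []"
  shows "\<not> homotopic_paths S (concat_path x0 ps) (linepath x0 x0)"
proof
  let ?Q = "{0..1} \<times> {0..1} :: (real \<times> real) set"
  have b: "pm.based (concat_path x0 ps)" using ps(1) by (intro based_concat_path) (auto simp: letter_def)
  assume "homotopic_paths S (concat_path x0 ps) (linepath x0 x0)"
  then obtain h where h: "continuous_on ?Q h" "h \<in> ?Q \<rightarrow> S"
    "\<And>t. t \<in> {0..1} \<Longrightarrow> h (0, t) = concat_path x0 ps t" "\<And>t. t \<in> {0..1} \<Longrightarrow> h (1, t) = linepath x0 x0 t"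
    "\<And>t. t \<in> {0..1} \<Longrightarrow> pathstart (h \<circ> Pair t) = pathstart (concat_path x0 ps) \<and>
      pathfinish (h \<circ> Pair t) = pathfinish (concat_path x0 ps)"
    unfolding homotopic_paths by blast
  have hS: "h ` ?Q \<subseteq> S" using h(2) by blast
  have Q: "compact ?Q" "convex ?Q" by (auto intro: compact_Times convex_Times)
  have sides: "h (t, 0) = x0" "h (t, 1) = x0" "h (1, t) = x0" if "t \<in> {0..1}" for t
    using h(4,5)[OF that] b
    by (auto simp: pm.based_def pathstart_def pathfinish_def linepath_def simp flip: scaleR_add_left)
  obtain s where s: "lift h ?Q s" "s (0, 0) = []"
    by (rule lift_exists[OF Q h(1) hS, of "(0, 0)" "[]"]) auto
  have edge: "lift (h \<circ> e) {0..1} (s \<circ> e)"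
    if "e = (\<lambda>t. (0, t)) \<or> e = (\<lambda>t. (1, t)) \<or> e = (\<lambda>t. (t, 0)) \<or> e = (\<lambda>t. (t, 1))" for e :: "real \<Rightarrow> real \<times> real"
    using that by (intro lift_compose[OF s(1)])
      (auto simp: linepath_def fun_eq_iff dist_Pair_Pair algebra_simps)
  have "lift (concat_path x0 ps) {0..1} (s \<circ> (\<lambda>t. (0, t)))"
  proof (rule lift_cong[OF edge[of "\<lambda>t. (0, t)"]])
    show "continuous_on {0..1} (h \<circ> (\<lambda>t. (0, t)))"
      by (intro continuous_on_compose continuous_intros continuous_on_subset[OF h(1)]) auto
    show "(h \<circ> (\<lambda>t. (0, t))) ` {0..1} \<subseteq> S" using hS by auto
  qed (use h(3) in auto)
  then have "length (s (0, 1)) = length (s (0, 0)) + length ps"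
    using lift_word[OF ps(1,2), of "s \<circ> (\<lambda>t. (0, t))"] s(2) by (simp add: leads_def)
  moreover have "s (1, 1) = s (0, 1)" "s (1, 1) = s (1, 0)" "s (1, 0) = s (0, 0)"
    using lift_const[OF _ edge[of "\<lambda>t. (t, 1)"]] lift_const[OF _ edge[of "\<lambda>t. (1, t)"]]
      lift_const[OF _ edge[of "\<lambda>t. (t, 0)"]] sides by simp_all
  ultimately show False using s(2) ps(3) by simp
qed

end

lemma reduced_word_Cons_Cons:
  assumes "reduced_word (l # l' # w)"
  shows "snd l = snd l' \<Longrightarrow> fst l = fst l'" "reduced_word (l' # w)"
proof -
  have r: "\<not> (snd ((l # l' # w) ! i) = snd ((l # l' # w) ! Suc i) \<and> fst ((l # l' # w) ! i) \<noteq> fst ((l # l' # w) ! Suc i))"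
    if "Suc i < length (l # l' # w)" for i
    using assms that unfolding reduced_word_def by blast
  show "snd l = snd l' \<Longrightarrow> fst l = fst l'" using r[of 0] by auto
  show "reduced_word (l' # w)" unfolding reduced_word_def using r[of "Suc i" for i] by simp
qed

section \<open>Free generators from loops in distinct branches\<close>

context cut_point_set
begin

text \<open>The loop runs along a geodesic to a nontrivial loop inside the branch and back. A
  geodesic that visited a branch containing neither of its ends would pass the attaching point
  twice. The retraction fixes the inner loop and merely changes the conjugating path.\<close>

lemma ex_branch_loop:
  assumes g: "path g" "path_image g \<subseteq> S" "pathfinish g = pathstart g"
    and nt: "\<not> homotopic_paths S g (linepath (pathstart g) (pathstart g))"
    and z: "z \<in> S" "a \<in> S" "a \<noteq> z" and x0: "x0 \<in> S" "x0 \<notin> branch z a"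
  obtains \<alpha> where "path \<alpha>" "path_image \<alpha> \<subseteq> S" "pathstart \<alpha> = x0" "pathfinish \<alpha> = x0"
    "\<And>z' a'. z' \<in> S \<Longrightarrow> x0 \<notin> branch z' a' \<Longrightarrow> branch z' a' \<inter> branch z a = {} \<Longrightarrow>
      path_image \<alpha> \<inter> {y. linked z' a' y} = {}"
    "\<not> homotopic_paths S (collapse z a \<circ> \<alpha>) (linepath z z)"
proof -
  obtain h where h: "path h" "path_image h \<subseteq> {y. linked z a y}" "pathfinish h = pathstart h"
    "\<not> homotopic_paths S h (linepath (pathstart h) (pathstart h))"
    using nontrivial_loop_in_branch[OF g nt z] .
  let ?y = "pathstart h"
  have y: "linked z a ?y" using h(2) by auto
  have yS: "?y \<in> S" using linkedD[OF y] by simp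
  have hS: "path_image h \<subseteq> S" using h(2) by (auto dest: linkedD)
  obtain c where c: "geodesic_in S c x0 ?y" using geodesic_exists[OF x0(1) yS] by blast
  note cp = geodesic_in_path[OF c]
  let ?\<alpha> = "c +++ h +++ reversepath c"
  show ?thesis
  proof
    show "path ?\<alpha>" "path_image ?\<alpha> \<subseteq> S" "pathstart ?\<alpha> = x0" "pathfinish ?\<alpha> = x0"
      using cp h hS by (auto simp: path_image_join)
    have im: "path_image ?\<alpha> \<subseteq> path_image c \<union> path_image h"
      using cp h by (auto simp: path_image_join)
    fix z' a' assume z': "z' \<in> S" "x0 \<notin> branch z' a'" and dj: "branch z' a' \<inter> branch z a = {}"
    have "\<not> linked z' a' w" if "w \<in> path_image c" for w
    proof
      assume w: "linked z' a' w"
      have wS: "w \<in> S" "w \<noteq> z'" using linkedD[OF w] by auto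
      have "\<not> linked z' x0 w" "\<not> linked z' w ?y"
        using w z'(2) dj y unfolding branch_def
        by (blast intro: path_component_sym path_component_trans)+
      then have "dist x0 w = dist x0 z' + dist z' w" "dist w ?y = dist w z' + dist z' ?y"
        using wS x0 yS by (auto intro: separated_dist)
      moreover obtain t where "0 \<le> t" "t \<le> 1" "w = c t" using \<open>w \<in> path_image c\<close> by (auto simp: path_image_def)
      then have "dist x0 w + dist w ?y = dist x0 ?y"
        using geodesic_in_dist[OF c, of t] by (simp add: algebra_simps)
      moreover have "dist x0 ?y \<le> dist x0 z' + dist z' ?y" by (rule dist_triangle)
      ultimately have "dist z' w \<le> 0" using dist_commute[of w z'] by linarith
      then show False using wS by simp
    qed
    moreover have "\<not> linked z' a' w" if "w \<in> path_image h" for w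
      using dj h(2) that unfolding branch_def by blast
    ultimately show "path_image ?\<alpha> \<inter> {y. linked z' a' y} = {}" using im by blast
  next
    let ?f = "collapse z a"
    have cf: "continuous_on S ?f" by (rule continuous_on_collapse[OF z(1)])
    have fS: "?f ` S \<subseteq> S" using collapse_in[OF z(1)] by auto
    have fh: "homotopic_paths S h (?f \<circ> h)"
    proof (rule homotopic_paths_eq[OF h(1) hS])
      fix t :: real assume "t \<in> {0..1}"
      then have "h t \<in> path_image h" by (auto simp: path_image_def)
      then have "linked z a (h t)" using h(2) by blast
      then show "h t = (?f \<circ> h) t" by (simp add: collapse_def)
    qed
    have fh': "path (?f \<circ> h)" "path_image (?f \<circ> h) \<subseteq> S" "pathstart (?f \<circ> h) = ?y"
      "pathfinish (?f \<circ> h) = ?y"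
      using homotopic_paths_imp_path[OF fh] homotopic_paths_imp_subset[OF fh]
        homotopic_paths_imp_pathstart[OF fh] homotopic_paths_imp_pathfinish[OF fh] h(3) by simp_all
    have fc: "path (?f \<circ> c)" "path_image (?f \<circ> c) \<subseteq> S"
      using cp fS by (auto intro!: path_continuous_image continuous_on_subset[OF cf] simp: path_image_compose)
    have eq: "?f \<circ> ?\<alpha> = (?f \<circ> c) +++ (?f \<circ> h) +++ reversepath (?f \<circ> c)"
      by (auto simp: joinpaths_def reversepath_def)
    show "\<not> homotopic_paths S (?f \<circ> ?\<alpha>) (linepath z z)"
    proof
      assume "homotopic_paths S (?f \<circ> ?\<alpha>) (linepath z z)"
      then have "homotopic_paths S (?f \<circ> h) (linepath ?y ?y)"
        using homotopic_paths_conjugate_null[OF fc(1) fh'(1) fc(2) fh'(2), of z] fh' cp y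
        unfolding eq by (simp add: pathfinish_compose collapse_def)
      then show False using fh h(4) by (meson homotopic_paths_trans)
    qed
  qed
qed

end

text \<open>Each generator is a product of two loops living in different branches, since a single loop may have
  finite order.\<close>
definition letter_block :: "real \<Rightarrow> (real \<Rightarrow> real \<Rightarrow> 'v) \<Rightarrow> bool \<times> real \<Rightarrow> (real \<times> (real \<Rightarrow> 'v::real_normed_vector)) list" where
  "letter_block \<delta> \<alpha> l = (let k = snd l in
     if fst l then [(k, \<alpha> k), (k + \<delta>, \<alpha> (k + \<delta>))]
     else [(k + \<delta>, reversepath (\<alpha> (k + \<delta>))), (k, reversepath (\<alpha> k))])"

lemma letter_block_ne: "letter_block \<delta> \<alpha> l \<noteq> []"
  by (simp add: letter_block_def Let_def)

text \<open>All indices of letters lie in an open interval of length \<open>\<delta>\<close>, so no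
  index equals another one shifted by \<open>\<delta>\<close>. Equal indices could meet only where a
  letter is followed by its inverse, which reducedness rules out.\<close>

lemma distinct_adj_blocks:
  assumes "reduced_word w" "snd ` set w \<subseteq> {p<..<p + \<delta>}"
  shows "distinct_adj (map fst (concat (map (letter_block \<delta> \<alpha>) w)))"
  using assms
proof (induction w)
  case (Cons l w)
  have \<delta>: "\<delta> > 0" using Cons.prems(2) by auto
  have d: "distinct_adj (map fst (letter_block \<delta> \<alpha> l))"
    using \<delta> by (simp add: letter_block_def Let_def)
  show ?case
  proof (cases w)
    case Nil
    then show ?thesis using d by simp
  next
    case (Cons l' w')
    note r = reduced_word_Cons_Cons[OF Cons.prems(1)[unfolded Cons]]
    have b: "snd l \<in> {p<..<p + \<delta>}" "snd l' \<in> {p<..<p + \<delta>}" using Cons.prems(2) Cons by auto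
    have "fst (last (letter_block \<delta> \<alpha> l)) \<noteq> fst (hd (letter_block \<delta> \<alpha> l'))"
      using b r(1) by (auto simp: letter_block_def Let_def)
    moreover have "distinct_adj (map fst (concat (map (letter_block \<delta> \<alpha>) w)))"
      using Cons.IH r(2) Cons.prems(2) Cons by auto
    ultimately show ?thesis
      using d Cons letter_block_ne[of \<delta> \<alpha>]
      by (simp add: distinct_adj_append_iff last_map hd_map hd_append)
  qed
qed simp

lemma (in path_model) word_value_blocks:
  assumes \<alpha>: "\<And>k. k \<in> snd ` set w \<Longrightarrow> based (\<alpha> k) \<and> based (\<alpha> (k + \<delta>))"
  shows "word_value \<pi> (map (\<lambda>l. letter_value \<pi> (fst l, cl (\<alpha> (snd l) +++ \<alpha> (snd l + \<delta>)))) w)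
    = cl (concat_path (f x) (concat (map (letter_block \<delta> \<alpha>) w))) \<and>
    based (concat_path (f x) (concat (map (letter_block \<delta> \<alpha>) w)))"
  using assms
proof (induction w)
  case Nil
  show ?case
    by (simp only: word_value_def concat_path_def list.map concat.simps foldr.simps id_apply one_\<pi> based_const)
next
  case (Cons l w)
  let ?k = "snd l" and ?r = "concat_path (f x) (concat (map (letter_block \<delta> \<alpha>) w))"
  interpret group \<pi> by (rule group_\<pi>)
  have b: "based (\<alpha> ?k)" "based (\<alpha> (?k + \<delta>))" using Cons.prems[of ?k] by auto
  have r: "based ?r" using Cons by simp
  have assoc: "cl (p +++ q) \<otimes>\<^bsub>\<pi>\<^esub> cl ?r = cl (p +++ q +++ ?r)" if "based p" "based q" for p q
    using that r m_assoc[of "cl p" "cl q" "cl ?r"] by (simp add: mult_\<pi> based_join cl_in_carrier)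
  have "letter_value \<pi> (fst l, cl (\<alpha> ?k +++ \<alpha> (?k + \<delta>))) \<otimes>\<^bsub>\<pi>\<^esub> cl ?r
      = cl (concat_path (f x) (letter_block \<delta> \<alpha> l @ concat (map (letter_block \<delta> \<alpha>) w)))"
  proof (cases "fst l")
    case True
    then show ?thesis using assoc[OF b] by (simp add: letter_value_def letter_block_def Let_def concat_path_def)
  next
    case False
    have "inv\<^bsub>\<pi>\<^esub> cl (\<alpha> ?k +++ \<alpha> (?k + \<delta>)) = cl (reversepath (\<alpha> (?k + \<delta>)) +++ reversepath (\<alpha> ?k))"
      using inv_\<pi>[OF based_join[OF b]] b by (simp add: based_def reversepath_joinpaths)
    then show ?thesis
      using False assoc[OF based_reverse[OF b(2)] based_reverse[OF b(1)]]
      by (simp add: letter_value_def letter_block_def Let_def concat_path_def)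
  qed
  moreover have "based (concat_path (f x) (letter_block \<delta> \<alpha> l @ concat (map (letter_block \<delta> \<alpha>) w)))"
    using b r by (auto simp: letter_block_def Let_def concat_path_def intro!: based_join based_reverse)
  ultimately show ?case using Cons by (simp add: word_value_def)
qed

context cut_point_set
begin

theorem uncountably_generated_free_subgroup:
  assumes g: "path g" "path_image g \<subseteq> S" "pathfinish g = pathstart g"
    and nt: "\<not> homotopic_paths S g (linepath (pathstart g) (pathstart g))"
    and pm: "path_model Y S f f' x"
  shows "has_uncountably_generated_free_subgroup (fundamental_group Y x)"
proof -
  interpret pm: path_model Y S f f' x by (rule pm)
  define x0 where "x0 = f x"
  have x0: "x0 \<in> S" unfolding x0_def by (rule pm.fS[OF pm.x])
  obtain c x y t0 where c: "geodesic_in S c x y" "x \<in> S" "y \<in> S" "x \<noteq> y" "0 < t0" "t0 < 1"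
    "linked (c t0) x y"
    using tree_loops_trivial[OF _ g] nt by blast
  obtain l u b where lu: "(l::real) < u"
    and cb: "\<And>t. t \<in> {l<..<u} \<Longrightarrow> c t \<in> S \<and> b t \<in> S \<and> b t \<noteq> c t"
    and dj: "\<And>s t. s \<in> {l<..<u} \<Longrightarrow> t \<in> {l<..<u} \<Longrightarrow> s \<noteq> t \<Longrightarrow> branch (c s) (b s) \<inter> branch (c t) (b t) = {}"
    by (rule disjoint_branches[OF c]) (use that in blast)
  define Bad where "Bad = {t \<in> {l<..<u}. x0 \<in> branch (c t) (b t)}"
  define J where "J = {l<..<u} - Bad"
  \<comment> \<open>The base point lies in at most one of the disjoint branches.\<close>
  have "\<exists>t. Bad \<subseteq> {t}" using dj unfolding Bad_def by blast
  then have Bad: "countable Bad" by (meson countable_finite finite.emptyI finite_insert finite_subset)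
  \<comment> \<open>With half the length of the interval, \<open>k\<close> in the first half and
    \<open>k + \<delta>\<close> in the second index two different branches; \<open>K\<close> drops
    the values for which either branch contains the base point.\<close>
  define \<delta> where "\<delta> = (u - l) / 2"
  define K where "K = {l<..<l + \<delta>} - Bad - (\<lambda>t. t - \<delta>) ` Bad"
  have K: "k \<in> J" "k + \<delta> \<in> J" "k \<in> {l<..<l + \<delta>}" if "k \<in> K" for k
  proof -
    show "k \<in> {l<..<l + \<delta>}" using that by (simp add: K_def)
    moreover have "k + \<delta> \<notin> Bad" using that unfolding K_def by force
    ultimately show "k \<in> J" "k + \<delta> \<in> J" using that by (auto simp: J_def K_def \<delta>_def field_simps)
  qed
  have "uncountable {l<..<l + \<delta>}" using lu by (simp add: uncountable_open_interval \<delta>_def)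
  then have uK: "uncountable K"
    unfolding K_def by (intro uncountable_minus_countable countable_image Bad)
  have J: "c t \<in> S" "b t \<in> S" "b t \<noteq> c t" "x0 \<notin> branch (c t) (b t)" if "t \<in> J" for t
    using that cb by (auto simp: J_def Bad_def)
  have Jdj: "branch (c s) (b s) \<inter> branch (c t) (b t) = {}" if "s \<in> J" "t \<in> J" "s \<noteq> t" for s t
    using dj that by (auto simp: J_def)
  have "\<exists>\<alpha>. path \<alpha> \<and> path_image \<alpha> \<subseteq> S \<and> pathstart \<alpha> = x0 \<and> pathfinish \<alpha> = x0 \<and>
      (\<forall>s\<in>J. s \<noteq> t \<longrightarrow> path_image \<alpha> \<inter> {y. linked (c s) (b s) y} = {}) \<and>
      \<not> homotopic_paths S (collapse (c t) (b t) \<circ> \<alpha>) (linepath (c t) (c t))" if t: "t \<in> J" for t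
  proof -
    obtain \<alpha> where "path \<alpha>" "path_image \<alpha> \<subseteq> S" "pathstart \<alpha> = x0" "pathfinish \<alpha> = x0"
      and av: "\<And>z' a'. z' \<in> S \<Longrightarrow> x0 \<notin> branch z' a' \<Longrightarrow> branch z' a' \<inter> branch (c t) (b t) = {} \<Longrightarrow>
        path_image \<alpha> \<inter> {y. linked z' a' y} = {}"
      and "\<not> homotopic_paths S (collapse (c t) (b t) \<circ> \<alpha>) (linepath (c t) (c t))"
      by (rule ex_branch_loop[OF g nt J(1-3)[OF t] x0 J(4)[OF t]]) (use that in blast)
    moreover have "path_image \<alpha> \<inter> {y. linked (c s) (b s) y} = {}" if "s \<in> J" "s \<noteq> t" for s
      using av[of "c s" "b s"] J[OF that(1)] Jdj[OF that(1) t that(2)] by blast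
    ultimately show ?thesis by blast
  qed
  then obtain \<alpha> where \<alpha>: "\<And>t. t \<in> J \<Longrightarrow> path (\<alpha> t) \<and> path_image (\<alpha> t) \<subseteq> S \<and> pathstart (\<alpha> t) = x0 \<and> pathfinish (\<alpha> t) = x0 \<and>
      (\<forall>s\<in>J. s \<noteq> t \<longrightarrow> path_image (\<alpha> t) \<inter> {y. linked (c s) (b s) y} = {}) \<and>
      \<not> homotopic_paths S (collapse (c t) (b t) \<circ> \<alpha> t) (linepath (c t) (c t))"
    by metis
  have ba: "pm.based (\<alpha> t)" if "t \<in> J" for t
    using \<alpha>[OF that] by (simp add: pm.based_def x0_def)
  show ?thesis
  proof (rule group.has_uncountably_generated_free_subgroupI[OF pm.group_\<pi> _ uK])
    show "(\<lambda>k. pm.cl (\<alpha> k +++ \<alpha> (k + \<delta>))) ` K \<subseteq> carrier pm.\<pi>"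
      using K ba by (auto intro!: pm.cl_in_carrier pm.based_join)
    fix w :: "(bool \<times> real) list"
    assume w: "w \<noteq> []" "snd ` set w \<subseteq> K" "reduced_word w"
    let ?ps = "concat (map (letter_block \<delta> \<alpha>) w)"
    let ?I = "fst ` set ?ps"
    have psne: "?ps \<noteq> []" using w(1) letter_block_ne[of \<delta> \<alpha>] by (cases w) auto
    have psJ: "fst q \<in> J \<and> (snd q = \<alpha> (fst q) \<or> snd q = reversepath (\<alpha> (fst q)))" if "q \<in> set ?ps" for q
    proof -
      from that obtain l where l: "l \<in> set w" "q \<in> set (letter_block \<delta> \<alpha> l)"
        unfolding set_concat set_map by blast
      then have "snd l \<in> K" using w(2) by auto
      from K[OF this] show ?thesis using l(2) by (auto simp: letter_block_def Let_def split: if_splits)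
    qed
    then have IJ: "?I \<subseteq> J" by auto
    \<comment> \<open>The family depends on the word, which is how it comes to be finite. Its group
      \<open>bf.P\<close> is that of \<open>S\<close> at \<open>x0\<close>; it is related to
      \<open>pm.\<pi>\<close> through \<open>homotopic_paths\<close> in \<open>S\<close>.\<close>
    interpret bf: branch_family S ?I c b x0
    proof
      show "finite ?I" "?I \<noteq> {}" using psne by auto
      show "c i \<in> S" "x0 \<notin> branch (c i) (b i)" if "i \<in> ?I" for i using J[of i] that IJ by auto
      show "branch (c i) (b i) \<inter> branch (c j) (b j) = {}" if "i \<in> ?I" "j \<in> ?I" "i \<noteq> j" for i j
        using Jdj[of i j] that IJ by blast
    qed (rule x0)
    have nt_wt: "bf.wt t (\<alpha> t) \<noteq> \<one>\<^bsub>bf.P\<^esub>" "bf.wt t (reversepath (\<alpha> t)) \<noteq> \<one>\<^bsub>bf.P\<^esub>" if "t \<in> ?I" for t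
    proof -
      have tJ: "t \<in> J" using that IJ by blast
      note A = \<alpha>[OF tJ]
      let ?r = "collapse (c t) (b t)"
      have z: "?r x0 = c t" using J(4)[OF tJ] by (rule collapse_not_branch)
      have "bf.path_in (\<alpha> t)" "bf.path_in (reversepath (\<alpha> t))"
        using A by (auto simp: bf.path_in_def)
      have rev: "?r \<circ> reversepath (\<alpha> t) = reversepath (?r \<circ> \<alpha> t)" by (auto simp: reversepath_def)
      have l: "reversepath (linepath (c t) (c t)) = linepath (c t) (c t)" by simp
      show "bf.wt t (\<alpha> t) \<noteq> \<one>\<^bsub>bf.P\<^esub>"
        using bf.wt_trivial_iff[OF \<open>bf.path_in (\<alpha> t)\<close> that] A z
        by (simp add: pathstart_compose pathfinish_compose)
      have "\<not> homotopic_paths S (reversepath (?r \<circ> \<alpha> t)) (linepath (c t) (c t))"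
        using A homotopic_paths_reversepath[of S "?r \<circ> \<alpha> t" "linepath (c t) (c t)"] unfolding l by blast
      then show "bf.wt t (reversepath (\<alpha> t)) \<noteq> \<one>\<^bsub>bf.P\<^esub>"
        using bf.wt_trivial_iff[OF \<open>bf.path_in (reversepath (\<alpha> t))\<close> that] A z
        by (simp add: rev pathstart_compose pathfinish_compose)
    qed
    have "bf.letter q" if q: "q \<in> set ?ps" for q
    proof -
      have t: "fst q \<in> ?I" "fst q \<in> J" using q IJ by auto
      note A = \<alpha>[OF t(2)]
      have "bf.pm.based (\<alpha> (fst q))" using A by (simp add: bf.pm.based_def)
      moreover have "bf.avoids (fst q) (path_image (\<alpha> (fst q)))"
        using A IJ unfolding bf.avoids_def by blast
      ultimately have "bf.pm.based (snd q)" "bf.avoids (fst q) (path_image (snd q))"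
        using conjunct2[OF psJ[OF q]] bf.pm.based_reverse by (metis path_image_reversepath)+
      moreover have "bf.wt (fst q) (snd q) \<noteq> \<one>\<^bsub>bf.P\<^esub>"
        using conjunct2[OF psJ[OF q]] nt_wt[OF t(1)] by metis
      ultimately show ?thesis unfolding bf.letter_def using t(1) by (intro conjI)
    qed
    moreover have "distinct_adj (map fst ?ps)"
      using w K(3) by (intro distinct_adj_blocks[of w l]) auto
    ultimately have nh: "\<not> homotopic_paths S (concat_path x0 ?ps) (linepath x0 x0)"
      using bf.alternating_word_nontrivial[of ?ps] psne by blast
    have "pm.based (\<alpha> k) \<and> pm.based (\<alpha> (k + \<delta>))" if "k \<in> snd ` set w" for k
      using K[of k] w(2) that ba by blast
    from pm.word_value_blocks[of w \<alpha> \<delta>, OF this]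
    show "word_value pm.\<pi> (map (\<lambda>l. letter_value pm.\<pi> (fst l, pm.cl (\<alpha> (snd l) +++ \<alpha> (snd l + \<delta>)))) w)
        \<noteq> \<one>\<^bsub>pm.\<pi>\<^esub>"
      using nh pm.cl_eq_iff[OF _ pm.based_const] by (simp add: pm.one_\<pi> x0_def)
  qed
qed

end

section \<open>Metric spaces and asymptotic cones\<close>

definition geodesic_metric :: "'a metric \<Rightarrow> bool" where
  "geodesic_metric m \<longleftrightarrow> (\<forall>x\<in>mspace m. \<forall>y\<in>mspace m. \<exists>c. c 0 = x \<and> c 1 = y \<and> c ` {0..1::real} \<subseteq> mspace m \<and>
     (\<forall>s\<in>{0..1}. \<forall>t\<in>{0..1}. mdist m (c s) (c t) = \<bar>s - t\<bar> * mdist m x y))"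

definition homogeneous_metric :: "'a metric \<Rightarrow> bool" where
  "homogeneous_metric m \<longleftrightarrow> (\<forall>x\<in>mspace m. \<forall>y\<in>mspace m. \<exists>f. f ` mspace m = mspace m \<and>
     (\<forall>u\<in>mspace m. \<forall>v\<in>mspace m. mdist m (f u) (f v) = mdist m u v) \<and> f x = y)"

text \<open>Kuratowski's embedding \<open>x \<mapsto> d(x, \<cdot>) - d(o, \<cdot>)\<close>, which moves an arbitrary metric space into
  a type on which the library's path operations are available.\<close>
lemma kuratowski_embedding:
  fixes m :: "'a metric"
  obtains F :: "'a \<Rightarrow> 'a discrete \<Rightarrow>\<^sub>C real"
    where "\<And>x y. x \<in> mspace m \<Longrightarrow> y \<in> mspace m \<Longrightarrow> dist (F x) (F y) = mdist m x y"
proof (cases "mspace m = {}")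
  case True
  then show ?thesis using that[of "\<lambda>_. 0"] by simp
next
  case False
  then obtain a where a: "a \<in> mspace m" by blast
  let ?k = "\<lambda>x p. if of_discrete p \<in> mspace m then mdist m x (of_discrete p) - mdist m a (of_discrete p) else 0"
  define F where "F x = Bcontfun (?k x)" for x
  have ap: "apply_bcontfun (F x) = ?k x" if x: "x \<in> mspace m" for x
  proof -
    have "?k x \<in> bcontfun"
    proof (rule bcontfun_normI)
      show "continuous_on UNIV (?k x)"
        by (auto simp: continuous_on_topological open_discrete intro: exI[of _ "{q}" for q])
      fix p
      show "norm (?k x p) \<le> mdist m x a"
        using mdist_triangle[OF x a, of "of_discrete p"] mdist_triangle[OF a x, of "of_discrete p"]
        by (auto simp: mdist_commute)
    qed
    then show ?thesis unfolding F_def by (rule Bcontfun_inverse)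
  qed
  have "dist (F x) (F y) = mdist m x y" if x: "x \<in> mspace m" and y: "y \<in> mspace m" for x y
  proof (rule antisym)
    show "dist (F x) (F y) \<le> mdist m x y"
    proof (rule dist_bound)
      fix p
      show "dist (apply_bcontfun (F x) p) (apply_bcontfun (F y) p) \<le> mdist m x y"
        using mdist_triangle[OF x y, of "of_discrete p"] mdist_triangle[OF y x, of "of_discrete p"]
        by (auto simp: ap x y dist_real_def mdist_commute)
    qed
    show "mdist m x y \<le> dist (F x) (F y)"
    proof -
      have yy: "mdist m y y = 0" using y by simp
      show ?thesis
        using dist_bounded[of "F x" "discrete y" "F y"]
        by (simp add: ap x y yy dist_real_def discrete_inverse)
    qed
  qed
  then show ?thesis by (rule that)
qed

lemma isometry_homeomorphic_maps:
  fixes F :: "'a \<Rightarrow> 'v::real_normed_vector"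
  assumes F: "\<And>x y. x \<in> mspace m \<Longrightarrow> y \<in> mspace m \<Longrightarrow> dist (F x) (F y) = mdist m x y"
  shows "homeomorphic_maps (mtopology_of m) (top_of_set (F ` mspace m)) F (inv_into (mspace m) F)"
proof -
  let ?g = "inv_into (mspace m) F" and ?E = "submetric euclidean_metric (F ` mspace m)"
  have inj: "inj_on F (mspace m)"
  proof (rule inj_onI)
    fix x y assume xy: "x \<in> mspace m" "y \<in> mspace m" "F x = F y"
    then have "mdist m x y = 0" using F[of x y] by simp
    then show "x = y" using xy by simp
  qed
  have E: "mtopology_of ?E = top_of_set (F ` mspace m)"
    by (simp add: mtopology_of_submetric)
  have "Lipschitz_continuous_map m ?E F"
    unfolding Lipschitz_continuous_map_def using F by (intro conjI exI[of _ 1]) auto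
  moreover have "Lipschitz_continuous_map ?E m ?g"
    unfolding Lipschitz_continuous_map_def using F inj by (intro conjI exI[of _ 1]) auto
  ultimately have "continuous_map (mtopology_of m) (top_of_set (F ` mspace m)) F"
    "continuous_map (top_of_set (F ` mspace m)) (mtopology_of m) ?g"
    using Lipschitz_continuous_imp_continuous_map unfolding E[symmetric] by blast+
  then show ?thesis
    using inj by (auto simp: homeomorphic_maps_def f_inv_into_f)
qed

text \<open>A path avoiding \<open>F z\<close> pulls back to a connected set avoiding
  \<open>z\<close>, so it cannot join points coming from different components.\<close>

lemma global_cut_point_separates:
  fixes F :: "'a \<Rightarrow> 'v::real_normed_vector"
  assumes hom: "homeomorphic_maps Y (top_of_set S) F g" and cut: "global_cut_point Y z"
  shows "\<exists>z a b. z \<in> S \<and> a \<in> S - {z} \<and> b \<in> S - {z} \<and> \<not> path_component (S - {z}) a b"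
proof -
  have F: "F u \<in> S" "g (F u) = u" if "u \<in> topspace Y" for u
    using hom that by (auto simp: homeomorphic_maps_def continuous_map_def)
  have g: "continuous_map (top_of_set S) Y g" "F (g v) = v" if "v \<in> S" for v
    using hom that by (auto simp: homeomorphic_maps_def)
  let ?Z = "subtopology Y (topspace Y - {z})"
  obtain C D where z: "z \<in> topspace Y" and CD: "C \<in> connected_components_of ?Z"
    "D \<in> connected_components_of ?Z" "C \<noteq> D"
    using cut unfolding global_cut_point_def by blast
  then obtain a b where a: "a \<in> topspace Y - {z}" "C = connected_component_of_set ?Z a"
    and b: "b \<in> topspace Y - {z}" "D = connected_component_of_set ?Z b"
    by (auto simp: connected_components_of_def)
  have "\<not> path_component (S - {F z}) (F a) (F b)"
  proof
    assume "path_component (S - {F z}) (F a) (F b)"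
    then obtain p where p: "path p" "path_image p \<subseteq> S - {F z}" "pathstart p = F a" "pathfinish p = F b"
      unfolding path_component_def by blast
    have "connectedin (top_of_set S) (path_image p)"
      using p connected_path_image[OF p(1)] by (auto simp: connectedin_subtopology)
    then have c: "connectedin Y (g ` path_image p)"
      using F(1)[OF z] by (intro connectedin_continuous_map_image[OF g(1)])
    have "g ` path_image p \<subseteq> topspace Y - {z}"
    proof -
      have "g v \<noteq> z" if "v \<in> path_image p" for v using that p(2) g(2)[of v] by auto
      then show ?thesis using connectedin_subset_topspace[OF c] by blast
    qed
    then have "connectedin ?Z (g ` path_image p)" using c by (simp add: connectedin_subtopology)
    moreover have "a \<in> g ` path_image p" "b \<in> g ` path_image p"
      using F(2)[of a] F(2)[of b] a(1) b(1) p by (metis DiffD1 image_eqI pathstart_in_path_image pathfinish_in_path_image)+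
    ultimately have "connected_component_of ?Z a b" unfolding connected_component_of_def by blast
    then show False using CD(3) a(2) b(2) by (simp add: connected_component_of_equiv)
  qed
  moreover have "F a \<noteq> F z" "F b \<noteq> F z" using F(2) a(1) b(1) z by (metis DiffD1 DiffD2 singletonI)+
  ultimately show ?thesis using F(1) a(1) b(1) z by blast
qed

theorem homogeneous_geodesic_cut_point_dichotomy:
  fixes m :: "'a metric"
  assumes geo: "geodesic_metric m" and homog: "homogeneous_metric m"
    and cut: "has_global_cut_point (mtopology_of m)"
  shows "simply_connected_space (mtopology_of m) \<or>
    (\<forall>x\<in>mspace m. has_uncountably_generated_free_subgroup (fundamental_group (mtopology_of m) x))"
proof -
  obtain F :: "'a \<Rightarrow> 'a discrete \<Rightarrow>\<^sub>C real"
    where F: "\<And>x y. x \<in> mspace m \<Longrightarrow> y \<in> mspace m \<Longrightarrow> dist (F x) (F y) = mdist m x y"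
    by (rule kuratowski_embedding[of m]) (use that in blast)
  let ?S = "F ` mspace m" and ?g = "inv_into (mspace m) F" and ?Y = "mtopology_of m"
  have hom: "homeomorphic_maps ?Y (top_of_set ?S) F ?g" by (rule isometry_homeomorphic_maps[OF F])
  have gF: "?g (F u) = u" if "u \<in> mspace m" for u
    using hom that by (auto simp: homeomorphic_maps_def)
  interpret cut_point_set ?S
  proof
    fix u v assume "u \<in> ?S" "v \<in> ?S"
    then obtain x y where xy: "u = F x" "v = F y" "x \<in> mspace m" "y \<in> mspace m" by blast
    obtain c where c: "c 0 = x" "c 1 = y" "c ` {0..1::real} \<subseteq> mspace m"
      "\<forall>s\<in>{0..1}. \<forall>t\<in>{0..1}. mdist m (c s) (c t) = \<bar>s - t\<bar> * mdist m x y"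
      using geo xy unfolding geodesic_metric_def by meson
    have cm: "c t \<in> mspace m" if "t \<in> {0..1}" for t using c(3) that by blast
    have "geodesic_in ?S (F \<circ> c) u v"
      unfolding geodesic_in_def using c xy cm by (auto simp: F)
    then show "\<exists>c. geodesic_in ?S c u v" by blast
    obtain f where f: "f ` mspace m = mspace m" "f x = y"
      "\<forall>u\<in>mspace m. \<forall>v\<in>mspace m. mdist m (f u) (f v) = mdist m u v"
      using homog xy unfolding homogeneous_metric_def by meson
    have fm: "f w \<in> mspace m" if "w \<in> mspace m" for w using f(1) that by blast
    have "(F \<circ> f \<circ> ?g) ` ?S = ?S"
    proof -
      have "?g ` ?S = mspace m" using gF by force
      then have "F ` f ` ?g ` ?S = ?S" by (simp only: f(1))
      then show ?thesis by (simp only: image_comp comp_assoc)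
    qed
    then have "self_isometry ?S (F \<circ> f \<circ> ?g)"
      unfolding self_isometry_def using f(3) by (auto simp: gF F fm)
    moreover have "(F \<circ> f \<circ> ?g) u = v" using f xy by (simp add: gF)
    ultimately show "\<exists>f. self_isometry ?S f \<and> f u = v" by blast
  next
    show "\<exists>z a b. z \<in> ?S \<and> a \<in> ?S - {z} \<and> b \<in> ?S - {z} \<and> \<not> path_component (?S - {z}) a b"
      using cut global_cut_point_separates[OF hom] unfolding has_global_cut_point_def by blast
  qed
  have model: "path_model ?Y ?S F ?g x" if "x \<in> mspace m" for x
    using hom that by unfold_locales auto
  have pc: "path_connected_space ?Y"
    using path_connected hom homeomorphic_path_connected_space[of ?Y "top_of_set ?S"]
    unfolding homeomorphic_space_def by auto
  show ?thesis
  proof (rule disjCI)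
    assume neg: "\<not> (\<forall>x\<in>mspace m. has_uncountably_generated_free_subgroup (fundamental_group ?Y x))"
    \<comment> \<open>A single essential loop anywhere yields the free subgroup at every base point,
      so its absence at one base point makes all loops contractible.\<close>
    have null: "homotopic_paths ?S q (linepath (pathstart q) (pathstart q))"
      if "path q" "path_image q \<subseteq> ?S" "pathfinish q = pathstart q" for q
      using uncountably_generated_free_subgroup[OF that _ model] neg by blast
    have "carrier (fundamental_group ?Y x) = {\<one>\<^bsub>fundamental_group ?Y x\<^esub>}" if x: "x \<in> mspace m" for x
    proof -
      interpret pm: path_model ?Y ?S F ?g x by (rule model[OF x])
      have "pm.cl q = pm.cl (linepath (F x) (F x))" if "pm.based q" for q
        using null[of q] that pm.cl_eq_iff[OF that pm.based_const] by (simp add: pm.based_def)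
      then show ?thesis using pm.based_const unfolding pm.carrier_\<pi> pm.one_\<pi> by blast
    qed
    then show "simply_connected_space ?Y" using pc unfolding simply_connected_space_def by simp
  qed
qed

text \<open>The word metric lives on the vertices of the Cayley graph, so its geodesics have integer
  parameters only; rescaling in the cone fills the gaps.\<close>

definition discretely_geodesic :: "'a metric \<Rightarrow> bool" where
  "discretely_geodesic X \<longleftrightarrow> (\<forall>x\<in>mspace X. \<forall>y\<in>mspace X. \<exists>L p. p 0 = x \<and> p L = y \<and>
     (\<forall>i\<le>L. p i \<in> mspace X) \<and> (\<forall>i\<le>L. \<forall>j\<le>L. mdist X (p i) (p j) = \<bar>real i - real j\<bar>))"

section \<open>Geometry of asymptotic cones\<close>

context
  fixes X :: "'a metric" and \<omega> :: "nat filter" and e :: "nat \<Rightarrow> 'a" and d :: "nat \<Rightarrow> real"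
  assumes uf: "ultrafilter \<omega>" and sc: "scaling_sequence \<omega> d" and ob: "observation_sequence X e"
begin

abbreviation (input) "acone \<equiv> asymptotic_cone X \<omega> e d"
abbreviation (input) "cseqs \<equiv> cone_sequences X \<omega> e d"
abbreviation (input) "cpoint x \<equiv> cone_rel X \<omega> e d `` {x}"

lemma cone_distI:
  assumes "((\<lambda>n. mdist X (x n) (y n) / d n) \<longlongrightarrow> r) \<omega>"
  shows "cone_dist X \<omega> d x y = ereal r"
proof -
  have "((\<lambda>n. ereal (mdist X (x n) (y n) / d n)) \<longlongrightarrow> ereal r) \<omega>"
    using assms by (intro tendsto_intros)
  then show ?thesis
    using tendsto_cone_dist[OF uf sc ob, of x y] \<omega>_nontrivial[OF uf sc ob] by (metis tendsto_unique)
qed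

lemma cls_in: "x \<in> cseqs \<Longrightarrow> cpoint x \<in> mspace acone"
  unfolding mspace_asymptotic_cone[OF uf sc ob] by (rule quotientI)

lemma cone_pointE:
  assumes "A \<in> mspace acone"
  obtains x where "x \<in> cseqs" "A = cpoint x"
  using assms unfolding mspace_asymptotic_cone[OF uf sc ob] by (rule quotientE)

lemma cls_eq_iff: "x \<in> cseqs \<Longrightarrow> y \<in> cseqs \<Longrightarrow> cpoint x = cpoint y \<longleftrightarrow> cone_dist X \<omega> d x y = 0"
  using eq_equiv_class_iff[OF equiv_cone_rel[OF uf sc ob], of x y] by (auto simp: cone_rel_def)

lemma cone_sequencesI:
  assumes "\<And>n. x n \<in> mspace X" "y \<in> cseqs" "cone_dist X \<omega> d x y < \<infinity>"
  shows "x \<in> cseqs"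
proof -
  have "cone_dist X \<omega> d x e \<le> cone_dist X \<omega> d x y + cone_dist X \<omega> d y e"
    using assms ob by (intro cone_dist_triangle[OF uf sc ob]) (auto simp: cone_sequences_def observation_sequence_def)
  also have "\<dots> < \<infinity>" using assms by (auto simp: cone_sequences_def)
  finally show ?thesis using assms by (auto simp: cone_sequences_def)
qed

text \<open>In each coordinate take the point of a discrete geodesic at \<open>t\<close> times its
  length, rounded down. Rounding at two parameters costs at most 2, which vanishes in the limit
  after division by \<open>d n\<close>.\<close>

lemma geodesic_cone:
  assumes "discretely_geodesic X"
  shows "geodesic_metric acone"
  unfolding geodesic_metric_def
proof (intro ballI)
  fix A B assume "A \<in> mspace acone" "B \<in> mspace acone"
  then obtain x y where x: "x \<in> cseqs" "A = cpoint x" and y: "y \<in> cseqs" "B = cpoint y"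
    by (metis cone_pointE)
  have xm: "x n \<in> mspace X" and ym: "y n \<in> mspace X" for n using x y by (auto simp: cone_sequences_def)
  have "\<exists>L p. p 0 = x n \<and> p L = y n \<and> (\<forall>i\<le>L. p i \<in> mspace X) \<and>
      (\<forall>i\<le>L. \<forall>j\<le>L. mdist X (p i) (p j) = \<bar>real i - real j\<bar>)" for n
    using assms xm[of n] ym[of n] unfolding discretely_geodesic_def by blast
  then obtain L :: "nat \<Rightarrow> nat" and p where p: "p n 0 = x n" "p n (L n) = y n"
    "i \<le> L n \<Longrightarrow> p n i \<in> mspace X"
    "i \<le> L n \<Longrightarrow> j \<le> L n \<Longrightarrow> mdist X (p n i) (p n j) = \<bar>real i - real j\<bar>" for n i j
    by metis
  define D where "D = mdist acone A B"
  have dxy: "cone_dist X \<omega> d x y = ereal D"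
    using mdist_asymptotic_cone[OF uf sc ob x(1) y(1)] x y by (simp add: D_def)
  have "mdist X (x n) (y n) = real (L n)" for n
    using p(4)[of 0 n "L n"] p(1,2) by simp
  then have LD: "((\<lambda>n. real (L n) / d n) \<longlongrightarrow> D) \<omega>"
    using tendsto_cone_dist[OF uf sc ob, of x y] dxy by simp
  define k where "k t n = nat \<lfloor>t * real (L n)\<rfloor>" for t n
  have kL: "k t n \<le> L n" if "t \<in> {0..1}" for t n
  proof -
    have "t * real (L n) \<le> real (L n)" using that by (simp add: mult_left_le_one_le)
    then show ?thesis unfolding k_def by (metis floor_mono floor_of_nat nat_le_iff of_int_of_nat_eq)
  qed
  have kt: "\<bar>real (k t n) - t * real (L n)\<bar> \<le> 1" if "t \<in> {0..1}" for t n
  proof -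
    have "0 \<le> t * real (L n)" using that by simp
    then show ?thesis unfolding k_def by linarith
  qed
  have d0: "((\<lambda>n. 2 / d n) \<longlongrightarrow> 0) \<omega>"
  proof -
    have "filterlim d at_top \<omega>"
      using sc unfolding scaling_sequence_def filterlim_at_top_dense by blast
    then show ?thesis by (intro tendsto_divide_0[OF tendsto_const] filterlim_at_top_imp_at_infinity)
  qed
  define w where "w t n = p n (k t n)" for t n
  have dw: "cone_dist X \<omega> d (w s) (w t) = ereal (\<bar>s - t\<bar> * D)" if st: "s \<in> {0..1}" "t \<in> {0..1}" for s t
  proof (rule cone_distI)
    have main: "((\<lambda>n. \<bar>s - t\<bar> * (real (L n) / d n)) \<longlongrightarrow> \<bar>s - t\<bar> * D) \<omega>"
      by (intro tendsto_intros LD)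
    have "((\<lambda>n. mdist X (w s n) (w t n) / d n - \<bar>s - t\<bar> * (real (L n) / d n)) \<longlongrightarrow> 0) \<omega>"
    proof (rule Lim_null_comparison[OF _ d0], rule always_eventually, rule allI)
      fix n
      have "mdist X (w s n) (w t n) = \<bar>real (k s n) - real (k t n)\<bar>"
        unfolding w_def by (intro p kL st)
      moreover have "\<bar>s - t\<bar> * real (L n) = \<bar>s * real (L n) - t * real (L n)\<bar>"
        by (simp add: abs_mult flip: left_diff_distrib)
      ultimately have "\<bar>mdist X (w s n) (w t n) - \<bar>s - t\<bar> * real (L n)\<bar> \<le> 2"
        using kt[OF st(1), of n] kt[OF st(2), of n] by linarith
      then have "\<bar>mdist X (w s n) (w t n) - \<bar>s - t\<bar> * real (L n)\<bar> / d n \<le> 2 / d n"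
        using dpos[OF uf sc ob, of n] by (intro divide_right_mono) auto
      then show "norm (mdist X (w s n) (w t n) / d n - \<bar>s - t\<bar> * (real (L n) / d n)) \<le> 2 / d n"
        using dpos[OF uf sc ob, of n] by (simp add: diff_divide_distrib[symmetric])
    qed
    from tendsto_add[OF this main]
    show "((\<lambda>n. mdist X (w s n) (w t n) / d n) \<longlongrightarrow> \<bar>s - t\<bar> * D) \<omega>" by simp
  qed
  have w01: "w 0 = x" "w 1 = y" by (auto simp: w_def k_def p)
  have wQ: "w t \<in> cseqs" if "t \<in> {0..1}" for t
    using dw[OF that, of 0] kL[OF that] by (intro cone_sequencesI[OF _ x(1)]) (auto simp: w01 w_def p)
  have "mdist acone (cpoint (w s)) (cpoint (w t)) = \<bar>s - t\<bar> * D" if "s \<in> {0..1}" "t \<in> {0..1}" for s t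
    using mdist_asymptotic_cone[OF uf sc ob wQ[OF that(1)] wQ[OF that(2)]] dw[OF that] by simp
  then show "\<exists>c. c 0 = A \<and> c 1 = B \<and> c ` {0..1::real} \<subseteq> mspace acone \<and>
      (\<forall>s\<in>{0..1}. \<forall>t\<in>{0..1}. mdist acone (c s) (c t) = \<bar>s - t\<bar> * mdist acone A B)"
    using x y w01 cls_in[OF wQ] by (intro exI[of _ "\<lambda>t. cpoint (w t)"]) (auto simp: D_def)
qed

text \<open>Isometries of \<open>X\<close> taking \<open>x n\<close> to \<open>y n\<close> act
  coordinatewise. Sequences at finite distance from \<open>x\<close> are sent to sequences at finite
  distance from \<open>y\<close>, so the cone is preserved.\<close>

lemma homogeneous_cone:
  assumes "homogeneous_metric X"
  shows "homogeneous_metric acone"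
  unfolding homogeneous_metric_def
proof (intro ballI)
  fix A B assume "A \<in> mspace acone" "B \<in> mspace acone"
  then obtain x y where x: "x \<in> cseqs" "A = cpoint x" and y: "y \<in> cseqs" "B = cpoint y"
    by (metis cone_pointE)
  have xm: "x n \<in> mspace X" and ym: "y n \<in> mspace X" for n using x y by (auto simp: cone_sequences_def)
  have "\<exists>f. f ` mspace X = mspace X \<and> (\<forall>u\<in>mspace X. \<forall>v\<in>mspace X. mdist X (f u) (f v) = mdist X u v) \<and> f (x n) = y n" for n
    using assms xm ym unfolding homogeneous_metric_def by blast
  then obtain f where f: "f n ` mspace X = mspace X" "f n (x n) = y n"
    "u \<in> mspace X \<Longrightarrow> v \<in> mspace X \<Longrightarrow> mdist X (f n u) (f n v) = mdist X u v" for n u v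
    by metis
  define \<Phi> where "\<Phi> w n = f n (w n)" for w n
  have iso: "cone_dist X \<omega> d (\<Phi> u) (\<Phi> v) = cone_dist X \<omega> d u v"
    if "\<And>n. u n \<in> mspace X" "\<And>n. v n \<in> mspace X" for u v
    using that f(3) by (simp add: cone_dist_def \<Phi>_def)
  have m: "w n \<in> mspace X" if "w \<in> cseqs" for w n using that by (simp add: cone_sequences_def)
  have \<Phi>x: "\<Phi> x = y" by (auto simp: \<Phi>_def f)
  have \<Phi>m: "\<Phi> w n \<in> mspace X" if "w \<in> cseqs" for w n using f(1) m[OF that] by (auto simp: \<Phi>_def)
  have \<Phi>cseqs: "\<Phi> w \<in> cseqs" if "w \<in> cseqs" for w
    using iso[of w x] m[OF that] m[OF x(1)] cone_dist_finite[OF uf sc ob that x(1)] \<Phi>x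
    by (intro cone_sequencesI[OF \<Phi>m[OF that] y(1)]) simp
  \<comment> \<open>The fact \<open>\<phi>\<close> below shows that the induced map does not depend
    on the representatives chosen here.\<close>
  define rep where "rep A' = (SOME w. w \<in> cseqs \<and> A' = cpoint w)" for A'
  have rep: "rep A' \<in> cseqs \<and> A' = cpoint (rep A')" if "A' \<in> mspace acone" for A'
  proof -
    have "\<exists>w. w \<in> cseqs \<and> A' = cpoint w" by (rule cone_pointE[OF that]) blast
    then show ?thesis unfolding rep_def by (rule someI_ex)
  qed
  let ?\<phi> = "\<lambda>A'. cpoint (\<Phi> (rep A'))"
  have \<phi>: "?\<phi> (cpoint w) = cpoint (\<Phi> w)" if "w \<in> cseqs" for w
  proof -
    have r: "rep (cpoint w) \<in> cseqs" "cpoint (rep (cpoint w)) = cpoint w" using rep[OF cls_in[OF that]] by auto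
    then have "cone_dist X \<omega> d (rep (cpoint w)) w = 0" using cls_eq_iff that by blast
    then show ?thesis using cls_eq_iff[OF \<Phi>cseqs \<Phi>cseqs, OF r(1) that] iso[of "rep (cpoint w)" w] m[OF r(1)] m[OF that] by simp
  qed
  have "?\<phi> ` mspace acone = mspace acone"
  proof
    show "?\<phi> ` mspace acone \<subseteq> mspace acone" using rep \<Phi>cseqs cls_in by blast
    show "mspace acone \<subseteq> ?\<phi> ` mspace acone"
    proof
      fix B' assume "B' \<in> mspace acone"
      then obtain w where w: "w \<in> cseqs" "B' = cpoint w" by (metis cone_pointE)
      \<comment> \<open>Preimages are taken coordinatewise; the resulting sequence is at finite
        distance from \<open>x\<close> because \<open>w\<close> is at finite distance from
        \<open>y\<close>.\<close>
      have "\<exists>v\<in>mspace X. f n v = w n" for n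
      proof -
        have "w n \<in> f n ` mspace X" using m[OF w(1), of n] by (simp add: f(1))
        then obtain v where "w n = f n v" "v \<in> mspace X" by (rule imageE)
        then show ?thesis by (intro bexI[of _ v]) simp_all
      qed
      then obtain v where v: "\<And>n. v n \<in> mspace X" "\<And>n. f n (v n) = w n" by metis
      then have \<Phi>v: "\<Phi> v = w" by (auto simp: \<Phi>_def)
      have "v \<in> cseqs"
        using iso[of v x] v(1) m[OF x(1)] cone_dist_finite[OF uf sc ob w(1) y(1)] \<Phi>v \<Phi>x
        by (intro cone_sequencesI[OF v(1) x(1)]) simp
      then show "B' \<in> ?\<phi> ` mspace acone" using \<phi>[of v] \<Phi>v w(2) cls_in
        by (intro image_eqI[of _ _ "cpoint v"]) simp_all
    qed
  qed
  moreover have "mdist acone (?\<phi> U) (?\<phi> V) = mdist acone U V" if "U \<in> mspace acone" "V \<in> mspace acone" for U V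
  proof -
    have r: "rep U \<in> cseqs" "U = cpoint (rep U)" "rep V \<in> cseqs" "V = cpoint (rep V)" using rep that by blast+
    have "ereal (mdist acone (?\<phi> U) (?\<phi> V)) = ereal (mdist acone (cpoint (rep U)) (cpoint (rep V)))"
      unfolding mdist_asymptotic_cone[OF uf sc ob \<Phi>cseqs[OF r(1)] \<Phi>cseqs[OF r(3)]]
        mdist_asymptotic_cone[OF uf sc ob r(1) r(3)] by (rule iso[OF m[OF r(1)] m[OF r(3)]])
    then show ?thesis using r by simp
  qed
  moreover have "?\<phi> A = B" using \<phi>[OF x(1)] x y \<Phi>x by simp
  ultimately show "\<exists>f. f ` mspace acone = mspace acone \<and>
      (\<forall>u\<in>mspace acone. \<forall>v\<in>mspace acone. mdist acone (f u) (f v) = mdist acone u v) \<and> f A = B"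
    by (intro exI[of _ ?\<phi>]) blast
qed

end

section \<open>Word metrics\<close>

context group
begin

text \<open>The distance of \<open>u\<close> and \<open>v\<close> depends only on
  \<open>inv u \<otimes> v\<close>, which left translations preserve.\<close>

lemma word_metric_homogeneous:
  assumes S: "finite_generating_set G S"
  shows "homogeneous_metric (word_metric G S)"
  unfolding homogeneous_metric_def mspace_word_metric[OF S]
proof (intro ballI)
  fix x y assume xy: "x \<in> carrier G" "y \<in> carrier G"
  let ?k = "y \<otimes> inv x"
  have k: "?k \<in> carrier G" using xy by simp
  have "mdist (word_metric G S) (?k \<otimes> u) (?k \<otimes> v) = mdist (word_metric G S) u v"
    if uv: "u \<in> carrier G" "v \<in> carrier G" for u v
  proof -
    have "inv (?k \<otimes> u) \<otimes> (?k \<otimes> v) = inv u \<otimes> v"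
      using uv k by (simp add: inv_mult_group m_assoc inv_solve_left' del: inv_inv)
    then show ?thesis using uv k by (simp add: mdist_word_metric[OF S])
  qed
  moreover have "(\<lambda>u. ?k \<otimes> u) ` carrier G = carrier G"
    by (rule surj_const_mult[OF k])
  moreover have "?k \<otimes> x = y" using xy by (simp add: m_assoc)
  ultimately show "\<exists>f. f ` carrier G = carrier G \<and>
      (\<forall>u\<in>carrier G. \<forall>v\<in>carrier G. mdist (word_metric G S) (f u) (f v) = mdist (word_metric G S) u v) \<and> f x = y"
    by (intro exI[of _ "\<lambda>u. ?k \<otimes> u"]) blast
qed

text \<open>The points are the translates by \<open>x\<close> of the prefixes of a shortest word for
  \<open>inv x \<otimes> y\<close>. Two of them cannot be closer than the number of letters between
  them, since the triangle inequality would then make \<open>x\<close> and \<open>y\<close> closer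
  than they are.\<close>

lemma word_metric_discretely_geodesic:
  assumes S: "finite_generating_set G S"
  shows "discretely_geodesic (word_metric G S)"
  unfolding discretely_geodesic_def mspace_word_metric[OF S]
proof (intro ballI)
  fix x y assume xy: "x \<in> carrier G" "y \<in> carrier G"
  have Sc: "S \<subseteq> carrier G" using S by (simp add: finite_generating_set_def)
  let ?d = "mdist (word_metric G S)"
  obtain ws where ws: "ws \<in> words_over G S" "length ws = word_length G S (inv x \<otimes> y)"
    "word_value G ws = inv x \<otimes> y"
    using word_length_attained[OF S, of "inv x \<otimes> y"] xy by auto
  let ?L = "length ws" and ?p = "\<lambda>i. x \<otimes> word_value G (take i ws)"
  have sub: "us \<in> words_over G S" if "set us \<subseteq> set ws" for us
    using that ws(1) by (auto simp: words_over_def in_lists_conv_set)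
  have wc: "word_value G us \<in> carrier G" if "set us \<subseteq> set ws" for us
    using word_value_closed words_over_carrier[OF Sc sub[OF that]] by blast
  have pc: "?p i \<in> carrier G" for i using xy wc[of "take i ws"] set_take_subset by fastforce
  have p0: "?p 0 = x" using xy by (simp add: word_value_def)
  have pL: "?p ?L = y" using xy by (simp add: ws(3) m_assoc[symmetric])
  have xyL: "?d x y = real ?L" using xy ws(2) by (simp add: mdist_word_metric[OF S])
  have le: "?d (?p i) (?p j) \<le> real j - real i" if ij: "i \<le> j" "j \<le> ?L" for i j
  proof -
    let ?u = "take i ws" and ?v = "drop i (take j ws)"
    have uv: "take j ws = ?u @ ?v" using ij by (metis append_take_drop_id min.absorb1 take_take)
    have su: "set ?u \<subseteq> set ws" "set ?v \<subseteq> set ws"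
      by (rule set_take_subset) (meson order_trans set_drop_subset set_take_subset)
    have c: "set ?u \<subseteq> carrier G" "set ?v \<subseteq> carrier G"
      using words_over_carrier[OF Sc sub] su by blast+
    have "word_value G (take j ws) = word_value G ?u \<otimes> word_value G ?v"
      by (subst uv) (rule word_value_append[OF c])
    then have "?p j = ?p i \<otimes> word_value G ?v"
      using xy wc[OF su(1)] wc[OF su(2)] by (simp add: m_assoc)
    then have "inv (?p i) \<otimes> ?p j = word_value G ?v"
      using pc[of i] wc[OF su(2)] by (simp add: m_assoc[symmetric])
    then have "?d (?p i) (?p j) = real (word_length G S (word_value G ?v))"
      using pc by (simp add: mdist_word_metric[OF S])
    also have "\<dots> \<le> real (length ?v)" using word_length_le[OF sub[OF su(2)]] by simp
    also have "\<dots> = real j - real i" using ij by (simp add: of_nat_diff)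
    finally show ?thesis .
  qed
  have eq: "?d (?p i) (?p j) = real j - real i" if ij: "i \<le> j" "j \<le> ?L" for i j
  proof (rule antisym[OF le[OF ij]])
    have m: "?p k \<in> mspace (word_metric G S)" for k using pc by (simp add: mspace_word_metric[OF S])
    have "?d (?p 0) (?p ?L) \<le> ?d (?p 0) (?p i) + (?d (?p i) (?p j) + ?d (?p j) (?p ?L))"
    proof -
      have "?d (?p 0) (?p ?L) \<le> ?d (?p 0) (?p i) + ?d (?p i) (?p ?L)"
        "?d (?p i) (?p ?L) \<le> ?d (?p i) (?p j) + ?d (?p j) (?p ?L)"
        by (rule mdist_triangle[OF m m m])+
      then show ?thesis by linarith
    qed
    then show "real j - real i \<le> ?d (?p i) (?p j)"
      using le[of 0 i] le[of j ?L] ij xyL unfolding p0 pL by simp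
  qed
  have "?d (?p i) (?p j) = \<bar>real i - real j\<bar>" if "i \<le> ?L" "j \<le> ?L" for i j
    using eq[of i j] eq[of j i] that mdist_commute[of "word_metric G S" "?p i" "?p j"]
    by (cases "i \<le> j") auto
  then show "\<exists>L p. p 0 = x \<and> p L = y \<and> (\<forall>i\<le>L. p i \<in> carrier G) \<and>
      (\<forall>i\<le>L. \<forall>j\<le>L. ?d (p i) (p j) = \<bar>real i - real j\<bar>)"
    using p0 pL pc by (intro exI[of _ ?L] exI[of _ ?p]) blast
qed

lemma asymptotic_cone_dichotomy:
  assumes "C \<in> asymptotic_cones G" "has_global_cut_point (mtopology_of C)"
  shows "simply_connected_space (mtopology_of C) \<or>
    (\<forall>x\<in>mspace C. has_uncountably_generated_free_subgroup (fundamental_group (mtopology_of C) x))"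
proof -
  obtain S \<omega> e d where C: "C = asymptotic_cone (word_metric G S) \<omega> e d" "finite_generating_set G S"
    "ultrafilter \<omega>" "observation_sequence (word_metric G S) e" "scaling_sequence \<omega> d"
    using assms(1) unfolding asymptotic_cones_def by blast
  have "geodesic_metric C" "homogeneous_metric C"
    unfolding C(1)
    using geodesic_cone[OF C(3,5,4) word_metric_discretely_geodesic[OF C(2)]]
      homogeneous_cone[OF C(3,5,4) word_metric_homogeneous[OF C(2)]] by auto
  then show ?thesis using homogeneous_geodesic_cut_point_dichotomy assms(2) by blast
qed

end

text \<open>The free subgroup is asserted at every base point, so the alternative involves no choice
  of base point.\<close>

theorem corollary2p23:
  fixes G :: "('a, 'b) monoid_scheme"
  assumes "group G" and "finitely_generated G"
  shows
    "(constricted G \<longrightarrow>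
        (\<forall>C \<in> asymptotic_cones G.
           simply_connected_space (mtopology_of C) \<or>
           (\<forall>x \<in> mspace C.
              has_uncountably_generated_free_subgroup (fundamental_group (mtopology_of C) x)))) \<and>
     (\<not> wide G \<longrightarrow>
        (\<exists>C \<in> asymptotic_cones G.
           simply_connected_space (mtopology_of C) \<or>
           (\<forall>x \<in> mspace C.
              has_uncountably_generated_free_subgroup (fundamental_group (mtopology_of C) x))))"
  using group.asymptotic_cone_dichotomy[OF assms(1)] unfolding constricted_def wide_def by blast

end
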